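(* Let $G$ be a discrete group, let $\mathcal{A}=\bigoplus_{g\in G}\mathcal{A}_g$ be a unital $G$-graded $*$-algebra and let $H$ be a subgroup of $G$. Suppose that $\pi$ is a closed $*$-representation of $\mathcal{A}$ and that $(\pi,E)$ is a non-degenerate system of imprimitivity for $\mathcal{A}$ over $G/H$. Then there exists a unique, up to unitary equivalence, closed $*$-representation $\rho$ of $\mathcal{A}_H$ such that (i) $\rho$ is inducible (from $\mathcal{A}_H$ to $\mathcal{A}$), and (ii) $(\pi,E)$ is unitarily equivalent to the system of imprimitivity induced by $\rho$.
   Context: A $*$-algebra is a complex associative algebra with involution. A $*$-representation $\pi$ of a $*$-algebra $\mathcal{A}$ on a dense linear subspace $\mathcal{D}(\pi)$ of a Hilbert space $\mathcal{H}_\pi$ is an algebra homomorphism of $\mathcal{A}$ into the linear operators on $\mathcal{D}(\pi)$ with $\langle\pi(a)\varphi,\psi\rangle=\langle\varphi,\pi(a^* )\psi\rangle$ for $a\in\mathcal{A}$, $\varphi,\psi\in\mathcal{D}(\pi)$. Two $*$-representations $\pi_1,\pi_2$ are unitarily equivalent if there is an isometric linear map $U$ of $\mathcal{D}(\pi_1)$ onto $\mathcal{D}(\pi_2)$ with $\pi_2(a)=U\pi_1(a)U^{-1}$ for all $a\in\mathcal{A}$. The graph topology of $\pi$ is the locally convex topology on $\mathcal{D}(\pi)$ given by the norms $\varphi\mapsto\|\varphi\|+\|\pi(a)\varphi\|$, $a\in\mathcal{A}$; $\pi$ is closed if $\mathcal{D}(\pi)$ is complete in it; the closure of $\pi$ is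 the extension of $\pi$ by continuity to the completion of $\mathcal{D}(\pi)$ in the graph topology. Grading: $\mathcal{A}_g\mathcal{A}_h\subseteq\mathcal{A}_{gh}$ and $(\mathcal{A}_g)^*\subseteq\mathcal{A}_{g^{-1}}$ for $g,h\in G$. For $X\subseteq G$ put $\mathcal{A}_X=\bigoplus_{g\in X}\mathcal{A}_g$; $\mathcal{A}_H$ is a $*$-subalgebra, and $p_H:\mathcal{A}\to\mathcal{A}_H$ is the projection $\sum_{g\in G} a_g\mapsto\sum_{g\in H}a_g$. $G/H$ is the set of left cosets; a coset $t\in G/H$ is also regarded as a subset of $G$. Induction: for a $*$-representation $\rho$ of $\mathcal{A}_H$, let $\mathcal{A}\otimes_{\mathcal{A}_H}\mathcal{D}(\rho)$ be the quotient of the complex tensor product $\mathcal{A}\otimes\mathcal{D}(\rho)$ by the span of the vectors $ab\otimes\varphi-a\otimes\rho(b)\varphi$ ($a\in\mathcal{A}$, $b\in\mathcal{A}_H$, $\varphi\in\mathcal{D}(\rho)$), and define a Hermitian sesquilinear form on it by $\langle a_1\otimes v_1,a_2\otimes v_2\rangle_0=\langle\rho(p_H(a_2^*a_1))v_1,v_2\rangle$. $\rho$ is inducible if this form is nonnegative. Then, with $\mathcal{K}_\rho=\{\eta:\langle\eta,\eta\rangle_0=0\}$ and $[\eta]=\eta+\mathcal{K}_\rho$, the induced representation $\mathrm{Ind}\,\rho=\mathrm{Ind}_{\mathcal{A}_H\uparrow\mathcal{A}}\rho$ is the closure of the $*$-representation $a\mapsto([b\otimes v]\mapsto[ab\otimes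 v])$ on the pre-Hilbert space $(\mathcal{A}\otimes_{\mathcal{A}_H}\mathcal{D}(\rho))/\mathcal{K}_\rho$. A system of imprimitivity for $\mathcal{A}$ over $G/H$ is a pair $(\pi,E)$ of a $*$-representation $\pi$ of $\mathcal{A}$ and a map $E$ from $G/H$ to the projections of $\mathcal{H}_\pi$ such that $E(t_1)E(t_2)=0$ for $t_1\ne t_2$, $\sum_{t\in G/H}E(t)=I$, and $E(gt)\pi(a_g)\subseteq\pi(a_g)E(t)$ for all $g\in G$, $t\in G/H$, $a_g\in\mathcal{A}_g$. Put $\mathcal{D}_t(\pi)=\mathrm{Ran}\,E(t)\cap\mathcal{D}(\pi)$. The system is non-degenerate if for every $t\in G/H$ the linear span of $\pi(\mathcal{A}_t)\mathcal{D}_H(\pi)$ is dense in $\mathcal{D}_t(\pi)$ in the graph topology of $\pi$. Two systems $(\pi_1,E_1)$, $(\pi_2,E_2)$ are unitarily equivalent if there is a unitary implementing a unitary equivalence of $\pi_1$ and $\pi_2$ and intertwining $E_1(t)$ and $E_2(t)$ for all $t$. The system of imprimitivity induced by a (non-zero) inducible $\rho$ is $(\mathrm{Ind}\,\rho,E)$, where $E(t)$ is the orthogonal projection onto the closure of the span of all $[a_t\otimes v]$, $a_t\in\mathcal{A}_t$, $v\in\mathcal{D}(\rho)$.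
   Formalization: *-representations are required to be unital (π(1) and ρ(1) act as the identity on the domain); without this uniqueness fails, since ρ ⊕ 0 induces the same system as ρ; for π it already follows from non-degeneracy. *)

theory Defs
  imports
    "HOL-Analysis.Analysis"
    "HOL-Library.Poly_Mapping"
    "HOL-Algebra.Algebra"
    "HOL-Algebra.Algebraic_Closure_Type"
begin

abbreviation complex_ring :: "complex ring" where
  "complex_ring \<equiv> ring_of_type_algebra"

definition lspan :: "((complex, 'v, 'm) module_scheme) \<Rightarrow> 'v set \<Rightarrow> 'v set" where
  "lspan V S = (\<lambda>U. submodule U complex_ring V) hull S"

definition linear_on ::
  "'v set \<Rightarrow> (complex, 'v, 'm) module_scheme \<Rightarrow> (complex, 'w, 'n) module_scheme \<Rightarrow> ('v \<Rightarrow> 'w) \<Rightarrow> bool"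
where
  "linear_on S V W T \<longleftrightarrow>
     (\<forall>x\<in>S. \<forall>y\<in>S. T (x \<oplus>\<^bsub>V\<^esub> y) = T x \<oplus>\<^bsub>W\<^esub> T y) \<and>
     (\<forall>c. \<forall>x\<in>S. T (c \<odot>\<^bsub>V\<^esub> x) = c \<odot>\<^bsub>W\<^esub> T x)"


section \<open>Complex inner product spaces on a carrier set\<close>

text \<open>
  As in every record extending \<^type>\<open>module\<close>, the fields \<^const>\<open>monoid.mult\<close> and \<^const>\<open>monoid.one\<close> are
  irrelevant for an inner product space.  The inner product is linear in the first argument.
  The record is also used for spaces whose form is merely sesquilinear, or only positive
  semidefinite; positive definiteness is imposed by the locale \<open>pre_hilbert\<close>.
\<close>

record 'v inner_space = "(complex, 'v) module" +
  cinner :: "'v \<Rightarrow> 'v \<Rightarrow> complex"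

definition hnorm :: "'v inner_space \<Rightarrow> 'v \<Rightarrow> real" where
  "hnorm V x = sqrt (Re (cinner V x x))"

text \<open>Outside the carrier the distance is set to \<open>0\<close>, because \<^locale>\<open>Metric_space\<close> requires
  nonnegativity and symmetry on the whole type.\<close>

definition hdist :: "'v inner_space \<Rightarrow> 'v \<Rightarrow> 'v \<Rightarrow> real" where
  "hdist V x y = (if x \<in> carrier V \<and> y \<in> carrier V then hnorm V (x \<ominus>\<^bsub>V\<^esub> y) else 0)"

definition htopology :: "'v inner_space \<Rightarrow> 'v topology" where
  "htopology V = Metric_space.mtopology (carrier V) (hdist V)"

locale pre_hilbert = Module.module complex_ring V for V :: "'v inner_space" (structure) +
  assumes cinner_add_left:
      "\<lbrakk>x \<in> carrier V; y \<in> carrier V; z \<in> carrier V\<rbrakk>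
        \<Longrightarrow> cinner V (x \<oplus> y) z = cinner V x z + cinner V y z"
    and cinner_smult_left:
      "\<lbrakk>x \<in> carrier V; z \<in> carrier V\<rbrakk> \<Longrightarrow> cinner V (c \<odot> x) z = c * cinner V x z"
    and cinner_commute:
      "\<lbrakk>x \<in> carrier V; y \<in> carrier V\<rbrakk> \<Longrightarrow> cinner V y x = cnj (cinner V x y)"
    and cinner_nonneg: "x \<in> carrier V \<Longrightarrow> 0 \<le> Re (cinner V x x)"
    and cinner_definite: "\<lbrakk>x \<in> carrier V; cinner V x x = 0\<rbrakk> \<Longrightarrow> x = \<zero>"

locale hilbert = pre_hilbert +
  assumes complete: "Metric_space.mcomplete (carrier V) (hdist V)"

definition is_projection :: "'v inner_space \<Rightarrow> ('v \<Rightarrow> 'v) \<Rightarrow> bool" where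
  "is_projection V P \<longleftrightarrow>
     P \<in> carrier V \<rightarrow> carrier V \<and> linear_on (carrier V) V V P \<and>
     (\<forall>x\<in>carrier V. P (P x) = P x) \<and>
     (\<forall>x\<in>carrier V. \<forall>y\<in>carrier V. cinner V (P x) y = cinner V x (P y))"

definition orth_proj :: "'v inner_space \<Rightarrow> 'v set \<Rightarrow> 'v \<Rightarrow> 'v" where
  "orth_proj V M x = (THE y. y \<in> M \<and> (\<forall>z\<in>M. cinner V (x \<ominus>\<^bsub>V\<^esub> y) z = 0))"

definition isometry_onto ::
  "'v inner_space \<Rightarrow> 'v set \<Rightarrow> 'w inner_space \<Rightarrow> 'w set \<Rightarrow> ('v \<Rightarrow> 'w) \<Rightarrow> bool"
where
  "isometry_onto V S W Y U \<longleftrightarrow>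
     linear_on S V W U \<and> (\<forall>x\<in>S. hnorm W (U x) = hnorm V x) \<and> U ` S = Y"


subsection \<open>Quotients and completion\<close>

text \<open>Quotient by a subspace \<open>K\<close>, with the form induced on cosets; the form makes sense if that of
  \<open>V\<close> does not depend on representatives modulo \<open>K\<close>.\<close>

definition quotient_space :: "'v inner_space \<Rightarrow> 'v set \<Rightarrow> 'v set inner_space" where
  "quotient_space V K =
     \<lparr>carrier = a_rcosets\<^bsub>V\<^esub> K, monoid.mult = undefined, monoid.one = undefined, ring.zero = K,
      add = (\<lambda>C D. C <+>\<^bsub>V\<^esub> D),
      smult = (\<lambda>c C. \<Union>x\<in>C. K +>\<^bsub>V\<^esub> (c \<odot>\<^bsub>V\<^esub> x)),
      cinner = (\<lambda>C D. the_elem {cinner V x y |x y. x \<in> C \<and> y \<in> D})\<rparr>"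

definition null_vectors :: "'v inner_space \<Rightarrow> 'v set" where
  "null_vectors V = {x \<in> carrier V. cinner V x x = 0}"

definition separated :: "'v inner_space \<Rightarrow> 'v set inner_space" where
  "separated V = quotient_space V (null_vectors V)"

definition sep_class :: "'v inner_space \<Rightarrow> 'v \<Rightarrow> 'v set" where
  "sep_class V x = null_vectors V +>\<^bsub>V\<^esub> x"

text \<open>The Hilbert space completion consists of the Cauchy sequences modulo the null sequences;
  the latter are the null vectors of the limit of the inner products.\<close>

definition cauchy_space :: "'v inner_space \<Rightarrow> (nat \<Rightarrow> 'v) inner_space" where
  "cauchy_space V =
     \<lparr>carrier = {s. Metric_space.MCauchy (carrier V) (hdist V) s},
      monoid.mult = undefined, monoid.one = undefined, ring.zero = (\<lambda>n. \<zero>\<^bsub>V\<^esub>),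
      add = (\<lambda>s t n. s n \<oplus>\<^bsub>V\<^esub> t n),
      smult = (\<lambda>c s n. c \<odot>\<^bsub>V\<^esub> s n),
      cinner = (\<lambda>s t. lim (\<lambda>n. cinner V (s n) (t n)))\<rparr>"

definition completion :: "'v inner_space \<Rightarrow> (nat \<Rightarrow> 'v) set inner_space" where
  "completion V = separated (cauchy_space V)"

definition completion_embed :: "'v inner_space \<Rightarrow> 'v \<Rightarrow> (nat \<Rightarrow> 'v) set" where
  "completion_embed V x = sep_class (cauchy_space V) (\<lambda>n. x)"


section \<open>Graded star-algebras\<close>

record 'a star_alg = "(complex, 'a) module" +
  star :: "'a \<Rightarrow> 'a"

locale star_algebra = Module.module complex_ring A + ring A for A :: "'a star_alg" (structure) +
  assumes smult_mult_left:
      "\<lbrakk>x \<in> carrier A; y \<in> carrier A\<rbrakk> \<Longrightarrow> (c \<odot> x) \<otimes> y = c \<odot> (x \<otimes> y)"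
    and smult_mult_right:
      "\<lbrakk>x \<in> carrier A; y \<in> carrier A\<rbrakk> \<Longrightarrow> x \<otimes> (c \<odot> y) = c \<odot> (x \<otimes> y)"
    and star_closed: "x \<in> carrier A \<Longrightarrow> star A x \<in> carrier A"
    and star_star: "x \<in> carrier A \<Longrightarrow> star A (star A x) = x"
    and star_add:
      "\<lbrakk>x \<in> carrier A; y \<in> carrier A\<rbrakk> \<Longrightarrow> star A (x \<oplus> y) = star A x \<oplus> star A y"
    and star_smult: "x \<in> carrier A \<Longrightarrow> star A (c \<odot> x) = cnj c \<odot> star A x"
    and star_mult:
      "\<lbrakk>x \<in> carrier A; y \<in> carrier A\<rbrakk> \<Longrightarrow> star A (x \<otimes> y) = star A y \<otimes> star A x"

text \<open>In HOL-Algebra \<^const>\<open>finsum\<close> over an infinite set is zero by convention, hence the explicit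
  restriction to the (finite) support.\<close>

definition is_decomposition ::
  "('g, 'm) monoid_scheme \<Rightarrow> 'a star_alg \<Rightarrow> ('g \<Rightarrow> 'a set) \<Rightarrow> 'a \<Rightarrow> ('g \<Rightarrow> 'a) \<Rightarrow> bool"
where
  "is_decomposition G A \<A> a f \<longleftrightarrow>
     f \<in> (\<Pi>\<^sub>E g\<in>carrier G. \<A> g) \<and>
     finite {g \<in> carrier G. f g \<noteq> \<zero>\<^bsub>A\<^esub>} \<and>
     a = (\<Oplus>\<^bsub>A\<^esub>g\<in>{g \<in> carrier G. f g \<noteq> \<zero>\<^bsub>A\<^esub>}. f g)"

locale graded_star_algebra = star_algebra A
  for G :: "('g, 'm) monoid_scheme" and A :: "'a star_alg" and \<A> :: "'g \<Rightarrow> 'a set" +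
  assumes grade_submodule: "g \<in> carrier G \<Longrightarrow> submodule (\<A> g) complex_ring A"
    and direct_sum: "a \<in> carrier A \<Longrightarrow> \<exists>!f. is_decomposition G A \<A> a f"
    and grade_mult:
      "\<lbrakk>g \<in> carrier G; h \<in> carrier G; a \<in> \<A> g; b \<in> \<A> h\<rbrakk>
        \<Longrightarrow> a \<otimes>\<^bsub>A\<^esub> b \<in> \<A> (g \<otimes>\<^bsub>G\<^esub> h)"
    and grade_star: "\<lbrakk>g \<in> carrier G; a \<in> \<A> g\<rbrakk> \<Longrightarrow> star A a \<in> \<A> (inv\<^bsub>G\<^esub> g)"

definition component ::
  "('g, 'm) monoid_scheme \<Rightarrow> 'a star_alg \<Rightarrow> ('g \<Rightarrow> 'a set) \<Rightarrow> 'a \<Rightarrow> 'g \<Rightarrow> 'a"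
where
  "component G A \<A> a = (THE f. is_decomposition G A \<A> a f)"

definition graded_part :: "'a star_alg \<Rightarrow> ('g \<Rightarrow> 'a set) \<Rightarrow> 'g set \<Rightarrow> 'a set" where
  "graded_part A \<A> S =
     {a. \<exists>F f. finite F \<and> F \<subseteq> S \<and> f \<in> (\<Pi> g\<in>F. \<A> g) \<and> a = (\<Oplus>\<^bsub>A\<^esub>g\<in>F. f g)}"

definition graded_proj ::
  "('g, 'm) monoid_scheme \<Rightarrow> 'a star_alg \<Rightarrow> ('g \<Rightarrow> 'a set) \<Rightarrow> 'g set \<Rightarrow> 'a \<Rightarrow> 'a"
where
  "graded_proj G A \<A> S a =
     (\<Oplus>\<^bsub>A\<^esub>g\<in>{g \<in> S. component G A \<A> a g \<noteq> \<zero>\<^bsub>A\<^esub>}. component G A \<A> a g)"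

definition graded_subalgebra :: "'a star_alg \<Rightarrow> ('g \<Rightarrow> 'a set) \<Rightarrow> 'g set \<Rightarrow> 'a star_alg" where
  "graded_subalgebra A \<A> H = A\<lparr>carrier := graded_part A \<A> H\<rparr>"


section \<open>Star-representations\<close>

text \<open>\<open>rep_space\<close> is the Hilbert space, \<open>rep_dom\<close> the dense domain; operators only matter on the
  domain.  Homomorphisms of unital algebras are unital, so \<open>\<pi>(1)\<close> is the identity on the domain.
  The zero space is admitted.\<close>

record ('a, 'h) rep =
  rep_space :: "'h inner_space"
  rep_dom :: "'h set"
  rep_op :: "'a \<Rightarrow> 'h \<Rightarrow> 'h"

locale star_rep =
  fixes B :: "'a star_alg" and \<pi> :: "('a, 'h) rep"
  assumes hilbert_space: "hilbert (rep_space \<pi>)"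
    and dom_subspace: "submodule (rep_dom \<pi>) complex_ring (rep_space \<pi>)"
    and dom_dense: "htopology (rep_space \<pi>) closure_of rep_dom \<pi> = carrier (rep_space \<pi>)"
    and op_closed: "\<lbrakk>a \<in> carrier B; \<phi> \<in> rep_dom \<pi>\<rbrakk> \<Longrightarrow> rep_op \<pi> a \<phi> \<in> rep_dom \<pi>"
    and op_linear:
      "a \<in> carrier B \<Longrightarrow> linear_on (rep_dom \<pi>) (rep_space \<pi>) (rep_space \<pi>) (rep_op \<pi> a)"
    and op_add:
      "\<lbrakk>a \<in> carrier B; b \<in> carrier B; \<phi> \<in> rep_dom \<pi>\<rbrakk>
        \<Longrightarrow> rep_op \<pi> (a \<oplus>\<^bsub>B\<^esub> b) \<phi> = rep_op \<pi> a \<phi> \<oplus>\<^bsub>rep_space \<pi>\<^esub> rep_op \<pi> b \<phi>"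
    and op_smult:
      "\<lbrakk>a \<in> carrier B; \<phi> \<in> rep_dom \<pi>\<rbrakk>
        \<Longrightarrow> rep_op \<pi> (c \<odot>\<^bsub>B\<^esub> a) \<phi> = c \<odot>\<^bsub>rep_space \<pi>\<^esub> rep_op \<pi> a \<phi>"
    and op_mult:
      "\<lbrakk>a \<in> carrier B; b \<in> carrier B; \<phi> \<in> rep_dom \<pi>\<rbrakk>
        \<Longrightarrow> rep_op \<pi> (a \<otimes>\<^bsub>B\<^esub> b) \<phi> = rep_op \<pi> a (rep_op \<pi> b \<phi>)"
    and op_one: "\<phi> \<in> rep_dom \<pi> \<Longrightarrow> rep_op \<pi> \<one>\<^bsub>B\<^esub> \<phi> = \<phi>"
    and op_adjoint:
      "\<lbrakk>a \<in> carrier B; \<phi> \<in> rep_dom \<pi>; \<psi> \<in> rep_dom \<pi>\<rbrakk>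
        \<Longrightarrow> cinner (rep_space \<pi>) (rep_op \<pi> a \<phi>) \<psi> =
            cinner (rep_space \<pi>) \<phi> (rep_op \<pi> (star B a) \<psi>)"

definition implements_equivalence ::
  "'a star_alg \<Rightarrow> ('a, 'h) rep \<Rightarrow> ('a, 'k) rep \<Rightarrow> ('h \<Rightarrow> 'k) \<Rightarrow> bool"
where
  "implements_equivalence B \<pi>1 \<pi>2 U \<longleftrightarrow>
     isometry_onto (rep_space \<pi>1) (rep_dom \<pi>1) (rep_space \<pi>2) (rep_dom \<pi>2) U \<and>
     (\<forall>a\<in>carrier B. \<forall>\<psi>\<in>rep_dom \<pi>2.
        rep_op \<pi>2 a \<psi> = U (rep_op \<pi>1 a (inv_into (rep_dom \<pi>1) U \<psi>)))"

definition unitarily_equivalent :: "'a star_alg \<Rightarrow> ('a, 'h) rep \<Rightarrow> ('a, 'k) rep \<Rightarrow> bool" where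
  "unitarily_equivalent B \<pi>1 \<pi>2 \<longleftrightarrow> (\<exists>U. implements_equivalence B \<pi>1 \<pi>2 U)"


subsection \<open>Graph topology, closedness, closure\<close>

definition graph_norm :: "('a, 'h) rep \<Rightarrow> 'a \<Rightarrow> 'h \<Rightarrow> real" where
  "graph_norm \<pi> a \<phi> = hnorm (rep_space \<pi>) \<phi> + hnorm (rep_space \<pi>) (rep_op \<pi> a \<phi>)"

definition graph_topology :: "'a star_alg \<Rightarrow> ('a, 'h) rep \<Rightarrow> 'h topology" where
  "graph_topology B \<pi> = topology_generated_by
     {{\<psi> \<in> rep_dom \<pi>. graph_norm \<pi> a (\<psi> \<ominus>\<^bsub>rep_space \<pi>\<^esub> \<phi>) < \<epsilon>} |a \<phi> \<epsilon>.
        a \<in> carrier B \<and> \<phi> \<in> rep_dom \<pi> \<and> 0 < \<epsilon>}"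

text \<open>The graph topology need not be metrizable, so completeness is expressed with Cauchy filters
  rather than Cauchy sequences.\<close>

definition graph_cauchy :: "'a star_alg \<Rightarrow> ('a, 'h) rep \<Rightarrow> 'h filter \<Rightarrow> bool" where
  "graph_cauchy B \<pi> F \<longleftrightarrow>
     F \<noteq> bot \<and> (\<forall>\<^sub>F \<phi> in F. \<phi> \<in> rep_dom \<pi>) \<and>
     (\<forall>a\<in>carrier B. \<forall>\<epsilon>>0.
        \<forall>\<^sub>F (\<phi>, \<psi>) in F \<times>\<^sub>F F. graph_norm \<pi> a (\<phi> \<ominus>\<^bsub>rep_space \<pi>\<^esub> \<psi>) < \<epsilon>)"

definition closed_rep :: "'a star_alg \<Rightarrow> ('a, 'h) rep \<Rightarrow> bool" where
  "closed_rep B \<pi> \<longleftrightarrow>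
     (\<forall>F. graph_cauchy B \<pi> F \<longrightarrow> (\<exists>\<phi>. limitin (graph_topology B \<pi>) (\<lambda>x. x) \<phi> F))"

text \<open>Every operator of a star-representation is closable, so the completion of the domain in the
  graph topology is canonically the subspace of those vectors of the Hilbert space that are norm
  limits of graph-Cauchy filters, and the operators extend to it by continuity.\<close>

definition rep_closure :: "'a star_alg \<Rightarrow> ('a, 'h) rep \<Rightarrow> ('a, 'h) rep" where
  "rep_closure B \<pi> =
     \<lparr>rep_space = rep_space \<pi>,
      rep_dom = {\<phi>. \<exists>F. graph_cauchy B \<pi> F \<and> limitin (htopology (rep_space \<pi>)) (\<lambda>x. x) \<phi> F},
      rep_op = (\<lambda>a \<phi>. THE \<psi>.
        \<forall>F. graph_cauchy B \<pi> F \<and> limitin (htopology (rep_space \<pi>)) (\<lambda>x. x) \<phi> F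
          \<longrightarrow> limitin (htopology (rep_space \<pi>)) (rep_op \<pi> a) \<psi> F)\<rparr>"


section \<open>Induced representations\<close>

text \<open>The free vector space on \<open>A \<times> D(\<rho>)\<close>; \<open>single (a, v) 1\<close> is the generator that becomes
  \<open>a \<otimes> v\<close> in the tensor product, and the form is the sesquilinear extension of
  \<open>\<langle>a\<^sub>1 \<otimes> v\<^sub>1, a\<^sub>2 \<otimes> v\<^sub>2\<rangle> = \<langle>\<rho>(p\<^sub>H(a\<^sub>2\<^sup>* a\<^sub>1)) v\<^sub>1, v\<^sub>2\<rangle>\<close>.\<close>

definition free_tensor ::
  "('g, 'm) monoid_scheme \<Rightarrow> 'g set \<Rightarrow> 'a star_alg \<Rightarrow> ('g \<Rightarrow> 'a set) \<Rightarrow> ('a, 'h) rep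
    \<Rightarrow> ('a \<times> 'h \<Rightarrow>\<^sub>0 complex) inner_space"
where
  "free_tensor G H A \<A> \<rho> =
     \<lparr>carrier = {f. Poly_Mapping.keys f \<subseteq> carrier A \<times> rep_dom \<rho>},
      monoid.mult = undefined, monoid.one = undefined, ring.zero = 0, add = (+),
      smult = (\<lambda>c. Poly_Mapping.map ((*) c)),
      cinner = (\<lambda>f g. \<Sum>(a1, v1)\<in>Poly_Mapping.keys f. \<Sum>(a2, v2)\<in>Poly_Mapping.keys g.
         Poly_Mapping.lookup f (a1, v1) * cnj (Poly_Mapping.lookup g (a2, v2)) *
         cinner (rep_space \<rho>)
           (rep_op \<rho> (graded_proj G A \<A> H (star A a2 \<otimes>\<^bsub>A\<^esub> a1)) v1) v2)\<rparr>"

definition bilinear_relations ::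
  "'a star_alg \<Rightarrow> ('a, 'h) rep \<Rightarrow> ('a \<times> 'h \<Rightarrow>\<^sub>0 complex) set"
where
  "bilinear_relations A \<rho> =
     {Poly_Mapping.single (a \<oplus>\<^bsub>A\<^esub> b, v) 1 - Poly_Mapping.single (a, v) 1
        - Poly_Mapping.single (b, v) 1
       |a b v. a \<in> carrier A \<and> b \<in> carrier A \<and> v \<in> rep_dom \<rho>} \<union>
     {Poly_Mapping.single (a, v \<oplus>\<^bsub>rep_space \<rho>\<^esub> w) 1 - Poly_Mapping.single (a, v) 1
        - Poly_Mapping.single (a, w) 1
       |a v w. a \<in> carrier A \<and> v \<in> rep_dom \<rho> \<and> w \<in> rep_dom \<rho>} \<union>
     {Poly_Mapping.single (c \<odot>\<^bsub>A\<^esub> a, v) 1 - Poly_Mapping.single (a, v) c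
       |c a v. a \<in> carrier A \<and> v \<in> rep_dom \<rho>} \<union>
     {Poly_Mapping.single (a, c \<odot>\<^bsub>rep_space \<rho>\<^esub> v) 1 - Poly_Mapping.single (a, v) c
       |c a v. a \<in> carrier A \<and> v \<in> rep_dom \<rho>}"

definition balanced_relations ::
  "'g set \<Rightarrow> 'a star_alg \<Rightarrow> ('g \<Rightarrow> 'a set) \<Rightarrow> ('a, 'h) rep \<Rightarrow> ('a \<times> 'h \<Rightarrow>\<^sub>0 complex) set"
where
  "balanced_relations H A \<A> \<rho> =
     {Poly_Mapping.single (a \<otimes>\<^bsub>A\<^esub> b, v) 1 - Poly_Mapping.single (a, rep_op \<rho> b v) 1
       |a b v. a \<in> carrier A \<and> b \<in> graded_part A \<A> H \<and> v \<in> rep_dom \<rho>}"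

definition tensor_kernel ::
  "('g, 'm) monoid_scheme \<Rightarrow> 'g set \<Rightarrow> 'a star_alg \<Rightarrow> ('g \<Rightarrow> 'a set) \<Rightarrow> ('a, 'h) rep
    \<Rightarrow> ('a \<times> 'h \<Rightarrow>\<^sub>0 complex) set"
where
  "tensor_kernel G H A \<A> \<rho> =
     lspan (free_tensor G H A \<A> \<rho>) (bilinear_relations A \<rho> \<union> balanced_relations H A \<A> \<rho>)"

text \<open>The complex tensor product is the free vector space modulo the bilinear relations.  Its
  quotient by the balanced relations is taken here in a single step.\<close>

definition tensor_space ::
  "('g, 'm) monoid_scheme \<Rightarrow> 'g set \<Rightarrow> 'a star_alg \<Rightarrow> ('g \<Rightarrow> 'a set) \<Rightarrow> ('a, 'h) rep
    \<Rightarrow> ('a \<times> 'h \<Rightarrow>\<^sub>0 complex) set inner_space"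
where
  "tensor_space G H A \<A> \<rho> =
     quotient_space (free_tensor G H A \<A> \<rho>) (tensor_kernel G H A \<A> \<rho>)"

definition inducible ::
  "('g, 'm) monoid_scheme \<Rightarrow> 'g set \<Rightarrow> 'a star_alg \<Rightarrow> ('g \<Rightarrow> 'a set) \<Rightarrow> ('a, 'h) rep \<Rightarrow> bool"
where
  "inducible G H A \<A> \<rho> \<longleftrightarrow>
     (\<forall>\<eta>\<in>carrier (tensor_space G H A \<A> \<rho>).
        cinner (tensor_space G H A \<A> \<rho>) \<eta> \<eta> \<in> \<real>\<^sub>\<ge>\<^sub>0)"

type_synonym ('a, 'h) ind_vector = "(nat \<Rightarrow> ('a \<times> 'h \<Rightarrow>\<^sub>0 complex) set set) set"

text \<open>The vector of the completed space represented by an element of the free vector space; thus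
  \<open>ind_vector G H A \<A> \<rho> (single (a, v) 1)\<close> is \<open>[a \<otimes> v]\<close>.\<close>

definition ind_vector ::
  "('g, 'm) monoid_scheme \<Rightarrow> 'g set \<Rightarrow> 'a star_alg \<Rightarrow> ('g \<Rightarrow> 'a set) \<Rightarrow> ('a, 'h) rep
    \<Rightarrow> ('a \<times> 'h \<Rightarrow>\<^sub>0 complex) \<Rightarrow> ('a, 'h) ind_vector"
where
  "ind_vector G H A \<A> \<rho> f =
     completion_embed (separated (tensor_space G H A \<A> \<rho>))
       (sep_class (tensor_space G H A \<A> \<rho>)
         (tensor_kernel G H A \<A> \<rho> +>\<^bsub>free_tensor G H A \<A> \<rho>\<^esub> f))"

definition left_mult :: "'a star_alg \<Rightarrow> 'a \<Rightarrow> ('a \<times> 'h \<Rightarrow>\<^sub>0 complex) \<Rightarrow> ('a \<times> 'h \<Rightarrow>\<^sub>0 complex)" where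
  "left_mult A a f =
     (\<Sum>(b, v)\<in>Poly_Mapping.keys f.
        Poly_Mapping.single (a \<otimes>\<^bsub>A\<^esub> b, v) (Poly_Mapping.lookup f (b, v)))"

definition pre_induced_rep ::
  "('g, 'm) monoid_scheme \<Rightarrow> 'g set \<Rightarrow> 'a star_alg \<Rightarrow> ('g \<Rightarrow> 'a set) \<Rightarrow> ('a, 'h) rep
    \<Rightarrow> ('a, ('a, 'h) ind_vector) rep"
where
  "pre_induced_rep G H A \<A> \<rho> =
     \<lparr>rep_space = completion (separated (tensor_space G H A \<A> \<rho>)),
      rep_dom = ind_vector G H A \<A> \<rho> ` carrier (free_tensor G H A \<A> \<rho>),
      rep_op = (\<lambda>a \<Phi>. the_elem {ind_vector G H A \<A> \<rho> (left_mult A a f) |f.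
         f \<in> carrier (free_tensor G H A \<A> \<rho>) \<and> ind_vector G H A \<A> \<rho> f = \<Phi>})\<rparr>"

definition induced_rep ::
  "('g, 'm) monoid_scheme \<Rightarrow> 'g set \<Rightarrow> 'a star_alg \<Rightarrow> ('g \<Rightarrow> 'a set) \<Rightarrow> ('a, 'h) rep
    \<Rightarrow> ('a, ('a, 'h) ind_vector) rep"
where
  "induced_rep G H A \<A> \<rho> = rep_closure A (pre_induced_rep G H A \<A> \<rho>)"

definition induced_projection ::
  "('g, 'm) monoid_scheme \<Rightarrow> 'g set \<Rightarrow> 'a star_alg \<Rightarrow> ('g \<Rightarrow> 'a set) \<Rightarrow> ('a, 'h) rep
    \<Rightarrow> 'g set \<Rightarrow> ('a, 'h) ind_vector \<Rightarrow> ('a, 'h) ind_vector"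
where
  "induced_projection G H A \<A> \<rho> t =
     (let K = rep_space (induced_rep G H A \<A> \<rho>)
      in orth_proj K (htopology K closure_of
           lspan K {ind_vector G H A \<A> \<rho> (Poly_Mapping.single (a, v) 1) |a v.
                      a \<in> graded_part A \<A> t \<and> v \<in> rep_dom \<rho>}))"


section \<open>Systems of imprimitivity\<close>

definition system_of_imprimitivity ::
  "('g, 'm) monoid_scheme \<Rightarrow> 'g set \<Rightarrow> 'a star_alg \<Rightarrow> ('g \<Rightarrow> 'a set)
    \<Rightarrow> ('a, 'h) rep \<Rightarrow> ('g set \<Rightarrow> 'h \<Rightarrow> 'h) \<Rightarrow> bool"
where
  "system_of_imprimitivity G H A \<A> \<pi> E \<longleftrightarrow>
     star_rep A \<pi> \<and>
     (\<forall>t\<in>lcosets\<^bsub>G\<^esub> H. is_projection (rep_space \<pi>) (E t)) \<and>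
     (\<forall>t1\<in>lcosets\<^bsub>G\<^esub> H. \<forall>t2\<in>lcosets\<^bsub>G\<^esub> H. t1 \<noteq> t2 \<longrightarrow>
        (\<forall>x\<in>carrier (rep_space \<pi>). E t1 (E t2 x) = \<zero>\<^bsub>rep_space \<pi>\<^esub>)) \<and>
     (\<forall>x\<in>carrier (rep_space \<pi>).
        limitin (htopology (rep_space \<pi>)) (\<lambda>T. \<Oplus>\<^bsub>rep_space \<pi>\<^esub>t\<in>T. E t x) x
          (finite_subsets_at_top (lcosets\<^bsub>G\<^esub> H))) \<and>
     (\<forall>g\<in>carrier G. \<forall>t\<in>lcosets\<^bsub>G\<^esub> H. \<forall>a\<in>\<A> g. \<forall>\<phi>\<in>rep_dom \<pi>.
        E t \<phi> \<in> rep_dom \<pi> \<and> E (g <#\<^bsub>G\<^esub> t) (rep_op \<pi> a \<phi>) = rep_op \<pi> a (E t \<phi>))"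

definition sys_dom :: "('a, 'h) rep \<Rightarrow> ('g set \<Rightarrow> 'h \<Rightarrow> 'h) \<Rightarrow> 'g set \<Rightarrow> 'h set" where
  "sys_dom \<pi> E t = E t ` carrier (rep_space \<pi>) \<inter> rep_dom \<pi>"

definition nondegenerate_system ::
  "('g, 'm) monoid_scheme \<Rightarrow> 'g set \<Rightarrow> 'a star_alg \<Rightarrow> ('g \<Rightarrow> 'a set)
    \<Rightarrow> ('a, 'h) rep \<Rightarrow> ('g set \<Rightarrow> 'h \<Rightarrow> 'h) \<Rightarrow> bool"
where
  "nondegenerate_system G H A \<A> \<pi> E \<longleftrightarrow>
     (\<forall>t\<in>lcosets\<^bsub>G\<^esub> H.
        sys_dom \<pi> E t \<subseteq> graph_topology A \<pi> closure_of
          lspan (rep_space \<pi>) {rep_op \<pi> a \<phi> |a \<phi>. a \<in> graded_part A \<A> t \<and> \<phi> \<in> sys_dom \<pi> E H})"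

definition systems_equivalent ::
  "('g, 'm) monoid_scheme \<Rightarrow> 'g set \<Rightarrow> 'a star_alg
    \<Rightarrow> ('a, 'h) rep \<Rightarrow> ('g set \<Rightarrow> 'h \<Rightarrow> 'h) \<Rightarrow> ('a, 'k) rep \<Rightarrow> ('g set \<Rightarrow> 'k \<Rightarrow> 'k) \<Rightarrow> bool"
where
  "systems_equivalent G H A \<pi>1 E1 \<pi>2 E2 \<longleftrightarrow>
     (\<exists>U. isometry_onto (rep_space \<pi>1) (carrier (rep_space \<pi>1))
            (rep_space \<pi>2) (carrier (rep_space \<pi>2)) U \<and>
          implements_equivalence A \<pi>1 \<pi>2 U \<and>
          (\<forall>t\<in>lcosets\<^bsub>G\<^esub> H. \<forall>x\<in>carrier (rep_space \<pi>1). U (E1 t x) = E2 t (U x)))"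

text \<open>\<open>\<rho>\<close> is a closed inducible star-representation of \<open>A\<^sub>H\<close> whose induced system of
  imprimitivity is unitarily equivalent to \<open>(\<pi>, E)\<close>.\<close>

definition induces_system ::
  "('g, 'm) monoid_scheme \<Rightarrow> 'g set \<Rightarrow> 'a star_alg \<Rightarrow> ('g \<Rightarrow> 'a set)
    \<Rightarrow> ('a, 'h) rep \<Rightarrow> ('g set \<Rightarrow> 'h \<Rightarrow> 'h) \<Rightarrow> ('a, 'k) rep \<Rightarrow> bool"
where
  "induces_system G H A \<A> \<pi> E \<rho> \<longleftrightarrow>
     star_rep (graded_subalgebra A \<A> H) \<rho> \<and>
     closed_rep (graded_subalgebra A \<A> H) \<rho> \<and>
     inducible G H A \<A> \<rho> \<and>
     systems_equivalent G H A \<pi> E (induced_rep G H A \<A> \<rho>) (induced_projection G H A \<A> \<rho>)"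

end

theory Submission
  imports Defs
begin

text \<open>
  The representation that induces \<open>(\<pi>, E)\<close> is found inside \<open>\<pi>\<close>: restrict the operators \<open>\<pi>(a)\<close>, \<open>a\<close> in
  the subalgebra over \<open>H\<close>, to the part \<open>D\<^sub>H\<close> of the domain that lies in the range of \<open>E H\<close>.

  Existence.  An element of degree \<open>g\<close> carries \<open>D\<^sub>H\<close> into the range of \<open>E (gH)\<close>, and these ranges
  are pairwise orthogonal.  Hence \<open>\<langle>\<pi>(a) v, w\<rangle> = \<langle>\<pi>(p a) v, w\<rangle>\<close> for \<open>v\<close>, \<open>w\<close> in \<open>D\<^sub>H\<close> and the projection
  \<open>p\<close> onto the subalgebra (\<open>form_expectation\<close>), which says that the form of the induced representation
  is the Gram form of the vectors \<open>\<pi>(a) v\<close>.  It is therefore nonnegative, and \<open>a \<otimes> v \<mapsto> \<pi>(a) v\<close>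
  identifies the completed induced space with a subspace of the space of \<open>\<pi>\<close>.  The vectors \<open>\<pi>(a) v\<close>
  span a subspace that is dense in the domain of \<open>\<pi>\<close> for the graph topology: nondegeneracy gives
  density in each range \<open>E t\<close>, and the sums \<open>\<Sum> E t \<phi>\<close> converge to \<open>\<phi>\<close> in the graph topology, since a
  homogeneous operator merely permutes the cosets (\<open>partial_sums_op\<close>).  As \<open>\<pi>\<close> is closed, the closure
  of its restriction to a graph-dense subspace is \<open>\<pi>\<close> itself (\<open>rep_closure_transport\<close>).  The restriction
  to \<open>D\<^sub>H\<close> is closed because \<open>\<parallel>\<pi>(a) v\<parallel>\<^sup>2 = \<langle>\<pi>(a\<^sup>* a) v, v\<rangle>\<close> and \<open>a\<^sup>* a\<close> has degree \<open>1\<close> for homogeneous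
  \<open>a\<close>, so that on \<open>D\<^sub>H\<close> the subalgebra already defines the graph topology of the whole algebra
  (\<open>homogeneous_graph_norm\<close>).

  Uniqueness.  Any inducing representation \<open>\<rho>\<close> sits in its induced representation as \<open>v \<mapsto> 1 \<otimes> v\<close>.
  The projection attached to the coset \<open>H\<close> acts on the tensors as \<open>a \<otimes> v \<mapsto> 1 \<otimes> \<rho>(p a) v\<close>; it is a
  contraction that commutes with the subalgebra, so it turns the Cauchy filters that define the closure
  into Cauchy filters of \<open>\<rho>\<close>.  Since \<open>\<rho>\<close> is closed, its domain exhausts the part of the induced
  domain in the range of that projection (\<open>inducing_rep_unique\<close>).  Transporting this along the given
  equivalence with \<open>(\<pi>, E)\<close> shows that \<open>\<rho>\<close> is equivalent to the restriction of \<open>\<pi>\<close> to \<open>D\<^sub>H\<close>.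

  The concrete construction of the induced space, a completion of a quotient of a quotient of a free
  vector space, enters only through the map from the free space into it, which preserves the form
  (\<open>\<iota>_form_hom\<close>), and through its universal property (\<open>induced_space_universal\<close>).
\<close>

section \<open>Complex vector spaces on a carrier set\<close>

lemma complex_ring_simps [simp]:
  "carrier complex_ring = UNIV"
  "x \<otimes>\<^bsub>complex_ring\<^esub> y = x * y"
  "\<one>\<^bsub>complex_ring\<^esub> = 1"
  "\<zero>\<^bsub>complex_ring\<^esub> = 0"
  "x \<oplus>\<^bsub>complex_ring\<^esub> y = x + y"
  by (simp_all add: ring_of_type_algebra_def)

interpretation complex_cring: cring complex_ring
  by (rule cring_from_type_algebra)

lemma complex_ring_uminus [simp]: "\<ominus>\<^bsub>complex_ring\<^esub> x = - x"
  using complex_cring.minus_equality[of "-x" x] by simp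

locale complex_module = Module.module complex_ring V
  for V :: "(complex, 'v, 'm) module_scheme" (structure)
begin

lemma smult_in_carrier [simp, intro]: "x \<in> carrier V \<Longrightarrow> c \<odot> x \<in> carrier V"
  using smult_closed by simp

lemma smult_simps [simp]:
  "x \<in> carrier V \<Longrightarrow> 0 \<odot> x = \<zero>"
  "x \<in> carrier V \<Longrightarrow> 1 \<odot> x = x"
  "c \<odot> \<zero> = \<zero>"
  using smult_l_null smult_one smult_r_null by simp_all

lemma smult_add_scalar: "x \<in> carrier V \<Longrightarrow> (c + d) \<odot> x = c \<odot> x \<oplus> d \<odot> x"
  using smult_l_distr[of c d x] by simp

lemma smult_add: "\<lbrakk>x \<in> carrier V; y \<in> carrier V\<rbrakk> \<Longrightarrow> c \<odot> (x \<oplus> y) = c \<odot> x \<oplus> c \<odot> y"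
  using smult_r_distr[of c x y] by simp

lemma smult_smult: "x \<in> carrier V \<Longrightarrow> c \<odot> (d \<odot> x) = (c * d) \<odot> x"
  using smult_assoc1[of c d x] by simp

lemma uminus_eq_smult: "x \<in> carrier V \<Longrightarrow> \<ominus> x = (-1) \<odot> x"
  using smult_l_minus[of 1 x] by simp

lemma minus_eq_smult: "\<lbrakk>x \<in> carrier V; y \<in> carrier V\<rbrakk> \<Longrightarrow> x \<ominus> y = x \<oplus> (-1) \<odot> y"
  by (simp add: a_minus_def uminus_eq_smult)

text \<open>Additive inverses are scalar multiples, so a complex subspace only has to be
  closed under sums and multiples.\<close>

lemma submodule_criterion:
  assumes "S \<subseteq> carrier V" "\<zero> \<in> S" "\<And>x y. \<lbrakk>x \<in> S; y \<in> S\<rbrakk> \<Longrightarrow> x \<oplus> y \<in> S"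
    and "\<And>c x. x \<in> S \<Longrightarrow> c \<odot> x \<in> S"
  shows "submodule S complex_ring V"
  using assms by (intro submoduleI) (auto simp: uminus_eq_smult subset_iff)

lemma submodule_facts:
  assumes "submodule S complex_ring V"
  shows "S \<subseteq> carrier V" "\<zero> \<in> S" "\<And>x y. \<lbrakk>x \<in> S; y \<in> S\<rbrakk> \<Longrightarrow> x \<oplus> y \<in> S"
    "\<And>c x. x \<in> S \<Longrightarrow> c \<odot> x \<in> S" "\<And>x y. \<lbrakk>x \<in> S; y \<in> S\<rbrakk> \<Longrightarrow> x \<ominus> y \<in> S"
proof -
  note E = submoduleE[OF assms]
  show 1: "S \<subseteq> carrier V" "\<And>x y. \<lbrakk>x \<in> S; y \<in> S\<rbrakk> \<Longrightarrow> x \<oplus> y \<in> S"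
    "\<And>c x. x \<in> S \<Longrightarrow> c \<odot> x \<in> S"
    using E by simp_all
  show "\<zero> \<in> S" using E(1,2) 1(3)[of _ 0] by force
  show "x \<ominus> y \<in> S" if "x \<in> S" "y \<in> S" for x y
    using that 1 by (simp add: minus_eq_smult subset_iff)
qed

lemma submodule_finsum:
  assumes "submodule S complex_ring V" "finite F" "\<And>i. i \<in> F \<Longrightarrow> f i \<in> S"
  shows "finsum V f F \<in> S"
  using assms(2,3)
proof (induction F)
  case empty then show ?case using submodule_facts(2)[OF assms(1)] by simp
next
  case (insert i F)
  have "f \<in> insert i F \<rightarrow> carrier V"
    using insert.prems submodule_facts(1)[OF assms(1)] by blast
  then have "finsum V f (insert i F) = f i \<oplus> finsum V f F"
    using insert.hyps by (subst finsum_insert) auto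
  then show ?case using insert submodule_facts(3)[OF assms(1)] by simp
qed

lemma carrier_submodule: "submodule (carrier V) complex_ring V"
  by (rule submodule_criterion) auto

lemma lspan_superset: "S \<subseteq> lspan V S"
  by (simp add: lspan_def hull_subset)

lemma lspan_minimal: "\<lbrakk>S \<subseteq> U; submodule U complex_ring V\<rbrakk> \<Longrightarrow> lspan V S \<subseteq> U"
  by (simp add: lspan_def hull_minimal)

lemma lspan_submodule:
  assumes "S \<subseteq> carrier V" shows "submodule (lspan V S) complex_ring V"
proof (rule submodule_criterion)
  show "lspan V S \<subseteq> carrier V" using assms carrier_submodule by (rule lspan_minimal)
qed (auto simp: lspan_def hull_def dest: submodule_facts)

end

lemma linear_on_minus:
  assumes "complex_module V" "complex_module W" "submodule S complex_ring V" "linear_on S V W T"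
    "T ` S \<subseteq> carrier W" "x \<in> S" "y \<in> S"
  shows "T (x \<ominus>\<^bsub>V\<^esub> y) = T x \<ominus>\<^bsub>W\<^esub> T y"
proof -
  interpret V: complex_module V by fact
  interpret W: complex_module W by fact
  note S = V.submodule_facts[OF assms(3)]
  have "T x \<in> carrier W" "T y \<in> carrier W" "x \<in> carrier V" "y \<in> carrier V" using assms S by auto
  then show ?thesis using assms S by (simp add: V.minus_eq_smult W.minus_eq_smult linear_on_def)
qed

lemma linear_on_zero:
  assumes "complex_module V" "complex_module W" "submodule S complex_ring V" "linear_on S V W T"
    "T ` S \<subseteq> carrier W"
  shows "T \<zero>\<^bsub>V\<^esub> = \<zero>\<^bsub>W\<^esub>"
proof -
  interpret V: complex_module V by fact
  interpret W: complex_module W by fact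
  note S = V.submodule_facts[OF assms(3)]
  have "T (0 \<odot>\<^bsub>V\<^esub> \<zero>\<^bsub>V\<^esub>) = 0 \<odot>\<^bsub>W\<^esub> T \<zero>\<^bsub>V\<^esub>" using assms S unfolding linear_on_def by blast
  then show ?thesis using assms S by auto
qed

lemma linear_on_finsum:
  assumes "complex_module V" "complex_module W" "submodule S complex_ring V" "linear_on S V W T"
    "T ` S \<subseteq> carrier W" "finite F" "\<And>i. i \<in> F \<Longrightarrow> f i \<in> S"
  shows "T (finsum V f F) = finsum W (\<lambda>i. T (f i)) F"
  using assms(6,7)
proof (induction F)
  interpret V: complex_module V by fact
  interpret W: complex_module W by fact
  note S = V.submodule_facts[OF assms(3)]
  case empty
  then show ?case using linear_on_zero[OF assms(1-5)] by simp
next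
  interpret V: complex_module V by fact
  interpret W: complex_module W by fact
  note S = V.submodule_facts[OF assms(3)]
  case (insert i F)
  have "f \<in> F \<rightarrow> carrier V" "f i \<in> carrier V" "(\<lambda>i. T (f i)) \<in> F \<rightarrow> carrier W" "T (f i) \<in> carrier W"
    using insert.prems S(1) assms(5) by auto
  moreover have "finsum V f F \<in> S" using insert by (intro V.submodule_finsum[OF assms(3)]) auto
  ultimately show ?case using insert assms(4) by (simp add: V.finsum_insert W.finsum_insert linear_on_def)
qed

section \<open>Hermitian forms\<close>

text \<open>The free vector space and the tensor product carry a form whose positivity is
  precisely what inducibility asserts, so quotients are treated for hermitian forms without a sign.\<close>

locale hermitian_space = complex_module V for V :: "'v inner_space" (structure) +
  assumes form_add_left:
      "\<lbrakk>x \<in> carrier V; y \<in> carrier V; z \<in> carrier V\<rbrakk>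
        \<Longrightarrow> cinner V (x \<oplus> y) z = cinner V x z + cinner V y z"
    and form_smult_left:
      "\<lbrakk>x \<in> carrier V; z \<in> carrier V\<rbrakk> \<Longrightarrow> cinner V (c \<odot> x) z = c * cinner V x z"
    and form_commute:
      "\<lbrakk>x \<in> carrier V; y \<in> carrier V\<rbrakk> \<Longrightarrow> cinner V y x = cnj (cinner V x y)"
begin

lemma form_add_right:
  "\<lbrakk>x \<in> carrier V; y \<in> carrier V; z \<in> carrier V\<rbrakk>
    \<Longrightarrow> cinner V z (x \<oplus> y) = cinner V z x + cinner V z y"
  by (simp add: form_commute[of x z] form_commute[of y z] form_commute[of "x \<oplus> y" z] form_add_left)

lemma form_smult_right:
  "\<lbrakk>x \<in> carrier V; z \<in> carrier V\<rbrakk> \<Longrightarrow> cinner V z (c \<odot> x) = cnj c * cinner V z x"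
  using form_commute[of z x] form_commute[of "c \<odot> x" z] by (simp add: form_smult_left)

lemma form_minus_left:
  "\<lbrakk>x \<in> carrier V; y \<in> carrier V; z \<in> carrier V\<rbrakk>
    \<Longrightarrow> cinner V (x \<ominus> y) z = cinner V x z - cinner V y z"
  by (simp add: minus_eq_smult form_add_left form_smult_left)

lemma form_minus_right:
  "\<lbrakk>x \<in> carrier V; y \<in> carrier V; z \<in> carrier V\<rbrakk>
    \<Longrightarrow> cinner V z (x \<ominus> y) = cinner V z x - cinner V z y"
  by (simp add: minus_eq_smult form_add_right form_smult_right)

lemma form_zero_left [simp]: "z \<in> carrier V \<Longrightarrow> cinner V \<zero> z = 0"
  using form_smult_left[of \<zero> z 0] by simp

lemma form_zero_right [simp]: "z \<in> carrier V \<Longrightarrow> cinner V z \<zero> = 0"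
  using form_smult_right[of \<zero> z 0] by simp

lemmas form_simps = form_add_left form_add_right form_smult_left form_smult_right
  form_minus_left form_minus_right

lemma form_finsum_left:
  assumes "finite F" "f \<in> F \<rightarrow> carrier V" "z \<in> carrier V"
  shows "cinner V (finsum V f F) z = (\<Sum>i\<in>F. cinner V (f i) z)"
  using assms(1,2)
proof (induction F)
  case (insert i F)
  have "finsum V f F \<in> carrier V" using insert by (intro finsum_closed) auto
  then show ?case using insert assms(3) by (simp add: finsum_insert form_add_left)
qed (use assms in simp)

lemma form_self_real: "x \<in> carrier V \<Longrightarrow> cinner V x x = complex_of_real (Re (cinner V x x))"
  using form_commute[of x x] by (simp add: complex_eq_iff)

text \<open>A hermitian form descends to the quotient by any subspace of this one.\<close>

definition radical :: "'v set" where
  "radical = {x \<in> carrier V. \<forall>y\<in>carrier V. cinner V x y = 0}"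

lemma radical_submodule: "submodule radical complex_ring V"
  by (rule submodule_criterion) (auto simp: radical_def form_simps)

end

locale semi_inner_space = hermitian_space +
  assumes form_nonneg: "x \<in> carrier V \<Longrightarrow> 0 \<le> Re (cinner V x x)"
begin

lemma hnorm_nonneg [simp]: "x \<in> carrier V \<Longrightarrow> 0 \<le> hnorm V x"
  by (simp add: hnorm_def form_nonneg)

lemma hnorm_sq: "x \<in> carrier V \<Longrightarrow> (hnorm V x)\<^sup>2 = Re (cinner V x x)"
  by (simp add: hnorm_def form_nonneg)

lemma form_self: "x \<in> carrier V \<Longrightarrow> cinner V x x = complex_of_real ((hnorm V x)\<^sup>2)"
  using form_self_real by (simp add: hnorm_sq)

lemma hnorm_zero [simp]: "hnorm V \<zero> = 0"
  by (simp add: hnorm_def)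

lemma Cauchy_Schwarz:
  assumes x: "x \<in> carrier V" and y: "y \<in> carrier V"
  shows "cmod (cinner V x y) \<le> hnorm V x * hnorm V y"
proof -
  define a where "a = (hnorm V x)\<^sup>2"
  define b where "b = (hnorm V y)\<^sup>2"
  define c where "c = cinner V x y"
  \<comment> \<open>The square length of \<open>x - s c y\<close> for real \<open>s\<close>: the phase \<open>c = \<langle>x, y\<rangle>\<close> makes the cross term real.\<close>
  have quad: "0 \<le> a - 2 * s * (cmod c)\<^sup>2 + s\<^sup>2 * (cmod c)\<^sup>2 * b" for s :: real
  proof -
    define t where "t = - complex_of_real s * c"
    have cc: "c * cnj c = complex_of_real ((cmod c)\<^sup>2)"
      using complex_norm_square[of c] by simp
    have "cinner V (x \<oplus> t \<odot> y) (x \<oplus> t \<odot> y)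
        = cinner V x x + cnj t * c + t * cnj c + t * cnj t * cinner V y y"
      using x y form_commute[OF x y] by (simp add: form_simps c_def algebra_simps)
    also have "\<dots> = complex_of_real a + cnj t * c + t * cnj c + t * cnj t * complex_of_real b"
      using x y by (simp add: form_self a_def b_def)
    also have "\<dots> = complex_of_real a - 2 * complex_of_real s * (c * cnj c)
        + complex_of_real s * complex_of_real s * (c * cnj c) * complex_of_real b"
      unfolding t_def by (simp add: algebra_simps)
    also have "\<dots> = complex_of_real (a - 2 * s * (cmod c)\<^sup>2 + s\<^sup>2 * (cmod c)\<^sup>2 * b)"
      unfolding cc by (simp add: power2_eq_square)
    finally have "Re (cinner V (x \<oplus> t \<odot> y) (x \<oplus> t \<odot> y)) = a - 2 * s * (cmod c)\<^sup>2 + s\<^sup>2 * (cmod c)\<^sup>2 * b"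
      by simp
    then show ?thesis using form_nonneg[of "x \<oplus> t \<odot> y"] x y by simp
  qed
  have "(cmod c)\<^sup>2 \<le> a * b"
  proof (cases "b = 0")
    case True
    have "cmod c = 0"
    proof (rule ccontr)
      \<comment> \<open>For \<open>b = 0\<close> the bound is affine in \<open>s\<close>, and this \<open>s\<close> makes it equal to \<open>- a - 2\<close>.\<close>
      assume "cmod c \<noteq> 0"
      then show False using quad[of "(a + 1) / (cmod c)\<^sup>2"] True hnorm_sq[OF x] form_nonneg[OF x]
        by (simp add: a_def)
    qed
    then show ?thesis using True by simp
  next
    case False
    then have "0 < b" by (simp add: b_def)
    have "0 \<le> a - 2 * (1 / b) * (cmod c)\<^sup>2 + (1 / b)\<^sup>2 * (cmod c)\<^sup>2 * b" by (rule quad)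
    also have "\<dots> = a - (cmod c)\<^sup>2 / b" using False by (simp add: power2_eq_square field_simps)
    finally show ?thesis using \<open>0 < b\<close> by (simp add: field_simps)
  qed
  then have "(cmod c)\<^sup>2 \<le> (hnorm V x * hnorm V y)\<^sup>2"
    by (simp add: a_def b_def power_mult_distrib)
  then show ?thesis unfolding c_def
    by (rule power2_le_imp_le) (simp add: x y)
qed

lemma hnorm_triangle:
  assumes "x \<in> carrier V" "y \<in> carrier V"
  shows "hnorm V (x \<oplus> y) \<le> hnorm V x + hnorm V y"
proof (rule power2_le_imp_le)
  have "(hnorm V (x \<oplus> y))\<^sup>2 = (hnorm V x)\<^sup>2 + (hnorm V y)\<^sup>2 + 2 * Re (cinner V x y)"
    using assms form_commute[OF assms] by (simp add: hnorm_sq form_simps)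
  also have "Re (cinner V x y) \<le> hnorm V x * hnorm V y"
    using Cauchy_Schwarz[OF assms] complex_Re_le_cmod order_trans by blast
  finally show "(hnorm V (x \<oplus> y))\<^sup>2 \<le> (hnorm V x + hnorm V y)\<^sup>2"
    by (simp add: power2_sum)
qed (use assms in simp)

lemma hnorm_smult:
  assumes "x \<in> carrier V" shows "hnorm V (c \<odot> x) = cmod c * hnorm V x"
proof -
  have "(hnorm V (c \<odot> x))\<^sup>2 = Re (c * cnj c * cinner V x x)"
    using assms by (simp only: hnorm_sq form_simps smult_in_carrier mult.assoc mult.left_commute)
  also have "c * cnj c * cinner V x x = complex_of_real ((cmod c * hnorm V x)\<^sup>2)"
    using assms complex_norm_square[of c] by (simp add: form_self power_mult_distrib)
  also have "Re \<dots> = (cmod c * hnorm V x)\<^sup>2" by (rule Re_complex_of_real)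
  finally show ?thesis using assms by (simp add: power2_eq_iff_nonneg)
qed

text \<open>Two expressions may be different vectors of a semi-inner product space although
  they agree as vectors modulo null vectors.  Their norms are then still equal, and the hypothesis is
  checked by expanding the form.\<close>

lemma hnorm_eq_by_form:
  assumes "x \<in> carrier V" "y \<in> carrier V" "\<And>z. z \<in> carrier V \<Longrightarrow> cinner V x z = cinner V y z"
  shows "hnorm V x = hnorm V y"
proof -
  have "cinner V x x = cinner V y y"
    using assms form_commute by metis
  then show ?thesis by (simp add: hnorm_def)
qed

lemma hnorm_minus_commute:
  assumes "x \<in> carrier V" "y \<in> carrier V" shows "hnorm V (x \<ominus> y) = hnorm V (y \<ominus> x)"
  using assms by (simp add: hnorm_def form_simps algebra_simps)

lemma hnorm_minus_triangle:
  assumes "x \<in> carrier V" "y \<in> carrier V" "z \<in> carrier V"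
  shows "hnorm V (x \<ominus> z) \<le> hnorm V (x \<ominus> y) + hnorm V (y \<ominus> z)"
proof -
  have "hnorm V (x \<ominus> z) = hnorm V ((x \<ominus> y) \<oplus> (y \<ominus> z))"
    using assms by (intro hnorm_eq_by_form) (auto simp: form_simps)
  then show ?thesis using assms by (simp add: hnorm_triangle)
qed

lemma hnorm_minus_add:
  assumes "x \<in> carrier V" "y \<in> carrier V" "x' \<in> carrier V" "y' \<in> carrier V"
  shows "hnorm V ((x \<oplus> y) \<ominus> (x' \<oplus> y')) \<le> hnorm V (x \<ominus> x') + hnorm V (y \<ominus> y')"
proof -
  have "hnorm V ((x \<oplus> y) \<ominus> (x' \<oplus> y')) = hnorm V ((x \<ominus> x') \<oplus> (y \<ominus> y'))"
    using assms by (intro hnorm_eq_by_form) (auto simp: form_simps)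
  then show ?thesis using assms by (simp add: hnorm_triangle)
qed

lemma hnorm_minus_smult:
  assumes "x \<in> carrier V" "x' \<in> carrier V"
  shows "hnorm V (c \<odot> x \<ominus> c \<odot> x') = cmod c * hnorm V (x \<ominus> x')"
proof -
  have "hnorm V (c \<odot> x \<ominus> c \<odot> x') = hnorm V (c \<odot> (x \<ominus> x'))"
    using assms by (intro hnorm_eq_by_form) (auto simp: form_simps algebra_simps)
  then show ?thesis using assms by (simp add: hnorm_smult)
qed

lemma hnorm_diff_abs:
  assumes "x \<in> carrier V" "y \<in> carrier V"
  shows "\<bar>hnorm V x - hnorm V y\<bar> \<le> hnorm V (x \<ominus> y)"
proof -
  have "x \<ominus> \<zero> = x" "y \<ominus> \<zero> = y" using assms by (simp_all add: minus_eq_smult)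
  then show ?thesis using hnorm_minus_triangle[of x y \<zero>] hnorm_minus_triangle[of y x \<zero>] assms
     hnorm_minus_commute[of x y] by simp
qed

text \<open>By the Cauchy-Schwarz inequality; it is what makes the null vectors a subspace.\<close>

lemma null_vectors_eq_radical: "null_vectors V = radical"
proof -
  have "cinner V x y = 0" if "x \<in> carrier V" "cinner V x x = 0" "y \<in> carrier V" for x y
    using Cauchy_Schwarz[OF that(1,3)] that by (simp add: hnorm_def)
  then show ?thesis by (auto simp: null_vectors_def radical_def)
qed

end

sublocale pre_hilbert \<subseteq> semi_inner_space
  by unfold_locales (auto intro: cinner_add_left cinner_smult_left cinner_commute cinner_nonneg)

lemma semi_inner_space_pre_hilbertI:
  assumes "semi_inner_space V" "\<And>x. \<lbrakk>x \<in> carrier V; cinner V x x = 0\<rbrakk> \<Longrightarrow> x = \<zero>\<^bsub>V\<^esub>"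
  shows "pre_hilbert V"
proof -
  interpret semi_inner_space V by fact
  show ?thesis
    by unfold_locales (auto intro: form_add_left form_smult_left form_commute form_nonneg assms(2))
qed

context pre_hilbert begin

lemma hnorm_eq_0_iff: "x \<in> carrier V \<Longrightarrow> hnorm V x = 0 \<longleftrightarrow> x = \<zero>"
  using form_self[of x] cinner_definite[of x] by auto

lemma minus_eq_zero_iff:
  assumes "x \<in> carrier V" "y \<in> carrier V" shows "x \<ominus> y = \<zero> \<longleftrightarrow> x = y"
  using assms by (metis a_minus_def l_neg minus_equality minus_minus a_inv_closed)

text \<open>Definiteness turns vector identities into identities between complex numbers.\<close>

lemma eq_by_form:
  assumes "x \<in> carrier V" "y \<in> carrier V" "\<And>z. z \<in> carrier V \<Longrightarrow> cinner V x z = cinner V y z"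
  shows "x = y"
proof -
  have "cinner V (x \<ominus> y) (x \<ominus> y) = 0"
    using assms(3)[of "x \<ominus> y"] assms(1,2) by (simp add: form_minus_left)
  then have "x \<ominus> y = \<zero>" using assms cinner_definite by simp
  then show ?thesis using assms minus_eq_zero_iff by simp
qed

lemma Metric_space_hdist: "Metric_space (carrier V) (hdist V)"
proof
  show "0 \<le> hdist V x y" for x y by (simp add: hdist_def)
  show "hdist V x y = hdist V y x" for x y by (simp add: hdist_def hnorm_minus_commute)
  show "hdist V x y = 0 \<longleftrightarrow> x = y" if "x \<in> carrier V" "y \<in> carrier V" for x y
    using that by (simp add: hdist_def hnorm_eq_0_iff minus_eq_zero_iff)
  show "hdist V x z \<le> hdist V x y + hdist V y z"
    if "x \<in> carrier V" "y \<in> carrier V" "z \<in> carrier V" for x y z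
    using that by (simp add: hdist_def hnorm_minus_triangle)
qed

sublocale metric: Metric_space "carrier V" "hdist V"
  by (rule Metric_space_hdist)

lemma limitin_htopology_iff:
  "limitin (htopology V) f l F \<longleftrightarrow>
     l \<in> carrier V \<and> (\<forall>\<epsilon>>0. \<forall>\<^sub>F x in F. f x \<in> carrier V \<and> hnorm V (f x \<ominus> l) < \<epsilon>)"
proof -
  have "f x \<in> carrier V \<and> hdist V (f x) l < \<epsilon> \<longleftrightarrow> f x \<in> carrier V \<and> hnorm V (f x \<ominus> l) < \<epsilon>"
    if "l \<in> carrier V" for x \<epsilon>
    using that by (auto simp: hdist_def)
  then show ?thesis unfolding htopology_def metric.limitin_metric by auto
qed

lemma closure_htopology_iff:
  assumes "S \<subseteq> carrier V"
  shows "x \<in> htopology V closure_of S \<longleftrightarrow>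
    x \<in> carrier V \<and> (\<forall>\<epsilon>>0. \<exists>y\<in>S. hnorm V (x \<ominus> y) < \<epsilon>)"
proof -
  have "hdist V x y = hnorm V (x \<ominus> y)" if "x \<in> carrier V" "y \<in> S" for y
    using that assms by (auto simp: hdist_def)
  then show ?thesis using assms unfolding htopology_def metric.metric_closure_of
    by (auto simp: subset_iff metric.in_mball)
qed

lemma MCauchy_iff:
  "metric.MCauchy s \<longleftrightarrow> (\<forall>n. s n \<in> carrier V) \<and>
     (\<forall>\<epsilon>>0. \<exists>N. \<forall>n\<ge>N. \<forall>m\<ge>N. hnorm V (s n \<ominus> s m) < \<epsilon>)"
  unfolding metric.MCauchy_def by (auto simp: hdist_def image_subset_iff)

lemma limit_unique:
  "\<lbrakk>limitin (htopology V) f l F; limitin (htopology V) f l' F; F \<noteq> bot\<rbrakk> \<Longrightarrow> l = l'"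
  unfolding htopology_def by (rule metric.limitin_metric_unique)

end

lemma pre_hilbert_imp:
  assumes "pre_hilbert V" shows "hermitian_space V" "complex_module V"
proof -
  interpret pre_hilbert V by fact
  show "hermitian_space V" "complex_module V" by unfold_locales
qed

section \<open>Form-preserving maps, quotients and completions\<close>

definition form_hom :: "'v inner_space \<Rightarrow> 'w inner_space \<Rightarrow> ('v \<Rightarrow> 'w) \<Rightarrow> bool" where
  "form_hom V W q \<longleftrightarrow> q \<in> carrier V \<rightarrow> carrier W \<and> linear_on (carrier V) V W q \<and>
     (\<forall>x\<in>carrier V. \<forall>y\<in>carrier V. cinner W (q x) (q y) = cinner V x y)"

lemma form_homD:
  assumes "form_hom V W q"
  shows "x \<in> carrier V \<Longrightarrow> q x \<in> carrier W"
    "\<lbrakk>x \<in> carrier V; y \<in> carrier V\<rbrakk> \<Longrightarrow> q (x \<oplus>\<^bsub>V\<^esub> y) = q x \<oplus>\<^bsub>W\<^esub> q y"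
    "x \<in> carrier V \<Longrightarrow> q (c \<odot>\<^bsub>V\<^esub> x) = c \<odot>\<^bsub>W\<^esub> q x"
    "\<lbrakk>x \<in> carrier V; y \<in> carrier V\<rbrakk> \<Longrightarrow> cinner W (q x) (q y) = cinner V x y"
    "x \<in> carrier V \<Longrightarrow> hnorm W (q x) = hnorm V x"
  using assms by (auto simp: form_hom_def linear_on_def hnorm_def)

lemma form_hom_minus:
  assumes "form_hom V W q" "complex_module V" "complex_module W" "x \<in> carrier V" "y \<in> carrier V"
  shows "q (x \<ominus>\<^bsub>V\<^esub> y) = q x \<ominus>\<^bsub>W\<^esub> q y"
proof -
  interpret V: complex_module V by fact
  interpret W: complex_module W by fact
  show ?thesis using assms(4,5) form_homD[OF assms(1)]
    by (simp add: V.minus_eq_smult W.minus_eq_smult)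
qed

lemma form_hom_comp: "\<lbrakk>form_hom V W q; form_hom W Y r\<rbrakk> \<Longrightarrow> form_hom V Y (\<lambda>x. r (q x))"
  by (auto simp: form_hom_def linear_on_def Pi_iff)

text \<open>Into a definite space linearity is automatic: the defect \<open>q (x + y) - q x - q y\<close> has the
  same length as \<open>(x + y) - x - y\<close>.\<close>

lemma form_homI:
  assumes "hermitian_space V" "pre_hilbert W"
    and into: "\<And>x. x \<in> carrier V \<Longrightarrow> q x \<in> carrier W"
    and form: "\<And>x y. \<lbrakk>x \<in> carrier V; y \<in> carrier V\<rbrakk> \<Longrightarrow> cinner W (q x) (q y) = cinner V x y"
  shows "form_hom V W q"
proof -
  interpret V: hermitian_space V by fact
  interpret W: pre_hilbert W by fact
  have "q (x \<oplus>\<^bsub>V\<^esub> y) = q x \<oplus>\<^bsub>W\<^esub> q y" if x: "x \<in> carrier V" and y: "y \<in> carrier V" for x y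
  proof -
    let ?d = "q (x \<oplus>\<^bsub>V\<^esub> y) \<ominus>\<^bsub>W\<^esub> (q x \<oplus>\<^bsub>W\<^esub> q y)"
    have "cinner W ?d ?d = 0" using x y by (simp add: W.form_simps into form V.form_simps)
    then have "?d = \<zero>\<^bsub>W\<^esub>" using x y into by (intro W.cinner_definite) auto
    then show ?thesis using x y into by (simp add: W.minus_eq_zero_iff)
  qed
  moreover have "q (c \<odot>\<^bsub>V\<^esub> x) = c \<odot>\<^bsub>W\<^esub> q x" if x: "x \<in> carrier V" for c x
  proof -
    let ?d = "q (c \<odot>\<^bsub>V\<^esub> x) \<ominus>\<^bsub>W\<^esub> c \<odot>\<^bsub>W\<^esub> q x"
    have "cinner W ?d ?d = 0" using x by (simp add: W.form_simps into form V.form_simps)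
    then have "?d = \<zero>\<^bsub>W\<^esub>" using x into by (intro W.cinner_definite) auto
    then show ?thesis using x into by (simp add: W.minus_eq_zero_iff)
  qed
  ultimately show ?thesis using into form by (auto simp: form_hom_def linear_on_def)
qed

lemma form_hom_inj:
  assumes "form_hom V W q" "pre_hilbert V"
  shows "inj_on q (carrier V)"
proof (rule inj_onI)
  interpret V: pre_hilbert V by fact
  fix x y assume x: "x \<in> carrier V" and y: "y \<in> carrier V" and "q x = q y"
  then have "cinner V x z = cinner V y z" if "z \<in> carrier V" for z
    using form_homD(4)[OF assms(1), of x z] form_homD(4)[OF assms(1), of y z] that by simp
  then show "x = y" using V.eq_by_form x y by blast
qed

text \<open>On a definite space form-preserving maps are injective.\<close>

lemma form_hom_inverse:
  assumes q: "form_hom V W q" and V: "pre_hilbert V" and onto: "q ` carrier V = carrier W"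
  shows "form_hom W V (inv_into (carrier V) q)"
    "inv_into (carrier V) q ` carrier W = carrier V"
    "\<And>x. x \<in> carrier V \<Longrightarrow> inv_into (carrier V) q (q x) = x"
proof -
  interpret V: pre_hilbert V by fact
  show i: "inv_into (carrier V) q (q x) = x" if "x \<in> carrier V" for x
    using that form_hom_inj[OF q V] by (simp add: inv_into_f_f)
  then show "inv_into (carrier V) q ` carrier W = carrier V"
    unfolding onto[symmetric] image_image by simp
  have "linear_on (carrier W) W V (inv_into (carrier V) q)"
    unfolding linear_on_def onto[symmetric]
    using i by (auto simp flip: form_homD(2,3)[OF q])
  then show "form_hom W V (inv_into (carrier V) q)"
    unfolding form_hom_def onto[symmetric] using i form_homD(4)[OF q] by auto
qed

text \<open>Quotients by a coset map are images, so they inherit the axioms.\<close>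

lemma hermitian_space_image:
  assumes V: "hermitian_space V" and q: "form_hom V W q" and onto: "q ` carrier V = carrier W"
    and zero: "q \<zero>\<^bsub>V\<^esub> = \<zero>\<^bsub>W\<^esub>"
  shows "hermitian_space W"
proof -
  interpret V: hermitian_space V by fact
  note [simp] = form_homD(2,3)[OF q, symmetric] form_homD(4)[OF q] zero[symmetric]
  have inW: "x \<in> carrier W \<longleftrightarrow> (\<exists>u\<in>carrier V. x = q u)" for x using onto by auto
  have ag: "abelian_group W"
  proof (rule abelian_groupI)
    fix x assume "x \<in> carrier W"
    then obtain u where u: "u \<in> carrier V" "x = q u" using inW by blast
    have "q (\<ominus>\<^bsub>V\<^esub> u) \<oplus>\<^bsub>W\<^esub> x = \<zero>\<^bsub>W\<^esub>" using u by (simp add: V.l_neg)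
    moreover have "q (\<ominus>\<^bsub>V\<^esub> u) \<in> carrier W" using u inW by blast
    ultimately show "\<exists>y\<in>carrier W. y \<oplus>\<^bsub>W\<^esub> x = \<zero>\<^bsub>W\<^esub>" by blast
  qed (auto simp: inW V.a_assoc V.a_comm V.a_lcomm)
  have "module complex_ring W"
    by (rule moduleI[OF complex_cring.is_cring ag])
      (auto simp: inW V.smult_add V.smult_add_scalar V.smult_smult)
  then interpret W: complex_module W by (simp add: complex_module_def)
  show ?thesis
  proof unfold_locales
    fix x z c assume "x \<in> carrier W" "z \<in> carrier W"
    then obtain u w where uw: "u \<in> carrier V" "x = q u" "w \<in> carrier V" "z = q w" using inW by blast
    show "cinner W (c \<odot>\<^bsub>W\<^esub> x) z = c * cinner W x z" using uw by (simp add: V.form_simps)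
    show "cinner W z x = cnj (cinner W x z)"
      unfolding uw using V.form_commute[OF uw(1,3)] form_homD(4)[OF q] uw(1,3) by simp
    fix y assume "y \<in> carrier W"
    then obtain v where v: "v \<in> carrier V" "y = q v" using inW by blast
    show "cinner W (x \<oplus>\<^bsub>W\<^esub> y) z = cinner W x z + cinner W y z"
      using uw v by (simp add: V.form_simps)
  qed
qed

lemma semi_inner_space_image:
  assumes V: "semi_inner_space V" and q: "form_hom V W q" and onto: "q ` carrier V = carrier W"
    and zero: "q \<zero>\<^bsub>V\<^esub> = \<zero>\<^bsub>W\<^esub>"
  shows "semi_inner_space W"
proof -
  interpret V: semi_inner_space V by fact
  interpret W: hermitian_space W using hermitian_space_image[OF V.hermitian_space_axioms q onto zero] .
  show ?thesis
  proof unfold_locales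
    fix x assume "x \<in> carrier W"
    then obtain u where "u \<in> carrier V" "x = q u" using onto by blast
    then show "0 \<le> Re (cinner W x x)" by (simp add: form_homD(4)[OF q] V.form_nonneg)
  qed
qed

subsection \<open>Quotients\<close>

context hermitian_space begin

text \<open>The form of the quotient is given by choosing representatives; since \<open>K\<close> lies in
  the radical, all of them give the same number.\<close>

lemma quotient_coset_map:
  assumes K: "submodule K complex_ring V" and rad: "K \<subseteq> radical"
  shows "form_hom V (quotient_space V K) (\<lambda>x. K +> x)"
    and "(\<lambda>x. K +> x) ` carrier V = carrier (quotient_space V K)"
    and "K +> \<zero> = \<zero>\<^bsub>quotient_space V K\<^esub>"
proof -
  note Kf = submodule_facts[OF K]
  have coset: "K +> x = (\<lambda>k. k \<oplus> x) ` K" for x by (auto simp: a_r_coset_def')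
  have "additive_subgroup K V" using K by (simp add: additive_subgroup_def submodule_def)
  then interpret K: abelian_subgroup K V
    using abelian_group_axioms by (intro abelian_subgroupI3)
  show "(\<lambda>x. K +> x) ` carrier V = carrier (quotient_space V K)"
    by (auto simp: quotient_space_def A_RCOSETS_def')
  show "K +> \<zero> = \<zero>\<^bsub>quotient_space V K\<^esub>"
    using Kf(1) by (simp add: quotient_space_def)
  have "K +> (x \<oplus> y) = (K +> x) <+>\<^bsub>V\<^esub> (K +> y)" if "x \<in> carrier V" "y \<in> carrier V" for x y
    using K.a_rcos_sum[OF that] by simp
  moreover have "K +> (c \<odot> x) = (\<Union>z\<in>K +> x. K +> (c \<odot> z))" if x: "x \<in> carrier V" for c x
  proof -
    have "K +> (c \<odot> z) = K +> (c \<odot> x)" if z: "z \<in> K +> x" for z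
    proof -
      obtain k where k: "k \<in> K" "z = k \<oplus> x" using z coset by auto
      then have "c \<odot> z = c \<odot> k \<oplus> c \<odot> x" using Kf(1) x by (auto simp: smult_add)
      moreover have "c \<odot> k \<in> K" using k Kf by blast
      ultimately show ?thesis
        using K.a_repr_independence'[of "c \<odot> k \<oplus> c \<odot> x" "c \<odot> x"] x coset by force
    qed
    moreover have "x \<in> K +> x" by (rule K.a_rcos_self[OF x])
    ultimately show ?thesis by blast
  qed
  moreover have "the_elem {cinner V u v |u v. u \<in> K +> x \<and> v \<in> K +> y} = cinner V x y"
    if x: "x \<in> carrier V" and y: "y \<in> carrier V" for x y
  proof -
    have r: "cinner V k z = 0" "cinner V z k = 0" if "k \<in> K" "z \<in> carrier V" for k z
      using that rad form_commute[of k z] by (auto simp: radical_def subset_iff)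
    have "cinner V u v = cinner V x y" if "u \<in> K +> x" "v \<in> K +> y" for u v
      using that x y Kf(1) unfolding coset by (auto simp: form_simps r subset_iff)
    moreover have "x \<in> K +> x" "y \<in> K +> y" using K.a_rcos_self x y by blast+
    ultimately have "{cinner V u v |u v. u \<in> K +> x \<and> v \<in> K +> y} = {cinner V x y}" by blast
    then show ?thesis by simp
  qed
  ultimately show "form_hom V (quotient_space V K) (\<lambda>x. K +> x)"
    by (auto simp: form_hom_def linear_on_def quotient_space_def A_RCOSETS_def')
qed

lemma hermitian_quotient:
  "\<lbrakk>submodule K complex_ring V; K \<subseteq> radical\<rbrakk> \<Longrightarrow> hermitian_space (quotient_space V K)"
  by (rule hermitian_space_image[OF hermitian_space_axioms]) (rule quotient_coset_map; assumption)+

end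

lemma (in semi_inner_space) sep_class_map:
  shows "form_hom V (separated V) (sep_class V)"
    and "sep_class V ` carrier V = carrier (separated V)"
    and "pre_hilbert (separated V)"
proof -
  have eq: "sep_class V = (\<lambda>x. radical +> x)" by (simp add: fun_eq_iff sep_class_def null_vectors_eq_radical)
  have sep: "separated V = quotient_space V radical" by (simp add: separated_def null_vectors_eq_radical)
  note Q = quotient_coset_map[OF radical_submodule order_refl, folded sep eq]
  show 1: "form_hom V (separated V) (sep_class V)" and 2: "sep_class V ` carrier V = carrier (separated V)"
    using Q by (simp_all add: eq)
  have z: "sep_class V \<zero> = \<zero>\<^bsub>separated V\<^esub>" using Q(3) by (simp add: eq)
  interpret S: semi_inner_space "separated V"
    using semi_inner_space_image[OF semi_inner_space_axioms 1 2 z] .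
  show "pre_hilbert (separated V)"
  proof (rule semi_inner_space_pre_hilbertI)
    show "semi_inner_space (separated V)" ..
    fix C assume "C \<in> carrier (separated V)" "cinner (separated V) C C = 0"
    then obtain x where x: "x \<in> carrier V" "C = sep_class V x" using 2 by blast
    have "cinner V x x = 0"
      using \<open>cinner (separated V) C C = 0\<close> form_homD(4)[OF 1 x(1) x(1)] x(2) by simp
    then have "x \<in> radical" using x(1) null_vectors_eq_radical by (auto simp: null_vectors_def)
    moreover have "subgroup radical (add_monoid V)" using radical_submodule by (simp add: submodule_def)
    moreover have "\<zero> \<in> radical" using submodule_facts(2)[OF radical_submodule] .
    ultimately have "radical +> x = radical +> \<zero>"
      using a_coset_join2[OF x(1), of radical] a_coset_join2[of \<zero> radical] by simp
    then show "C = \<zero>\<^bsub>separated V\<^esub>" using x z by (simp add: eq)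
  qed
qed

text \<open>A form-preserving map into a definite space cannot separate vectors that a
  surjective form-preserving map identifies: their difference has length zero.\<close>

lemma form_hom_factor:
  assumes "hermitian_space V" "pre_hilbert Y" and q: "form_hom V W q" "q ` carrier V = carrier W"
    and W: "hermitian_space W" and J: "form_hom V Y J"
  shows "\<exists>J'. form_hom W Y J' \<and> (\<forall>x\<in>carrier V. J' (q x) = J x)"
proof -
  interpret V: hermitian_space V by fact
  interpret Y: pre_hilbert Y by fact
  define J' where "J' = (\<lambda>C. J (inv_into (carrier V) q C))"
  have wd: "J x = J y" if x: "x \<in> carrier V" and y: "y \<in> carrier V" and "q x = q y" for x y
  proof -
    have e: "cinner V x z = cinner V y z" if "z \<in> carrier V" for z
      using form_homD(4)[OF q(1), of x z] form_homD(4)[OF q(1), of y z] that x y \<open>q x = q y\<close> by simp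
    let ?d = "J x \<ominus>\<^bsub>Y\<^esub> J y"
    have "cinner Y ?d ?d = 0"
      using x y form_homD(1)[OF J] by (simp add: Y.form_simps form_homD(4)[OF J] e)
    then have "?d = \<zero>\<^bsub>Y\<^esub>" using x y form_homD(1)[OF J] by (intro Y.cinner_definite) auto
    then show ?thesis using x y form_homD(1)[OF J] by (simp add: Y.minus_eq_zero_iff)
  qed
  have J': "J' (q x) = J x" if "x \<in> carrier V" for x
    unfolding J'_def using that by (intro wd) (auto intro: inv_into_into simp: f_inv_into_f)
  have "form_hom W Y J'"
  proof (rule form_homI[OF W \<open>pre_hilbert Y\<close>])
    show "J' C \<in> carrier Y" if C: "C \<in> carrier W" for C
    proof -
      obtain x where "x \<in> carrier V" "C = q x" using C q(2) by blast
      then show ?thesis using J' form_homD(1)[OF J] by simp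
    qed
    show "cinner Y (J' C) (J' D) = cinner W C D" if C: "C \<in> carrier W" "D \<in> carrier W" for C D
    proof -
      obtain x where "x \<in> carrier V" "C = q x" using C(1) q(2) by blast
      moreover obtain y where "y \<in> carrier V" "D = q y" using C(2) q(2) by blast
      ultimately show ?thesis by (simp add: J' form_homD(4)[OF J] form_homD(4)[OF q(1)])
    qed
  qed
  then show ?thesis using J' by blast
qed

subsection \<open>Completion\<close>

context pre_hilbert begin

lemma cauchy_space_carrier:
  "s \<in> carrier (cauchy_space V) \<longleftrightarrow> metric.MCauchy s"
  by (simp add: cauchy_space_def)

text \<open>Cauchy sequences are bounded, so by the Cauchy-Schwarz inequality the numbers
  \<open>\<langle>s n, t n\<rangle>\<close> form a Cauchy sequence and the form of the completion is an actual limit.\<close>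

lemma MCauchy_form_tendsto:
  assumes s: "metric.MCauchy s" and t: "metric.MCauchy t"
  shows "(\<lambda>n. cinner V (s n) (t n)) \<longlonglongrightarrow> cinner (cauchy_space V) s t"
proof -
  have bounded: "\<exists>B>0. \<forall>n. hnorm V (u n) \<le> B" if u: "metric.MCauchy u" for u
  proof -
    have uc: "u n \<in> carrier V" for n using u MCauchy_iff by blast
    have "Cauchy (\<lambda>n. hnorm V (u n))"
      unfolding Cauchy_def dist_real_def
    proof (intro allI impI)
      fix e :: real assume "e > 0"
      then obtain N where "\<forall>n\<ge>N. \<forall>m\<ge>N. hnorm V (u n \<ominus> u m) < e" using u MCauchy_iff by blast
      then show "\<exists>N. \<forall>m\<ge>N. \<forall>n\<ge>N. \<bar>hnorm V (u m) - hnorm V (u n)\<bar> < e"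
        using hnorm_diff_abs[OF uc uc] by (meson order.strict_trans1)
    qed
    then have "Bseq (\<lambda>n. hnorm V (u n))" by (rule Cauchy_Bseq)
    then show ?thesis unfolding Bseq_def using uc by auto
  qed
  obtain B where B: "B > 0" "\<And>n. hnorm V (s n) \<le> B" using bounded[OF s] by blast
  obtain C where C: "C > 0" "\<And>n. hnorm V (t n) \<le> C" using bounded[OF t] by blast
  have c: "s n \<in> carrier V" "t n \<in> carrier V" for n using s t MCauchy_iff by blast+
  have "Cauchy (\<lambda>n. cinner V (s n) (t n))"
    unfolding Cauchy_def dist_norm
  proof (intro allI impI)
    fix e :: real assume e: "e > 0"
    obtain N where N: "\<forall>n\<ge>N. \<forall>m\<ge>N. hnorm V (s n \<ominus> s m) < e / (2 * C)"
      using s e C(1) MCauchy_iff[of s] by (meson divide_pos_pos mult_pos_pos zero_less_numeral)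
    obtain M where M: "\<forall>n\<ge>M. \<forall>m\<ge>M. hnorm V (t n \<ominus> t m) < e / (2 * B)"
      using t e B(1) MCauchy_iff[of t] by (meson divide_pos_pos mult_pos_pos zero_less_numeral)
    show "\<exists>K. \<forall>m\<ge>K. \<forall>n\<ge>K. cmod (cinner V (s m) (t m) - cinner V (s n) (t n)) < e"
    proof (intro exI[of _ "max N M"] allI impI)
      fix m n assume mn: "max N M \<le> m" "max N M \<le> n"
      have "cinner V (s m) (t m) - cinner V (s n) (t n)
          = cinner V (s m \<ominus> s n) (t m) + cinner V (s n) (t m \<ominus> t n)"
        using c by (simp add: form_simps)
      also have "cmod \<dots> \<le> cmod (cinner V (s m \<ominus> s n) (t m)) + cmod (cinner V (s n) (t m \<ominus> t n))"
        by (rule norm_triangle_ineq)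
      also have "\<dots> \<le> hnorm V (s m \<ominus> s n) * hnorm V (t m) + hnorm V (s n) * hnorm V (t m \<ominus> t n)"
        using c by (intro add_mono Cauchy_Schwarz) auto
      also have "\<dots> \<le> hnorm V (s m \<ominus> s n) * C + B * hnorm V (t m \<ominus> t n)"
        using c B C by (intro add_mono mult_left_mono mult_right_mono) auto
      also have "\<dots> < e / (2 * C) * C + B * (e / (2 * B))"
        using N M mn B(1) C(1) by (intro add_strict_mono mult_strict_right_mono mult_strict_left_mono) auto
      also have "\<dots> = e" using B(1) C(1) by simp
      finally show "cmod (cinner V (s m) (t m) - cinner V (s n) (t n)) < e" .
    qed
  qed
  then have "convergent (\<lambda>n. cinner V (s n) (t n))" by (simp add: Cauchy_convergent_iff)
  then show ?thesis by (simp add: cauchy_space_def convergent_LIMSEQ_iff)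
qed

lemma MCauchy_add:
  assumes s: "metric.MCauchy s" and t: "metric.MCauchy t"
  shows "metric.MCauchy (\<lambda>n. s n \<oplus> t n)"
  unfolding MCauchy_iff
proof (intro conjI allI impI)
  have c: "s n \<in> carrier V" "t n \<in> carrier V" for n using s t MCauchy_iff by blast+
  then show "s n \<oplus> t n \<in> carrier V" for n by simp
  fix e :: real assume "e > 0"
  then have "e / 2 > 0" by simp
  obtain N where N: "\<forall>n\<ge>N. \<forall>m\<ge>N. hnorm V (s n \<ominus> s m) < e / 2"
    using s \<open>e / 2 > 0\<close> MCauchy_iff by blast
  obtain M where M: "\<forall>n\<ge>M. \<forall>m\<ge>M. hnorm V (t n \<ominus> t m) < e / 2"
    using t \<open>e / 2 > 0\<close> MCauchy_iff by blast
  show "\<exists>N. \<forall>n\<ge>N. \<forall>m\<ge>N. hnorm V ((s n \<oplus> t n) \<ominus> (s m \<oplus> t m)) < e"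
  proof (intro exI[of _ "max N M"] allI impI)
    fix n m assume "max N M \<le> n" "max N M \<le> m"
    then have "hnorm V (s n \<ominus> s m) < e / 2" "hnorm V (t n \<ominus> t m) < e / 2" using N M by auto
    then show "hnorm V ((s n \<oplus> t n) \<ominus> (s m \<oplus> t m)) < e"
      using hnorm_minus_add[OF c(1) c(2) c(1) c(2), of n n m m] by linarith
  qed
qed

lemma MCauchy_smult:
  assumes s: "metric.MCauchy s"
  shows "metric.MCauchy (\<lambda>n. c \<odot> s n)"
  unfolding MCauchy_iff
proof (intro conjI allI impI)
  have sc: "s n \<in> carrier V" for n using s MCauchy_iff by blast
  then show "c \<odot> s n \<in> carrier V" for n by simp
  fix e :: real assume "e > 0"
  then have "e / (cmod c + 1) > 0" by (simp add: add_nonneg_pos)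
  then obtain N where N: "\<forall>n\<ge>N. \<forall>m\<ge>N. hnorm V (s n \<ominus> s m) < e / (cmod c + 1)"
    using s MCauchy_iff by blast
  have "hnorm V (c \<odot> s n \<ominus> c \<odot> s m) < e" if "n \<ge> N" "m \<ge> N" for n m
  proof -
    have "hnorm V (c \<odot> s n \<ominus> c \<odot> s m) \<le> (cmod c + 1) * hnorm V (s n \<ominus> s m)"
      using sc by (simp add: hnorm_minus_smult mult_right_mono)
    also have "\<dots> < (cmod c + 1) * (e / (cmod c + 1))"
      using N that by (intro mult_strict_left_mono) (auto simp: add_nonneg_pos)
    also have "\<dots> = e" using add_nonneg_pos[of "cmod c" 1] by simp
    finally show ?thesis .
  qed
  then show "\<exists>N. \<forall>n\<ge>N. \<forall>m\<ge>N. hnorm V (c \<odot> s n \<ominus> c \<odot> s m) < e" by blast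
qed

lemma semi_inner_space_cauchy: "semi_inner_space (cauchy_space V)"
proof -
  let ?C = "cauchy_space V"
  have ops: "\<zero>\<^bsub>?C\<^esub> = (\<lambda>n. \<zero>)" "s \<oplus>\<^bsub>?C\<^esub> t = (\<lambda>n. s n \<oplus> t n)" "c \<odot>\<^bsub>?C\<^esub> s = (\<lambda>n. c \<odot> s n)" for s t c
    by (simp_all add: cauchy_space_def)
  have inV: "s n \<in> carrier V" if "metric.MCauchy s" for s n using that MCauchy_iff by blast
  have ag: "abelian_group ?C"
  proof (rule abelian_groupI)
    fix s assume "s \<in> carrier ?C"
    then have s: "metric.MCauchy s" by (simp add: cauchy_space_carrier)
    show "\<exists>t\<in>carrier ?C. t \<oplus>\<^bsub>?C\<^esub> s = \<zero>\<^bsub>?C\<^esub>"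
      using MCauchy_smult[OF s, of "-1"] inV[OF s]
      by (intro bexI[of _ "\<lambda>n. (-1) \<odot> s n"]) (auto simp: cauchy_space_carrier ops l_neg simp flip: uminus_eq_smult)
  qed (use inV in \<open>auto simp: cauchy_space_carrier ops MCauchy_add a_assoc a_comm a_lcomm\<close>)
  have "module complex_ring ?C"
    by (rule moduleI[OF complex_cring.is_cring ag])
      (auto simp: cauchy_space_carrier ops MCauchy_smult inV smult_add smult_add_scalar smult_smult)
  then interpret C: complex_module ?C by (simp add: complex_module_def)
  note lim = MCauchy_form_tendsto
  show ?thesis
  proof unfold_locales
    fix s t u c assume "s \<in> carrier ?C" "u \<in> carrier ?C"
    then have s: "metric.MCauchy s" and u: "metric.MCauchy u" by (simp_all add: cauchy_space_carrier)
    show "cinner ?C (c \<odot>\<^bsub>?C\<^esub> s) u = c * cinner ?C s u"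
    proof (rule LIMSEQ_unique)
      show "(\<lambda>n. c * cinner V (s n) (u n)) \<longlonglongrightarrow> cinner ?C (c \<odot>\<^bsub>?C\<^esub> s) u"
        using lim[OF MCauchy_smult[OF s] u] by (simp add: ops form_simps inV[OF s] inV[OF u])
      show "(\<lambda>n. c * cinner V (s n) (u n)) \<longlonglongrightarrow> c * cinner ?C s u"
        by (intro tendsto_intros lim s u)
    qed
    show "cinner ?C u s = cnj (cinner ?C s u)"
    proof (rule LIMSEQ_unique)
      show "(\<lambda>n. cinner V (u n) (s n)) \<longlonglongrightarrow> cinner ?C u s" by (rule lim[OF u s])
      show "(\<lambda>n. cinner V (u n) (s n)) \<longlonglongrightarrow> cnj (cinner ?C s u)"
        using tendsto_cnj[OF lim[OF s u]] by (simp add: form_commute[OF inV[OF s] inV[OF u]])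
    qed
    show "0 \<le> Re (cinner ?C s s)"
      using tendsto_Re[OF lim[OF s s]] by (rule LIMSEQ_le_const) (use form_nonneg inV[OF s] in auto)
    assume "t \<in> carrier ?C"
    then have t: "metric.MCauchy t" by (simp add: cauchy_space_carrier)
    show "cinner ?C (s \<oplus>\<^bsub>?C\<^esub> t) u = cinner ?C s u + cinner ?C t u"
    proof (rule LIMSEQ_unique)
      show "(\<lambda>n. cinner V (s n) (u n) + cinner V (t n) (u n)) \<longlonglongrightarrow> cinner ?C (s \<oplus>\<^bsub>?C\<^esub> t) u"
        using lim[OF MCauchy_add[OF s t] u] by (simp add: ops form_simps inV[OF s] inV[OF t] inV[OF u])
      show "(\<lambda>n. cinner V (s n) (u n) + cinner V (t n) (u n)) \<longlonglongrightarrow> cinner ?C s u + cinner ?C t u"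
        by (intro tendsto_intros lim s t u)
    qed
  qed
qed

lemma pre_hilbert_completion: "pre_hilbert (completion V)"
  unfolding completion_def using semi_inner_space_cauchy by (rule semi_inner_space.sep_class_map)

lemma completion_embed_form_hom: "form_hom V (completion V) (completion_embed V)"
proof (rule form_homI[OF hermitian_space_axioms pre_hilbert_completion])
  interpret C: semi_inner_space "cauchy_space V" by (rule semi_inner_space_cauchy)
  note S = C.sep_class_map(1)
  have const: "(\<lambda>n. x) \<in> carrier (cauchy_space V)" if "x \<in> carrier V" for x
    using that by (simp add: cauchy_space_carrier)
  show "completion_embed V x \<in> carrier (completion V)" if "x \<in> carrier V" for x
    unfolding completion_embed_def completion_def using const[OF that] by (rule form_homD(1)[OF S])
  show "cinner (completion V) (completion_embed V x) (completion_embed V y) = cinner V x y"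
    if "x \<in> carrier V" "y \<in> carrier V" for x y
    unfolding completion_embed_def completion_def
    using form_homD(4)[OF S const const, OF that] by (simp add: cauchy_space_def)
qed

text \<open>Universal property of the completion.  The isometry sends the class of a Cauchy sequence
  \<open>s\<close> to the limit of \<open>J \<circ> s\<close>.\<close>

lemma completion_isometry:
  assumes Y: "hilbert Y" and J: "form_hom V Y J"
    and dense: "htopology Y closure_of (J ` carrier V) = carrier Y"
  shows "\<exists>W. form_hom (completion V) Y W \<and> W ` carrier (completion V) = carrier Y \<and>
    (\<forall>x\<in>carrier V. W (completion_embed V x) = J x)"
proof -
  interpret Y: hilbert Y by fact
  interpret C: semi_inner_space "cauchy_space V" by (rule semi_inner_space_cauchy)
  have Jm: "J (x \<ominus> y) = J x \<ominus>\<^bsub>Y\<^esub> J y" if "x \<in> carrier V" "y \<in> carrier V" for x y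
    by (rule form_hom_minus[OF J _ _ that]) unfold_locales
  have JY: "J x \<in> carrier Y" if "x \<in> carrier V" for x using form_homD(1)[OF J that] .
  have inV: "s n \<in> carrier V" if "metric.MCauchy s" for s n using that MCauchy_iff by blast
  have JCauchy: "Y.metric.MCauchy (\<lambda>n. J (s n)) \<longleftrightarrow> metric.MCauchy s" if "\<And>n. s n \<in> carrier V" for s
    unfolding MCauchy_iff Y.MCauchy_iff using that by (simp add: JY flip: Jm) (simp add: form_homD(5)[OF J])
  define L where "L = (\<lambda>s. THE y. limitin (htopology Y) (\<lambda>n. J (s n)) y sequentially)"
  have Leq: "L s = y" if "limitin (htopology Y) (\<lambda>n. J (s n)) y sequentially" for s y
    unfolding L_def using that by (rule the_equality) (metis Y.limit_unique that sequentially_bot)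
  have L: "limitin (htopology Y) (\<lambda>n. J (s n)) (L s) sequentially" if s: "metric.MCauchy s" for s
  proof -
    have "Y.metric.MCauchy (\<lambda>n. J (s n))" using s JCauchy inV by blast
    then obtain y where "limitin (htopology Y) (\<lambda>n. J (s n)) y sequentially"
      using Y.complete unfolding Y.metric.mcomplete_def htopology_def by blast
    then show ?thesis using Leq by metis
  qed
  have norm_lim: "(\<lambda>n. cinner Y (J (s n)) (J (t n))) \<longlonglongrightarrow> cinner Y (L s) (L t)"
    if s: "metric.MCauchy s" and t: "metric.MCauchy t" for s t
  proof -
    have lc: "L u \<in> carrier Y" if "metric.MCauchy u" for u
      using L[OF that] Y.limitin_htopology_iff by blast
    have d0: "(\<lambda>n. hnorm Y (J (u n) \<ominus>\<^bsub>Y\<^esub> L u)) \<longlonglongrightarrow> 0" if u: "metric.MCauchy u" for u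
    proof (rule tendstoI)
      fix e :: real assume "e > 0"
      then have "\<forall>\<^sub>F n in sequentially. J (u n) \<in> carrier Y \<and> hnorm Y (J (u n) \<ominus>\<^bsub>Y\<^esub> L u) < e"
        using L[OF u] unfolding Y.limitin_htopology_iff by blast
      then show "\<forall>\<^sub>F n in sequentially. dist (hnorm Y (J (u n) \<ominus>\<^bsub>Y\<^esub> L u)) 0 < e"
        by eventually_elim (use lc[OF u] in simp)
    qed
    have "(\<lambda>n. hnorm Y (J (s n) \<ominus>\<^bsub>Y\<^esub> L s) * (hnorm Y (J (t n) \<ominus>\<^bsub>Y\<^esub> L t) + hnorm Y (L t))
        + hnorm Y (L s) * hnorm Y (J (t n) \<ominus>\<^bsub>Y\<^esub> L t)) \<longlonglongrightarrow> 0 * (0 + hnorm Y (L t)) + hnorm Y (L s) * 0"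
      by (intro tendsto_intros d0 s t)
    then have "(\<lambda>n. hnorm Y (J (s n) \<ominus>\<^bsub>Y\<^esub> L s) * (hnorm Y (J (t n) \<ominus>\<^bsub>Y\<^esub> L t) + hnorm Y (L t))
        + hnorm Y (L s) * hnorm Y (J (t n) \<ominus>\<^bsub>Y\<^esub> L t)) \<longlonglongrightarrow> 0" by simp
    then have "(\<lambda>n. cinner Y (J (s n)) (J (t n)) - cinner Y (L s) (L t)) \<longlonglongrightarrow> 0"
    proof (rule Lim_null_comparison[rotated])
      show "\<forall>\<^sub>F n in sequentially. norm (cinner Y (J (s n)) (J (t n)) - cinner Y (L s) (L t)) \<le>
        hnorm Y (J (s n) \<ominus>\<^bsub>Y\<^esub> L s) * (hnorm Y (J (t n) \<ominus>\<^bsub>Y\<^esub> L t) + hnorm Y (L t))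
        + hnorm Y (L s) * hnorm Y (J (t n) \<ominus>\<^bsub>Y\<^esub> L t)"
      proof (intro always_eventually allI)
        fix n
        let ?a = "J (s n)" and ?b = "J (t n)"
        have ab: "?a \<in> carrier Y" "?b \<in> carrier Y" using JY inV s t by auto
        note cc = ab lc[OF s] lc[OF t]
        have "cinner Y ?a ?b - cinner Y (L s) (L t)
            = cinner Y (?a \<ominus>\<^bsub>Y\<^esub> L s) ?b + cinner Y (L s) (?b \<ominus>\<^bsub>Y\<^esub> L t)"
          using cc by (simp add: Y.form_simps)
        also have "norm \<dots> \<le> hnorm Y (?a \<ominus>\<^bsub>Y\<^esub> L s) * hnorm Y ?b + hnorm Y (L s) * hnorm Y (?b \<ominus>\<^bsub>Y\<^esub> L t)"
          using cc by (intro order_trans[OF norm_triangle_ineq] add_mono Y.Cauchy_Schwarz) auto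
        also have "\<dots> \<le> hnorm Y (?a \<ominus>\<^bsub>Y\<^esub> L s) * (hnorm Y (?b \<ominus>\<^bsub>Y\<^esub> L t) + hnorm Y (L t))
            + hnorm Y (L s) * hnorm Y (?b \<ominus>\<^bsub>Y\<^esub> L t)"
          using cc Y.hnorm_diff_abs[of ?b "L t"] by (intro add_right_mono mult_left_mono) auto
        finally show "norm (cinner Y ?a ?b - cinner Y (L s) (L t)) \<le> \<dots>" .
      qed
    qed
    then show ?thesis by (simp add: LIM_zero_iff)
  qed
  have Lform: "form_hom (cauchy_space V) Y L"
  proof (rule form_homI)
    show "hermitian_space (cauchy_space V)" "pre_hilbert Y" by unfold_locales
    show "L s \<in> carrier Y" if "s \<in> carrier (cauchy_space V)" for s
      using that L Y.limitin_htopology_iff by (auto simp: cauchy_space_carrier)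
    fix s t assume "s \<in> carrier (cauchy_space V)" "t \<in> carrier (cauchy_space V)"
    then have st: "metric.MCauchy s" "metric.MCauchy t" by (simp_all add: cauchy_space_carrier)
    then have "(\<lambda>n. cinner V (s n) (t n)) \<longlonglongrightarrow> cinner Y (L s) (L t)"
      using norm_lim[OF st] inV by (simp add: form_homD(4)[OF J])
    then show "cinner Y (L s) (L t) = cinner (cauchy_space V) s t"
      using MCauchy_form_tendsto[OF st] LIMSEQ_unique by blast
  qed
  have Lonto: "\<exists>s\<in>carrier (cauchy_space V). L s = y" if y: "y \<in> carrier Y" for y
  proof -
    have "\<exists>x\<in>carrier V. hnorm Y (y \<ominus>\<^bsub>Y\<^esub> J x) < inverse (real (Suc n))" for n
    proof -
      have "y \<in> htopology Y closure_of (J ` carrier V)" using y dense by simp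
      moreover have "J ` carrier V \<subseteq> carrier Y" using JY by auto
      ultimately show ?thesis using Y.closure_htopology_iff[of "J ` carrier V" y] by simp
    qed
    then obtain s where s: "\<And>n. s n \<in> carrier V" "\<And>n. hnorm Y (y \<ominus>\<^bsub>Y\<^esub> J (s n)) < inverse (real (Suc n))"
      by metis
    have lim: "limitin (htopology Y) (\<lambda>n. J (s n)) y sequentially"
      unfolding Y.limitin_htopology_iff
    proof (intro conjI allI impI y)
      fix e :: real assume "e > 0"
      then have "\<forall>\<^sub>F n in sequentially. inverse (real (Suc n)) < e"
        using LIMSEQ_inverse_real_of_nat by (auto dest: order_tendstoD)
      then show "\<forall>\<^sub>F n in sequentially. J (s n) \<in> carrier Y \<and> hnorm Y (J (s n) \<ominus>\<^bsub>Y\<^esub> y) < e"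
      proof eventually_elim
        case (elim n)
        then show ?case using s(1)[of n] s(2)[of n] JY y Y.hnorm_minus_commute[of y "J (s n)"] by simp
      qed
    qed
    have "Y.metric.MCauchy (\<lambda>n. J (s n))"
      using lim s(1) JY unfolding htopology_def by (intro Y.metric.convergent_imp_MCauchy) auto
    then have "metric.MCauchy s" using JCauchy s(1) by blast
    then show ?thesis using Leq[OF lim] cauchy_space_carrier by blast
  qed
  interpret S: pre_hilbert "separated (cauchy_space V)" by (rule C.sep_class_map(3))
  have "\<exists>W. form_hom (completion V) Y W \<and> (\<forall>s\<in>carrier (cauchy_space V). W (sep_class (cauchy_space V) s) = L s)"
    unfolding completion_def
    using form_hom_factor[OF C.hermitian_space_axioms Y.pre_hilbert_axioms C.sep_class_map(1,2)
        S.hermitian_space_axioms Lform] .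
  then obtain W where W: "form_hom (completion V) Y W"
    and WL: "\<And>s. s \<in> carrier (cauchy_space V) \<Longrightarrow> W (sep_class (cauchy_space V) s) = L s" by blast
  have "carrier Y \<subseteq> W ` carrier (completion V)"
  proof
    fix y assume "y \<in> carrier Y"
    then obtain s where s: "s \<in> carrier (cauchy_space V)" "L s = y" using Lonto by blast
    then have "sep_class (cauchy_space V) s \<in> carrier (completion V)"
      unfolding completion_def using C.sep_class_map(2) by blast
    then show "y \<in> W ` carrier (completion V)" using WL[OF s(1)] s(2) by force
  qed
  then have "W ` carrier (completion V) = carrier Y" using form_homD(1)[OF W] by blast
  moreover have "W (completion_embed V x) = J x" if x: "x \<in> carrier V" for x
  proof -
    have "limitin (htopology Y) (\<lambda>n. J x) (J x) sequentially"
      unfolding Y.limitin_htopology_iff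
      using JY[OF x] Y.minus_eq_zero_iff[of "J x" "J x"] by simp
    then have "L (\<lambda>n. x) = J x" by (rule Leq)
    then show ?thesis unfolding completion_embed_def using x by (subst WL) (auto simp: cauchy_space_carrier)
  qed
  ultimately show ?thesis using W by blast
qed

end

section \<open>Homogeneous parts of a graded star-algebra\<close>

sublocale star_algebra \<subseteq> complex_module A
  by unfold_locales

lemma (in star_algebra) star_zero: "star A \<zero> = \<zero>"
  using star_smult[of \<zero> 0] star_closed[of \<zero>] by simp

lemma (in star_algebra) star_one: "star A \<one> = \<one>"
proof -
  have "star A (star A \<one> \<otimes> \<one>) = star A \<one> \<otimes> star A (star A \<one>)"
    by (rule star_mult) (simp_all add: star_closed)
  then show ?thesis by (simp add: star_closed star_star)
qed

locale graded_algebra_subgroup = graded_star_algebra G A \<A> + G: group G + H: subgroup H G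
  for G :: "('g, 'm) monoid_scheme" and A :: "'a star_alg" (structure)
    and \<A> :: "'g \<Rightarrow> 'a set" and H :: "'g set"
begin

abbreviation part :: "'g set \<Rightarrow> 'a set" where "part \<equiv> graded_part A \<A>"

lemma grade_facts:
  assumes "g \<in> carrier G"
  shows "\<A> g \<subseteq> carrier A" "\<zero> \<in> \<A> g" "\<And>x y. \<lbrakk>x \<in> \<A> g; y \<in> \<A> g\<rbrakk> \<Longrightarrow> x \<oplus> y \<in> \<A> g"
    "\<And>c x. x \<in> \<A> g \<Longrightarrow> c \<odot> x \<in> \<A> g"
  using submodule_facts[OF grade_submodule[OF assms]] by auto

lemma zero_in_part: "\<zero> \<in> part S"
  unfolding graded_part_def by (rule CollectI, rule exI[of _ "{}"]) simp

text \<open>A member of \<open>part S\<close> is given by a choice of summands over a finite set of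
  degrees.  The new summand is merged with the old one of the same degree, which is taken to be zero
  where there was none.\<close>

lemma part_add_homogeneous:
  assumes S: "S \<subseteq> carrier G" and g: "g \<in> S" and x: "x \<in> \<A> g" and b: "b \<in> part S"
  shows "x \<oplus> b \<in> part S"
proof -
  obtain F f where F: "finite F" "F \<subseteq> S" "f \<in> (\<Pi> g\<in>F. \<A> g)" "b = finsum A f F"
    using b by (auto simp: graded_part_def)
  define f0 where "f0 = (\<lambda>h. if h \<in> F then f h else \<zero>)"
  have f0: "f0 h \<in> \<A> h" "f0 h \<in> carrier A" if "h \<in> S" for h
    using that F(3) S grade_facts(1,2)[of h] by (auto simp: f0_def Pi_iff subset_iff)
  have xc: "x \<in> carrier A" using x g S grade_facts(1) by blast
  have "b = finsum A f0 (insert g F)"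
  proof -
    have "finsum A f F = finsum A f0 (insert g F)"
      by (rule add.finprod_mono_neutral_cong_left)
         (use F g f0 S in \<open>auto simp: f0_def Pi_iff subset_iff\<close>, use f0 F in \<open>force simp: f0_def subset_iff\<close>)
    then show ?thesis using F by simp
  qed
  also have "\<dots> = f0 g \<oplus> finsum A f0 (F - {g})"
  proof -
    have "finsum A f0 (insert g (F - {g})) = f0 g \<oplus> finsum A f0 (F - {g})"
      using F f0 g by (intro finsum_insert) auto
    then show ?thesis by simp
  qed
  finally have b': "b = f0 g \<oplus> finsum A f0 (F - {g})" .
  have c1: "finsum A f0 (F - {g}) \<in> carrier A" using F f0 by (intro finsum_closed) auto
  let ?f = "f0(g := x \<oplus> f0 g)"
  have "finsum A ?f (insert g (F - {g})) = ?f g \<oplus> finsum A ?f (F - {g})"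
    using F f0 g xc by (intro finsum_insert) auto
  also have "finsum A ?f (F - {g}) = finsum A f0 (F - {g})"
    using F f0 by (intro finsum_cong') auto
  also have "?f g \<oplus> finsum A f0 (F - {g}) = x \<oplus> b"
    unfolding b' fun_upd_same using xc f0(2)[OF g] c1 by (rule a_assoc)
  finally have "x \<oplus> b = finsum A ?f (insert g (F - {g}))" by (rule sym)
  moreover have "?f \<in> (\<Pi> h\<in>insert g (F - {g}). \<A> h)"
  proof (rule Pi_I)
    fix h assume "h \<in> insert g (F - {g})"
    then have "h \<in> S" using F(2) g by auto
    then show "?f h \<in> \<A> h" using f0(1) g S x grade_facts(3)[of g x "f0 g"] by auto
  qed
  ultimately show ?thesis unfolding graded_part_def
    using F(1,2) g by (intro CollectI exI[of _ "insert g (F - {g})"] exI[of _ ?f]) auto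
qed

lemma part_homogeneous:
  assumes "S \<subseteq> carrier G" "g \<in> S" "x \<in> \<A> g"
  shows "x \<in> part S"
  using part_add_homogeneous[OF assms zero_in_part] assms grade_facts(1)[of g]
  by (simp add: subset_iff)

text \<open>Statements about \<open>part S\<close> that are additive need only be checked on homogeneous
  elements; nearly every fact about the grading below is obtained in this way.\<close>

lemma part_induct [consumes 2, case_names zero add]:
  assumes S: "S \<subseteq> carrier G" and a: "a \<in> part S" and zero: "P \<zero>"
    and add: "\<And>g x b. \<lbrakk>g \<in> S; x \<in> \<A> g; x \<in> carrier A; b \<in> part S; b \<in> carrier A; P b\<rbrakk> \<Longrightarrow> P (x \<oplus> b)"
  shows "P a"
proof -
  obtain F f where F: "finite F" "F \<subseteq> S" "f \<in> (\<Pi> g\<in>F. \<A> g)" "a = finsum A f F"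
    using a by (auto simp: graded_part_def)
  have "P (finsum A f F) \<and> finsum A f F \<in> part S \<and> finsum A f F \<in> carrier A"
    using F(1-3)
  proof (induction F)
    case empty then show ?case by (simp add: zero zero_in_part)
  next
    case (insert g F)
    have fc: "f h \<in> carrier A" "f h \<in> \<A> h" if "h \<in> insert g F" for h
      using that insert.prems S grade_facts(1)[of h] by auto
    then have "finsum A f (insert g F) = f g \<oplus> finsum A f F"
      using insert.hyps by (intro finsum_insert) auto
    then show ?case using insert fc add[of g "f g" "finsum A f F"]
      part_add_homogeneous[OF S, of g "f g" "finsum A f F"] by auto
  qed
  then show ?thesis using F by simp
qed

lemma part_in_carrier: "\<lbrakk>S \<subseteq> carrier G; a \<in> part S\<rbrakk> \<Longrightarrow> a \<in> carrier A"
  by (induction rule: part_induct) auto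

lemma part_add:
  assumes S: "S \<subseteq> carrier G" and a: "a \<in> part S" and b: "b \<in> part S"
  shows "a \<oplus> b \<in> part S"
  using S a
proof (induction rule: part_induct)
  case zero then show ?case using b part_in_carrier[OF S b] by simp
next
  case (add g x c)
  then show ?case
    using part_add_homogeneous[OF S add(1,2,6)] part_in_carrier[OF S b] by (simp add: a_assoc)
qed

lemma part_smult:
  assumes S: "S \<subseteq> carrier G" and a: "a \<in> part S"
  shows "c \<odot> a \<in> part S"
  using S a
proof (induction rule: part_induct)
  case zero then show ?case using zero_in_part by simp
next
  case (add g x b)
  then show ?case using part_add_homogeneous[OF S, of g "c \<odot> x" "c \<odot> b"] grade_facts(4)[of g x c] S
    by (auto simp: smult_add)
qed

lemma part_mult:
  assumes S: "S \<subseteq> carrier G" and T: "T \<subseteq> carrier G" and U: "U \<subseteq> carrier G"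
    and STU: "\<And>g h. \<lbrakk>g \<in> S; h \<in> T\<rbrakk> \<Longrightarrow> g \<otimes>\<^bsub>G\<^esub> h \<in> U" and a: "a \<in> part S" and b: "b \<in> part T"
  shows "a \<otimes> b \<in> part U"
  using S a
proof (induction rule: part_induct)
  case zero then show ?case using zero_in_part part_in_carrier[OF T b] by simp
next
  case (add g x c)
  have "x \<otimes> b \<in> part U"
    using T b
  proof (induction rule: part_induct)
    case zero then show ?case using add zero_in_part by simp
  next
    case a2: (add h y d)
    have "x \<otimes> y \<in> part U"
      using add a2 S T by (intro part_homogeneous[OF U STU[OF add(1) a2(1)]] grade_mult) auto
    then show ?case using add a2 part_add[OF U] by (simp add: r_distr)
  qed
  then show ?case using add part_add[OF U] part_in_carrier[OF T b] by (simp add: l_distr)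
qed

lemma part_star:
  assumes S: "S \<subseteq> carrier G" and U: "U \<subseteq> carrier G"
    and SU: "\<And>g. g \<in> S \<Longrightarrow> inv\<^bsub>G\<^esub> g \<in> U" and a: "a \<in> part S"
  shows "star A a \<in> part U"
  using S a
proof (induction rule: part_induct)
  case zero then show ?case using zero_in_part by (simp add: star_zero)
next
  case (add g x b)
  have "star A x \<in> part U"
    using add S by (intro part_homogeneous[OF U SU[OF add(1)]] grade_star) auto
  then show ?case using add part_add[OF U] by (simp add: star_add)
qed

subsection \<open>The projection onto the part over a set of degrees\<close>

text \<open>The projection is only ever used through this characterization: its value is the component
  in \<open>part S\<close> of any splitting along \<open>S\<close> and its complement.\<close>

lemma graded_proj_eq:
  assumes S: "S \<subseteq> carrier G" and b: "b \<in> part S" and c: "c \<in> part (carrier G - S)"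
  shows "graded_proj G A \<A> S (b \<oplus> c) = b"
proof -
  obtain F f where F: "finite F" "F \<subseteq> S" "f \<in> (\<Pi> g\<in>F. \<A> g)" "b = finsum A f F"
    using b by (auto simp: graded_part_def)
  obtain F' f' where F': "finite F'" "F' \<subseteq> carrier G - S" "f' \<in> (\<Pi> g\<in>F'. \<A> g)" "c = finsum A f' F'"
    using c by (auto simp: graded_part_def)
  \<comment> \<open>The decomposition of \<open>b + c\<close>; decompositions are \<open>undefined\<close> off the group.\<close>
  define k where "k = (\<lambda>g. if g \<in> carrier G then if g \<in> F then f g else if g \<in> F' then f' g else \<zero> else undefined)"
  have kA: "k g \<in> \<A> g" "k g \<in> carrier A" if "g \<in> carrier G" for g
    using that F(3) F'(3) grade_facts(1,2)[OF that] by (auto simp: k_def)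
  have supp: "{g \<in> carrier G. k g \<noteq> \<zero>} \<subseteq> F \<union> F'" by (auto simp: k_def split: if_splits)
  have FG: "F \<subseteq> carrier G" "F' \<subseteq> carrier G" using F F' S by auto
  have kF: "finsum A k F = b"
    unfolding F(4) by (rule finsum_cong') (use FG F kA in \<open>force simp: k_def\<close>)+
  have kF': "finsum A k F' = c"
    unfolding F'(4)
  proof (rule finsum_cong')
    show "f' \<in> F' \<rightarrow> carrier A" using F'(3) FG grade_facts(1) by (force simp: Pi_iff)
    show "k g = f' g" if "g \<in> F'" for g using that F F' by (auto simp: k_def)
  qed simp
  have tot: "finsum A k {g \<in> carrier G. k g \<noteq> \<zero>} = finsum A k (F \<union> F')"
    by (rule add.finprod_mono_neutral_cong_left) (use F(1) F'(1) supp FG kA in auto)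
  have "finsum A k (F \<union> F') = finsum A k F \<oplus> finsum A k F'"
    using F F' FG kA by (intro finsum_Un_disjoint) auto
  then have "is_decomposition G A \<A> (b \<oplus> c) k"
    unfolding is_decomposition_def using tot kF kF' kA supp F(1) F'(1)
    by (auto intro: finite_subset simp: k_def PiE_iff extensional_def)
  moreover have "b \<oplus> c \<in> carrier A" using part_in_carrier[OF S b] part_in_carrier[OF _ c] by simp
  ultimately have comp: "component G A \<A> (b \<oplus> c) = k"
    unfolding component_def using direct_sum by (intro the1_equality) auto
  have "finsum A k {g \<in> S. k g \<noteq> \<zero>} = finsum A k F"
  proof (rule add.finprod_mono_neutral_cong_left)
    show "{g \<in> S. k g \<noteq> \<zero>} \<subseteq> F" using F'(2) S by (auto simp: k_def split: if_splits)
  qed (use F(1,2) FG kA in auto)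
  then show ?thesis by (simp add: graded_proj_def comp kF)
qed

text \<open>Both \<open>a + 0\<close> and \<open>0 + a\<close> split \<open>a\<close> along \<open>S\<close>.\<close>

lemma part_disjoint:
  assumes "S \<subseteq> carrier G" "a \<in> part S" "a \<in> part (carrier G - S)"
  shows "a = \<zero>"
  using graded_proj_eq[OF assms(1,2) zero_in_part] graded_proj_eq[OF assms(1) zero_in_part assms(3)]
    part_in_carrier[OF assms(1,2)] by simp

lemma split_along:
  assumes S: "S \<subseteq> carrier G" and a: "a \<in> carrier A"
  obtains b c where "b \<in> part S" "c \<in> part (carrier G - S)" "a = b \<oplus> c"
proof -
  obtain f where f: "is_decomposition G A \<A> a f" using direct_sum[OF a] by blast
  let ?Z = "{g \<in> carrier G. f g \<noteq> \<zero>}"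
  have Z: "finite ?Z" "a = finsum A f ?Z" "\<And>g. g \<in> carrier G \<Longrightarrow> f g \<in> \<A> g"
    using f by (auto simp: is_decomposition_def PiE_iff)
  have fc: "f g \<in> carrier A" if "g \<in> carrier G" for g using Z(3) that grade_facts(1) by blast
  have "finsum A f ((?Z \<inter> S) \<union> (?Z - S)) = finsum A f (?Z \<inter> S) \<oplus> finsum A f (?Z - S)"
    using Z(1) fc by (intro finsum_Un_disjoint) auto
  moreover have "(?Z \<inter> S) \<union> (?Z - S) = ?Z" by blast
  ultimately have "a = finsum A f (?Z \<inter> S) \<oplus> finsum A f (?Z - S)" using Z(2) by simp
  moreover have "finsum A f (?Z \<inter> S) \<in> part S" unfolding graded_part_def
    using Z by (intro CollectI exI[of _ "?Z \<inter> S"] exI[of _ f]) auto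
  moreover have "finsum A f (?Z - S) \<in> part (carrier G - S)" unfolding graded_part_def
    using Z by (intro CollectI exI[of _ "?Z - S"] exI[of _ f]) auto
  ultimately show ?thesis using that by blast
qed

lemma carrier_eq_part: "part (carrier G) = carrier A"
proof
  show "part (carrier G) \<subseteq> carrier A" using part_in_carrier by blast
  show "carrier A \<subseteq> part (carrier G)"
  proof
    fix a assume "a \<in> carrier A"
    then obtain b c where bc: "b \<in> part (carrier G)" "c \<in> part (carrier G - carrier G)" "a = b \<oplus> c"
      by (rule split_along[OF order_refl])
    then have "c = \<zero>" by (auto simp: graded_part_def)
    then show "a \<in> part (carrier G)" using bc part_in_carrier[OF order_refl bc(1)] by simp
  qed
qed

subsection \<open>The conditional expectation onto the subalgebra over H\<close>

abbreviation p where "p \<equiv> graded_proj G A \<A> H"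

abbreviation B where "B \<equiv> graded_subalgebra A \<A> H"

lemma subset_G: "H \<subseteq> carrier G" "carrier G - H \<subseteq> carrier G" "x \<in> H \<Longrightarrow> x \<in> carrier G"
  using H.subset by auto

lemma B_simps [simp]:
  "carrier B = part H" "star B = star A" "x \<otimes>\<^bsub>B\<^esub> y = x \<otimes> y" "\<one>\<^bsub>B\<^esub> = \<one>" "x \<oplus>\<^bsub>B\<^esub> y = x \<oplus> y"
  "c \<odot>\<^bsub>B\<^esub> x = c \<odot> x" "\<zero>\<^bsub>B\<^esub> = \<zero>"
  by (simp_all add: graded_subalgebra_def)

lemma split_H:
  assumes "a \<in> carrier A"
  obtains c where "p a \<in> part H" "p a \<in> carrier A" "c \<in> part (carrier G - H)" "c \<in> carrier A" "a = p a \<oplus> c"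
proof -
  obtain b c where bc: "b \<in> part H" "c \<in> part (carrier G - H)" "a = b \<oplus> c"
    using split_along[OF subset_G(1) assms] .
  then have "p a = b" using graded_proj_eq[OF subset_G(1)] by blast
  then show ?thesis using that bc part_in_carrier[OF subset_G(1)] part_in_carrier[OF subset_G(2)] by blast
qed

lemma p_closed: "a \<in> carrier A \<Longrightarrow> p a \<in> part H"
  by (rule split_H)

lemma part_H_carrier: "a \<in> part H \<Longrightarrow> a \<in> carrier A"
  by (rule part_in_carrier[OF subset_G(1)])

lemma p_part: "a \<in> part H \<Longrightarrow> p a = a"
  using graded_proj_eq[OF subset_G(1) _ zero_in_part, of a] part_H_carrier[of a] by simp

lemma H_mult: "\<lbrakk>a \<in> part H; b \<in> part H\<rbrakk> \<Longrightarrow> a \<otimes> b \<in> part H"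
  by (rule part_mult[OF subset_G(1) subset_G(1) subset_G(1)]) auto

lemma H_star: "a \<in> part H \<Longrightarrow> star A a \<in> part H"
  by (rule part_star[OF subset_G(1) subset_G(1)]) auto

lemma inv_compl: "g \<in> carrier G - H \<Longrightarrow> inv\<^bsub>G\<^esub> g \<in> carrier G - H"
  using H.m_inv_closed[of "inv\<^bsub>G\<^esub> g"] by auto

lemma mult_compl:
  assumes "g \<in> carrier G - H" "h \<in> H"
  shows "g \<otimes>\<^bsub>G\<^esub> h \<in> carrier G - H" "h \<otimes>\<^bsub>G\<^esub> g \<in> carrier G - H"
proof -
  have hG: "h \<in> carrier G" using assms subset_G by blast
  have "(g \<otimes>\<^bsub>G\<^esub> h) \<otimes>\<^bsub>G\<^esub> inv\<^bsub>G\<^esub> h = g" "inv\<^bsub>G\<^esub> h \<otimes>\<^bsub>G\<^esub> (h \<otimes>\<^bsub>G\<^esub> g) = g"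
    using assms hG by (simp_all add: G.m_assoc flip: G.m_assoc[of "inv\<^bsub>G\<^esub> h"])
  then show "g \<otimes>\<^bsub>G\<^esub> h \<in> carrier G - H" "h \<otimes>\<^bsub>G\<^esub> g \<in> carrier G - H"
    using assms hG H.m_closed H.m_inv_closed by (metis DiffD1 DiffD2 DiffI G.m_closed)+
qed

text \<open>The properties of the expectation that follow have one proof: apply the operation
  to a splitting \<open>a = p a + c\<close>.  Subgroup and complement are both stable under inversion and under
  multiplication by \<open>H\<close>, so the result is again split along \<open>H\<close>.\<close>

lemma p_add: assumes "a \<in> carrier A" "b \<in> carrier A" shows "p (a \<oplus> b) = p a \<oplus> p b"
proof -
  obtain c where c: "c \<in> part (carrier G - H)" "c \<in> carrier A" "a = p a \<oplus> c" "p a \<in> part H" "p a \<in> carrier A"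
    using split_H[OF assms(1)] .
  obtain d where d: "d \<in> part (carrier G - H)" "d \<in> carrier A" "b = p b \<oplus> d" "p b \<in> part H" "p b \<in> carrier A"
    using split_H[OF assms(2)] .
  have "a \<oplus> b = (p a \<oplus> p b) \<oplus> (c \<oplus> d)"
    by (subst c(3), subst d(3)) (use c(2,5) d(2,5) in \<open>simp add: a_ac\<close>)
  then show ?thesis
    using graded_proj_eq[OF subset_G(1) part_add[OF subset_G(1) c(4) d(4)] part_add[OF subset_G(2) c(1) d(1)]]
    by simp
qed

lemma p_smult: assumes "a \<in> carrier A" shows "p (k \<odot> a) = k \<odot> p a"
proof -
  obtain c where c: "c \<in> part (carrier G - H)" "c \<in> carrier A" "a = p a \<oplus> c" "p a \<in> part H" "p a \<in> carrier A"
    using split_H[OF assms(1)] .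
  have "k \<odot> a = k \<odot> p a \<oplus> k \<odot> c"
    by (subst c(3)) (use c(2,5) in \<open>simp add: smult_add\<close>)
  then show ?thesis
    using graded_proj_eq[OF subset_G(1) part_smult[OF subset_G(1) c(4)] part_smult[OF subset_G(2) c(1)]]
    by simp
qed

lemma p_star: assumes "a \<in> carrier A" shows "p (star A a) = star A (p a)"
proof -
  obtain c where c: "c \<in> part (carrier G - H)" "c \<in> carrier A" "a = p a \<oplus> c" "p a \<in> part H" "p a \<in> carrier A"
    using split_H[OF assms(1)] .
  have "star A a = star A (p a) \<oplus> star A c"
    by (subst c(3)) (use c(2,5) in \<open>simp add: star_add\<close>)
  moreover have "star A c \<in> part (carrier G - H)"
    by (rule part_star[OF subset_G(2) subset_G(2) _ c(1)]) (rule inv_compl)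
  ultimately show ?thesis
    using graded_proj_eq[OF subset_G(1) H_star[OF c(4)]] by simp
qed

lemma p_mult_right: assumes "a \<in> carrier A" "b \<in> part H" shows "p (a \<otimes> b) = p a \<otimes> b"
proof -
  obtain c where c: "c \<in> part (carrier G - H)" "c \<in> carrier A" "a = p a \<oplus> c" "p a \<in> part H" "p a \<in> carrier A"
    using split_H[OF assms(1)] .
  have "a \<otimes> b = p a \<otimes> b \<oplus> c \<otimes> b"
    by (subst c(3)) (use c(2,5) part_H_carrier[OF assms(2)] in \<open>simp add: l_distr\<close>)
  moreover have "c \<otimes> b \<in> part (carrier G - H)"
    by (rule part_mult[OF subset_G(2) subset_G(1) subset_G(2) _ c(1) assms(2)]) (rule mult_compl)
  ultimately show ?thesis
    using graded_proj_eq[OF subset_G(1) H_mult[OF c(4) assms(2)]] by simp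
qed

lemma p_mult_left: assumes "a \<in> carrier A" "b \<in> part H" shows "p (b \<otimes> a) = b \<otimes> p a"
proof -
  obtain c where c: "c \<in> part (carrier G - H)" "c \<in> carrier A" "a = p a \<oplus> c" "p a \<in> part H" "p a \<in> carrier A"
    using split_H[OF assms(1)] .
  have "b \<otimes> a = b \<otimes> p a \<oplus> b \<otimes> c"
    by (subst c(3)) (use c(2,5) part_H_carrier[OF assms(2)] in \<open>simp add: r_distr\<close>)
  moreover have "b \<otimes> c \<in> part (carrier G - H)"
    by (rule part_mult[OF subset_G(1) subset_G(2) subset_G(2) _ assms(2) c(1)]) (rule mult_compl)
  ultimately show ?thesis
    using graded_proj_eq[OF subset_G(1) H_mult[OF assms(2) c(4)]] by simp
qed

text \<open>Writing \<open>1 = b + c\<close> along \<open>H\<close> and its complement, \<open>c x\<close> has degrees outside \<open>H g\<close> for \<open>x\<close> of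
  degree \<open>g\<close>, while \<open>c x = x - b x\<close> has degrees in \<open>H g\<close>.  So \<open>b\<close> is a left unit.\<close>

lemma one_in_part_H: "\<one> \<in> part H"
proof -
  obtain b c where bc: "b \<in> part H" "c \<in> part (carrier G - H)" "\<one> = b \<oplus> c"
    using split_along[OF subset_G(1) one_closed] .
  have bcA: "b \<in> carrier A" "c \<in> carrier A"
    using part_in_carrier[OF subset_G(1) bc(1)] part_in_carrier[OF subset_G(2) bc(2)] by auto
  have hom: "c \<otimes> x = \<zero>" if g: "g \<in> carrier G" and x: "x \<in> \<A> g" for g x
  proof -
    let ?S = "(\<lambda>h. h \<otimes>\<^bsub>G\<^esub> g) ` H"
    have S: "?S \<subseteq> carrier G" using g subset_G by auto
    have xA: "x \<in> carrier A" using grade_facts(1)[OF g] x by blast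
    have xg: "x \<in> part {g}" using g x by (intro part_homogeneous) auto
    have "g = \<one>\<^bsub>G\<^esub> \<otimes>\<^bsub>G\<^esub> g" using g by simp
    then have "g \<in> ?S" using H.one_closed by blast
    then have xS: "x \<in> part ?S" using x S by (intro part_homogeneous)
    have bS: "b \<otimes> x \<in> part ?S"
      by (rule part_mult[OF subset_G(1) _ S _ bc(1) xg]) (use g in auto)
    have cS: "c \<otimes> x \<in> part (carrier G - ?S)"
    proof (rule part_mult[OF subset_G(2) _ _ _ bc(2) xg])
      fix k h assume k: "k \<in> carrier G - H" and "h \<in> {g}"
      then have "k \<otimes>\<^bsub>G\<^esub> g \<noteq> k' \<otimes>\<^bsub>G\<^esub> g" if "k' \<in> H" for k'
        using that g G.r_cancel subset_G by blast
      then show "k \<otimes>\<^bsub>G\<^esub> h \<in> carrier G - ?S" using k g \<open>h \<in> {g}\<close> by auto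
    qed (use g in auto)
    have "x = b \<otimes> x \<oplus> c \<otimes> x" using bcA xA bc(3) l_one[OF xA] by (simp flip: l_distr)
    moreover have "(b \<otimes> x \<oplus> c \<otimes> x) \<oplus> (-1) \<odot> (b \<otimes> x) = c \<otimes> x"
      using bcA xA by (simp add: a_assoc a_lcomm[of "b \<otimes> x" "c \<otimes> x"] r_neg flip: uminus_eq_smult)
    ultimately have "c \<otimes> x = x \<oplus> (-1) \<odot> (b \<otimes> x)" by simp
    then have "c \<otimes> x \<in> part ?S" using part_add[OF S xS part_smult[OF S bS]] by simp
    then show ?thesis using part_disjoint[OF S] cS by blast
  qed
  have "c \<otimes> a = \<zero>" if "a \<in> part (carrier G)" for a
    using order_refl that
  proof (induction rule: part_induct)
    case zero then show ?case using bcA by simp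
  next
    case (add g x b) then show ?case using hom[of g x] bcA by (simp add: r_distr)
  qed
  then have "c = \<zero>" using carrier_eq_part r_one[OF bcA(2)] one_closed by force
  then show ?thesis using bc bcA by simp
qed

lemma p_one: "p \<one> = \<one>"
  by (rule p_part[OF one_in_part_H])

end

section \<open>Linear extension to the free vector space\<close>

definition lsum :: "('k \<Rightarrow>\<^sub>0 complex) \<Rightarrow> ('k \<Rightarrow> complex) \<Rightarrow> complex" where
  "lsum f u = (\<Sum>k\<in>Poly_Mapping.keys f. Poly_Mapping.lookup f k * u k)"

lemma lsum_superset:
  assumes "finite S" "Poly_Mapping.keys f \<subseteq> S"
  shows "lsum f u = (\<Sum>k\<in>S. Poly_Mapping.lookup f k * u k)"
  unfolding lsum_def using assms by (intro sum.mono_neutral_left) (auto simp: in_keys_iff)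

lemma lsum_cong: "(\<And>k. k \<in> Poly_Mapping.keys f \<Longrightarrow> u k = v k) \<Longrightarrow> lsum f u = lsum f v"
  unfolding lsum_def by (rule sum.cong) auto

lemma lsum_add_left: "lsum (f + g) u = lsum f u + lsum g u"
proof -
  let ?S = "Poly_Mapping.keys f \<union> Poly_Mapping.keys g"
  have "Poly_Mapping.keys (f + g) \<subseteq> ?S" by (rule Poly_Mapping.keys_add)
  then show ?thesis
    by (simp add: lsum_superset[of ?S] lookup_add algebra_simps sum.distrib)
qed

lemma lookup_scale: "Poly_Mapping.lookup (Poly_Mapping.map ((*) c) f) k = c * Poly_Mapping.lookup f k"
  for c :: complex
  by (simp add: Poly_Mapping.map.rep_eq when_def)

lemma keys_scale: "Poly_Mapping.keys (Poly_Mapping.map ((*) c) f) \<subseteq> Poly_Mapping.keys f" for c :: complex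
  by (auto simp: in_keys_iff lookup_scale)

lemma lsum_scale_left: "lsum (Poly_Mapping.map ((*) c) f) u = c * lsum f u"
proof -
  have "lsum (Poly_Mapping.map ((*) c) f) u = (\<Sum>k\<in>Poly_Mapping.keys f. c * Poly_Mapping.lookup f k * u k)"
    using keys_scale[of c f] by (subst lsum_superset[of "Poly_Mapping.keys f"]) (simp_all add: lookup_scale)
  then show ?thesis by (simp add: lsum_def sum_distrib_left mult.assoc)
qed

lemma lsum_zero [simp]: "lsum 0 u = 0"
  by (simp add: lsum_def)

lemma lsum_single [simp]: "lsum (Poly_Mapping.single k c) u = c * u k"
  by (subst lsum_superset[of "{k}"]) auto

lemma lsum_diff_left: "lsum (f - g) u = lsum f u - lsum g u"
  using lsum_add_left[of "f - g" g u] by simp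

lemma lsum_sum_left: "lsum (\<Sum>i\<in>F. g i) u = (\<Sum>i\<in>F. lsum (g i) u)"
  by (induction F rule: infinite_finite_induct) (simp_all add: lsum_add_left)

lemma lsum_swap: "lsum f (\<lambda>k. cnj (lsum g (\<lambda>l. w k l))) = cnj (lsum g (\<lambda>l. cnj (lsum f (\<lambda>k. cnj (w k l)))))"
  unfolding lsum_def
  by (simp add: sum_distrib_left sum_distrib_right cnj_sum algebra_simps) (rule sum.swap)

lemma lsum_left_mult:
  "lsum (left_mult A a f) u = lsum f (\<lambda>(b, v). u (a \<otimes>\<^bsub>A\<^esub> b, v))"
  unfolding left_mult_def lsum_sum_left lsum_def[of f] by (rule sum.cong) auto

definition vsum :: "'v inner_space \<Rightarrow> ('k \<Rightarrow>\<^sub>0 complex) \<Rightarrow> ('k \<Rightarrow> 'v) \<Rightarrow> 'v" where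
  "vsum V f u = (\<Oplus>\<^bsub>V\<^esub>k\<in>Poly_Mapping.keys f. Poly_Mapping.lookup f k \<odot>\<^bsub>V\<^esub> u k)"

lemma (in hermitian_space) vsum_in_submodule:
  assumes "submodule S complex_ring V" "\<And>k. k \<in> Poly_Mapping.keys f \<Longrightarrow> u k \<in> S"
  shows "vsum V f u \<in> S"
  unfolding vsum_def using submodule_facts(4)[OF assms(1)] assms
  by (intro submodule_finsum) auto

lemma (in hermitian_space) form_vsum_left:
  assumes "\<And>k. k \<in> Poly_Mapping.keys f \<Longrightarrow> u k \<in> carrier V" "z \<in> carrier V"
  shows "cinner V (vsum V f u) z = lsum f (\<lambda>k. cinner V (u k) z)"
  unfolding vsum_def lsum_def using assms
  by (subst form_finsum_left) (auto simp: form_smult_left intro!: sum.cong)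

section \<open>The form of the induced representation\<close>

sublocale star_rep \<subseteq> space: hilbert "rep_space \<pi>"
  by (rule hilbert_space)

abbreviation (in star_rep) Hs where "Hs \<equiv> rep_space \<pi>"
abbreviation (in star_rep) Dom where "Dom \<equiv> rep_dom \<pi>"

lemma (in star_rep) dom_facts:
  shows "\<phi> \<in> Dom \<Longrightarrow> \<phi> \<in> carrier (Hs)" "\<zero>\<^bsub>Hs\<^esub> \<in> Dom"
    "\<lbrakk>\<phi> \<in> Dom; \<psi> \<in> Dom\<rbrakk> \<Longrightarrow> \<phi> \<oplus>\<^bsub>Hs\<^esub> \<psi> \<in> Dom"
    "\<phi> \<in> Dom \<Longrightarrow> c \<odot>\<^bsub>Hs\<^esub> \<phi> \<in> Dom"
    "\<lbrakk>\<phi> \<in> Dom; \<psi> \<in> Dom\<rbrakk> \<Longrightarrow> \<phi> \<ominus>\<^bsub>Hs\<^esub> \<psi> \<in> Dom"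
  using space.submodule_facts[OF dom_subspace] by auto

lemma (in star_rep) op_linear_simps:
  assumes "a \<in> carrier B"
  shows "\<lbrakk>\<phi> \<in> Dom; \<psi> \<in> Dom\<rbrakk>
      \<Longrightarrow> rep_op \<pi> a (\<phi> \<oplus>\<^bsub>Hs\<^esub> \<psi>) = rep_op \<pi> a \<phi> \<oplus>\<^bsub>Hs\<^esub> rep_op \<pi> a \<psi>"
    "\<phi> \<in> Dom \<Longrightarrow> rep_op \<pi> a (c \<odot>\<^bsub>Hs\<^esub> \<phi>) = c \<odot>\<^bsub>Hs\<^esub> rep_op \<pi> a \<phi>"
    "\<lbrakk>\<phi> \<in> Dom; \<psi> \<in> Dom\<rbrakk>
      \<Longrightarrow> rep_op \<pi> a (\<phi> \<ominus>\<^bsub>Hs\<^esub> \<psi>) = rep_op \<pi> a \<phi> \<ominus>\<^bsub>Hs\<^esub> rep_op \<pi> a \<psi>"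
proof -
  show "rep_op \<pi> a (\<phi> \<ominus>\<^bsub>Hs\<^esub> \<psi>) = rep_op \<pi> a \<phi> \<ominus>\<^bsub>Hs\<^esub> rep_op \<pi> a \<psi>"
    if "\<phi> \<in> Dom" "\<psi> \<in> Dom"
    using op_closed[OF assms] dom_facts(1)
    by (intro linear_on_minus[OF _ _ dom_subspace op_linear[OF assms] _ that]) (unfold_locales, auto)
qed (use op_linear[OF assms] in \<open>auto simp: linear_on_def\<close>)

locale induction_data = graded_algebra_subgroup G A \<A> H + rho: star_rep "graded_subalgebra A \<A> H" \<rho>
  for G :: "('g, 'm) monoid_scheme" and A :: "'a star_alg" (structure)
    and \<A> :: "'g \<Rightarrow> 'a set" and H :: "'g set" and \<rho> :: "('a, 'k) rep"
begin

abbreviation K where "K \<equiv> rep_space \<rho>"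
abbreviation D where "D \<equiv> rep_dom \<rho>"
abbreviation FT where "FT \<equiv> free_tensor G H A \<A> \<rho>"
abbreviation T where "T \<equiv> tensor_space G H A \<A> \<rho>"
abbreviation ker where "ker \<equiv> tensor_kernel G H A \<A> \<rho>"
abbreviation \<iota> where "\<iota> \<equiv> ind_vector G H A \<A> \<rho>"
abbreviation C where "C \<equiv> completion (separated T)"

text \<open>The form on elementary tensors.\<close>

definition tform :: "'a \<times> 'k \<Rightarrow> 'a \<times> 'k \<Rightarrow> complex" where
  "tform k l = cinner K (rep_op \<rho> (p (star A (fst l) \<otimes> fst k)) (snd k)) (snd l)"

lemma star_mult_part: "\<lbrakk>a \<in> carrier A; b \<in> carrier A\<rbrakk> \<Longrightarrow> p (star A b \<otimes> a) \<in> part H"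
  by (simp add: p_closed star_closed)

lemma rho_closed: "\<lbrakk>a \<in> part H; v \<in> D\<rbrakk> \<Longrightarrow> rep_op \<rho> a v \<in> D"
  "\<lbrakk>a \<in> part H; v \<in> D\<rbrakk> \<Longrightarrow> rep_op \<rho> a v \<in> carrier K"
  using rho.op_closed rho.dom_facts(1) by auto

text \<open>As a function of its first argument the form respects each of the relations that
  define the tensor product over the subalgebra.  For the balanced relation this is the
  right-linearity of \<open>p\<close>; the symmetry is the compatibility of \<open>p\<close> with the involution.\<close>

lemma tform_simps:
  assumes l: "l \<in> carrier A \<times> D" and a: "a \<in> carrier A" and v: "v \<in> D"
  shows "b \<in> carrier A \<Longrightarrow> tform (a \<oplus> b, v) l = tform (a, v) l + tform (b, v) l"
    "w \<in> D \<Longrightarrow> tform (a, v \<oplus>\<^bsub>K\<^esub> w) l = tform (a, v) l + tform (a, w) l"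
    "tform (c \<odot> a, v) l = c * tform (a, v) l"
    "tform (a, c \<odot>\<^bsub>K\<^esub> v) l = c * tform (a, v) l"
    "b \<in> part H \<Longrightarrow> tform (a \<otimes> b, v) l = tform (a, rep_op \<rho> b v) l"
    "tform l (a, v) = cnj (tform (a, v) l)"
proof -
  obtain x y where xy: "l = (x, y)" "x \<in> carrier A" "y \<in> D" using l by auto
  note vK = rho.dom_facts(1)
  note yK = vK[OF xy(3)] and sx = star_closed[OF xy(2)]
  have P: "p (star A x \<otimes> a) \<in> part H" using star_mult_part a xy(2) .
  show "tform (a \<oplus> b, v) l = tform (a, v) l + tform (b, v) l" if b: "b \<in> carrier A"
    using P star_mult_part[OF b xy(2)] a b v sx yK rho.op_add[of "p (star A x \<otimes> a)" "p (star A x \<otimes> b)" v]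
    by (simp add: tform_def xy(1) r_distr p_add rho.space.form_add_left rho_closed)
  show "tform (a, v \<oplus>\<^bsub>K\<^esub> w) l = tform (a, v) l + tform (a, w) l" if w: "w \<in> D"
    using P v w yK by (simp add: tform_def xy(1) rho.op_linear_simps rho.space.form_add_left rho_closed)
  show "tform (c \<odot> a, v) l = c * tform (a, v) l"
    using P a v sx yK rho.op_smult[of "p (star A x \<otimes> a)" v c]
    by (simp add: tform_def xy(1) smult_mult_right p_smult rho.space.form_smult_left rho_closed)
  show "tform (a, c \<odot>\<^bsub>K\<^esub> v) l = c * tform (a, v) l"
    using P v yK by (simp add: tform_def xy(1) rho.op_linear_simps rho.space.form_smult_left rho_closed)
  show "tform (a \<otimes> b, v) l = tform (a, rep_op \<rho> b v) l" if b: "b \<in> part H"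
    using P b a v sx part_H_carrier[OF b] rho.op_mult[of "p (star A x \<otimes> a)" b v]
    by (simp add: tform_def xy(1) p_mult_right flip: m_assoc)
  have "p (star A a \<otimes> x) = star A (p (star A x \<otimes> a))"
    using p_star[of "star A x \<otimes> a"] a xy(2) sx star_closed[OF a] by (simp add: star_mult star_star)
  then have "cinner K (rep_op \<rho> (p (star A x \<otimes> a)) v) y = cinner K v (rep_op \<rho> (p (star A a \<otimes> x)) y)"
    using rho.op_adjoint[of "p (star A x \<otimes> a)" v y] P v xy(3) by simp
  then show "tform l (a, v) = cnj (tform (a, v) l)"
    using rho.space.form_commute[of v "rep_op \<rho> (p (star A a \<otimes> x)) y"] vK[OF v]
      rho_closed(2)[OF star_mult_part[OF xy(2) a] xy(3)]
    by (simp add: tform_def xy(1))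
qed

lemma FT_simps:
  "f \<in> carrier FT \<longleftrightarrow> Poly_Mapping.keys f \<subseteq> carrier A \<times> D"
  "\<zero>\<^bsub>FT\<^esub> = 0" "f \<oplus>\<^bsub>FT\<^esub> g = f + g" "c \<odot>\<^bsub>FT\<^esub> f = Poly_Mapping.map ((*) c) f"
  by (simp_all add: free_tensor_def)

lemma FT_form: "cinner FT f g = lsum f (\<lambda>k. cnj (lsum g (\<lambda>l. cnj (tform k l))))"
  by (simp add: free_tensor_def lsum_def tform_def case_prod_unfold sum_distrib_left mult.assoc)

lemma keysD: "\<lbrakk>f \<in> carrier FT; k \<in> Poly_Mapping.keys f\<rbrakk> \<Longrightarrow> k \<in> carrier A \<times> D"
  by (auto simp: FT_simps)

lemma hermitian_FT: "hermitian_space FT"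
proof -
  have ag: "abelian_group FT"
  proof (rule abelian_groupI)
    fix f g assume "f \<in> carrier FT" "g \<in> carrier FT"
    then show "f \<oplus>\<^bsub>FT\<^esub> g \<in> carrier FT"
      using Poly_Mapping.keys_add[of f g] by (auto simp: FT_simps)
  next
    fix f assume "f \<in> carrier FT"
    then show "\<exists>g\<in>carrier FT. g \<oplus>\<^bsub>FT\<^esub> f = \<zero>\<^bsub>FT\<^esub>"
      by (intro bexI[of _ "- f"]) (auto simp: FT_simps)
  qed (auto simp: FT_simps)
  have "module complex_ring FT"
  proof (rule moduleI[OF complex_cring.is_cring ag])
    fix c d f g assume "f \<in> carrier FT" "g \<in> carrier FT"
    then show "c \<odot>\<^bsub>FT\<^esub> f \<in> carrier FT" using keys_scale[of c f] by (auto simp: FT_simps)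
  qed (auto simp: FT_simps lookup_scale lookup_add algebra_simps intro!: poly_mapping_eqI)
  then interpret FT: complex_module FT by (simp add: complex_module_def)
  show ?thesis
  proof unfold_locales
    fix f g assume fg: "f \<in> carrier FT" "g \<in> carrier FT"
    have "cnj (tform k l) = tform l k" if "k \<in> Poly_Mapping.keys f" "l \<in> Poly_Mapping.keys g" for k l
      using tform_simps(6)[of l "fst k" "snd k"] keysD[OF fg(1) that(1)] keysD[OF fg(2) that(2)] by auto
    then have "cinner FT f g = lsum f (\<lambda>k. cnj (lsum g (\<lambda>l. tform l k)))"
      unfolding FT_form by (intro lsum_cong arg_cong[of _ _ cnj])
    also have "\<dots> = cnj (cinner FT g f)" unfolding FT_form by (rule lsum_swap)
    finally show "cinner FT g f = cnj (cinner FT f g)" by simp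
  qed (auto simp: FT_simps(3,4) FT_form lsum_add_left lsum_scale_left)
qed

sublocale FT: hermitian_space FT by (rule hermitian_FT)

lemma single_in_FT: "\<lbrakk>a \<in> carrier A; v \<in> D\<rbrakk> \<Longrightarrow> Poly_Mapping.single (a, v) c \<in> carrier FT"
  by (auto simp: FT_simps)

lemma diff_in_FT: "\<lbrakk>f \<in> carrier FT; g \<in> carrier FT\<rbrakk> \<Longrightarrow> f - g \<in> carrier FT"
  using Poly_Mapping.keys_diff[of f g] by (auto simp: FT_simps)

text \<open>Each generator of the kernel is a combination of elementary tensors on which
  \<open>tform\<close>, as a function of its first argument, cancels.\<close>

lemma relations_in_radical: "bilinear_relations A \<rho> \<union> balanced_relations H A \<A> \<rho> \<subseteq> FT.radical"
proof -
  have rad: "r \<in> FT.radical"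
    if r: "r \<in> carrier FT" and 0: "\<And>l. l \<in> carrier A \<times> D \<Longrightarrow> lsum r (\<lambda>k. tform k l) = 0" for r
  proof -
    have "cinner FT r g = 0" if g: "g \<in> carrier FT" for g
    proof -
      have "cinner FT r g = cnj (lsum g (\<lambda>l. cnj (lsum r (\<lambda>k. tform k l))))"
        unfolding FT_form by (subst lsum_swap) simp
      also have "lsum g (\<lambda>l. cnj (lsum r (\<lambda>k. tform k l))) = lsum g (\<lambda>l. 0)"
        using 0 keysD[OF g] by (intro lsum_cong) simp
      finally show ?thesis by (simp add: lsum_def)
    qed
    then show ?thesis using r by (simp add: FT.radical_def)
  qed
  show ?thesis
    unfolding bilinear_relations_def balanced_relations_def
    by (intro Un_least subsetI; clarify; rule rad)
       (auto intro!: single_in_FT diff_in_FT simp: lsum_diff_left tform_simps rho.dom_facts part_H_carrier rho_closed)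
qed

lemma kernel_submodule: "submodule ker complex_ring FT"
  and kernel_in_radical: "ker \<subseteq> FT.radical"
proof -
  show "ker \<subseteq> FT.radical"
    unfolding tensor_kernel_def using relations_in_radical FT.radical_submodule by (rule FT.lspan_minimal)
  have "FT.radical \<subseteq> carrier FT" by (auto simp: FT.radical_def)
  then show "submodule ker complex_ring FT"
    unfolding tensor_kernel_def using relations_in_radical by (intro FT.lspan_submodule) blast
qed

lemmas tensor_map = FT.quotient_coset_map[OF kernel_submodule kernel_in_radical, folded tensor_space_def]

sublocale T: hermitian_space T
  unfolding tensor_space_def by (rule FT.hermitian_quotient[OF kernel_submodule kernel_in_radical])

lemma left_mult_in_FT: "\<lbrakk>a \<in> carrier A; f \<in> carrier FT\<rbrakk> \<Longrightarrow> left_mult A a f \<in> carrier FT"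
proof -
  assume a: "a \<in> carrier A" and f: "f \<in> carrier FT"
  have "Poly_Mapping.keys (left_mult A a f)
      \<subseteq> (\<Union>k\<in>Poly_Mapping.keys f. Poly_Mapping.keys (case k of (b, v) \<Rightarrow> Poly_Mapping.single (a \<otimes> b, v) (Poly_Mapping.lookup f (b, v))))"
    unfolding left_mult_def by (rule Poly_Mapping.keys_sum)
  also have "\<dots> \<subseteq> carrier A \<times> D"
    using a keysD[OF f] by (fastforce split: if_splits)
  finally show ?thesis by (simp add: FT_simps)
qed

lemma left_mult_adjoint:
  assumes a: "a \<in> carrier A" and f: "f \<in> carrier FT" and g: "g \<in> carrier FT"
  shows "cinner FT (left_mult A a f) g = cinner FT f (left_mult A (star A a) g)"
proof -
  have "tform (a \<otimes> b, v) (c, w) = tform (b, v) (star A a \<otimes> c, w)"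
    if "b \<in> carrier A" "c \<in> carrier A" for b c v w
    using that a by (simp add: tform_def star_mult star_star star_closed m_assoc)
  then have "lsum f (\<lambda>k. cnj (lsum g (\<lambda>l. cnj (tform (a \<otimes> fst k, snd k) l))))
      = lsum f (\<lambda>k. cnj (lsum g (\<lambda>l. cnj (tform k (star A a \<otimes> fst l, snd l)))))"
    using keysD[OF f] keysD[OF g] by (intro lsum_cong arg_cong[of _ _ cnj]) auto
  then show ?thesis unfolding FT_form lsum_left_mult by (simp add: case_prod_unfold)
qed

lemma left_mult_single [simp]: "left_mult A a (Poly_Mapping.single (b, v) 1) = Poly_Mapping.single (a \<otimes> b, v) 1"
  by (simp add: left_mult_def)

end

locale inducible_data = induction_data G A \<A> H \<rho>
  for G :: "('g, 'm) monoid_scheme" and A :: "'a star_alg" (structure)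
    and \<A> :: "'g \<Rightarrow> 'a set" and H :: "'g set" and \<rho> :: "('a, 'k) rep" +
  assumes ind: "inducible G H A \<A> \<rho>"
begin

sublocale T: semi_inner_space T
  by unfold_locales (use ind in \<open>auto simp: inducible_def complex_nonneg_Reals_iff\<close>)

sublocale S: pre_hilbert "separated T"
  by (rule T.sep_class_map(3))

sublocale C: pre_hilbert C
  by (rule S.pre_hilbert_completion)

lemma \<iota>_form_hom: "form_hom FT C \<iota>"
  unfolding ind_vector_def
  by (rule form_hom_comp[OF form_hom_comp[OF tensor_map(1) T.sep_class_map(1)] S.completion_embed_form_hom])

lemmas \<iota>_simps = form_homD[OF \<iota>_form_hom]

text \<open>The completed space is characterized by the form: any Hilbert space carrying a dense
  image of the free vector space with the same Gram matrix is isometric to it.\<close>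

lemma induced_space_universal:
  assumes Y: "hilbert Y" and \<Phi>: "form_hom FT Y \<Phi>"
    and dense: "htopology Y closure_of (\<Phi> ` carrier FT) = carrier Y"
  shows "\<exists>W. form_hom C Y W \<and> W ` carrier C = carrier Y \<and> (\<forall>f\<in>carrier FT. W (\<iota> f) = \<Phi> f)"
proof -
  interpret Y: hilbert Y by fact
  obtain \<Phi>1 where 1: "form_hom T Y \<Phi>1" "\<And>f. f \<in> carrier FT \<Longrightarrow> \<Phi>1 (ker +>\<^bsub>FT\<^esub> f) = \<Phi> f"
    using form_hom_factor[OF hermitian_FT Y.pre_hilbert_axioms tensor_map(1,2) T.hermitian_space_axioms \<Phi>] by blast
  obtain \<Phi>2 where 2: "form_hom (separated T) Y \<Phi>2" "\<And>x. x \<in> carrier T \<Longrightarrow> \<Phi>2 (sep_class T x) = \<Phi>1 x"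
    using form_hom_factor[OF T.hermitian_space_axioms Y.pre_hilbert_axioms T.sep_class_map(1,2)
      S.hermitian_space_axioms 1(1)] by blast
  have inT: "ker +>\<^bsub>FT\<^esub> f \<in> carrier T" if "f \<in> carrier FT" for f
    using form_homD(1)[OF tensor_map(1)] that .
  have inS: "sep_class T x \<in> carrier (separated T)" if "x \<in> carrier T" for x
    using form_homD(1)[OF T.sep_class_map(1)] that .
  have "\<Phi>2 ` carrier (separated T) = \<Phi>1 ` carrier T"
    unfolding T.sep_class_map(2)[symmetric] image_image using 2(2) by (rule image_cong[OF refl])
  also have "\<dots> = \<Phi> ` carrier FT"
    unfolding tensor_map(2)[symmetric] image_image using 1(2) by (rule image_cong[OF refl])
  finally have "htopology Y closure_of (\<Phi>2 ` carrier (separated T)) = carrier Y" using dense by simp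
  then obtain W where W: "form_hom C Y W" "W ` carrier C = carrier Y"
    "\<And>x. x \<in> carrier (separated T) \<Longrightarrow> W (completion_embed (separated T) x) = \<Phi>2 x"
    using S.completion_isometry[OF Y 2(1)] by blast
  have "W (\<iota> f) = \<Phi> f" if "f \<in> carrier FT" for f
    unfolding ind_vector_def using that by (simp add: W(3) 2(2) 1(2) inT inS)
  then show ?thesis using W(1,2) by blast
qed

text \<open>Left multiplication has an adjoint for the form, hence preserves equality of the
  vectors represented.\<close>

lemma \<iota>_left_mult_cong:
  assumes a: "a \<in> carrier A" and f: "f \<in> carrier FT" and g: "g \<in> carrier FT" and eq: "\<iota> f = \<iota> g"
  shows "\<iota> (left_mult A a f) = \<iota> (left_mult A a g)"
proof -
  let ?d = "\<iota> (left_mult A a f) \<ominus>\<^bsub>C\<^esub> \<iota> (left_mult A a g)"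
  note af = left_mult_in_FT[OF a f] and ag = left_mult_in_FT[OF a g]
  have e: "cinner C (\<iota> (left_mult A a f)) (\<iota> h) = cinner C (\<iota> (left_mult A a g)) (\<iota> h)"
    if h: "h \<in> carrier FT" for h
  proof -
    have h': "left_mult A (star A a) h \<in> carrier FT" by (rule left_mult_in_FT[OF star_closed[OF a] h])
    have "cinner C (\<iota> (left_mult A a f)) (\<iota> h) = cinner C (\<iota> f) (\<iota> (left_mult A (star A a) h))"
      using af f h h' by (simp add: \<iota>_simps left_mult_adjoint[OF a f h])
    also have "\<dots> = cinner C (\<iota> (left_mult A a g)) (\<iota> h)"
      unfolding eq using ag g h h' by (simp add: \<iota>_simps left_mult_adjoint[OF a g h])
    finally show ?thesis .
  qed
  have "cinner C ?d ?d = 0"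
    using \<iota>_simps(1)[OF af] \<iota>_simps(1)[OF ag] e[OF af] e[OF ag] by (simp add: C.form_simps)
  then have "?d = \<zero>\<^bsub>C\<^esub>" using \<iota>_simps(1)[OF af] \<iota>_simps(1)[OF ag] by (intro C.cinner_definite) auto
  then show ?thesis using \<iota>_simps(1)[OF af] \<iota>_simps(1)[OF ag] by (simp add: C.minus_eq_zero_iff)
qed

abbreviation pre where "pre \<equiv> pre_induced_rep G H A \<A> \<rho>"
abbreviation pdom where "pdom \<equiv> \<iota> ` carrier FT"

lemma pre_simps:
  "rep_space pre = C" "rep_dom pre = pdom"
  by (simp_all add: pre_induced_rep_def)

lemma pre_op:
  assumes "a \<in> carrier A" "f \<in> carrier FT"
  shows "rep_op pre a (\<iota> f) = \<iota> (left_mult A a f)"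
proof -
  have "{\<iota> (left_mult A a g) |g. g \<in> carrier FT \<and> \<iota> g = \<iota> f} = {\<iota> (left_mult A a f)}"
    using \<iota>_left_mult_cong[OF assms(1) _ assms(2)] assms by blast
  then show ?thesis by (simp add: pre_induced_rep_def)
qed

end

section \<open>Graph topology and closure\<close>

lemma graph_cauchy_iff:
  "graph_cauchy B \<pi> F \<longleftrightarrow> F \<noteq> bot \<and> (\<forall>\<^sub>F \<phi> in F. \<phi> \<in> rep_dom \<pi>) \<and>
     (\<forall>a\<in>carrier B. \<forall>\<epsilon>>0. \<exists>Q. eventually Q F \<and>
        (\<forall>x y. Q x \<longrightarrow> Q y \<longrightarrow> graph_norm \<pi> a (x \<ominus>\<^bsub>rep_space \<pi>\<^esub> y) < \<epsilon>))"
  by (simp add: graph_cauchy_def eventually_prod_same)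

text \<open>Maps that do not increase graph norms preserve Cauchy filters.  This is used for a
  unitary, for its inverse, and for the projection of an induced representation onto the inducing one.\<close>

lemma graph_cauchy_image:
  assumes F: "graph_cauchy B \<sigma> F" and S: "\<forall>\<^sub>F x in F. x \<in> S"
    and sub: "carrier B' \<subseteq> carrier B" and dom: "\<And>x. x \<in> S \<Longrightarrow> g x \<in> rep_dom \<rho>"
    and le: "\<And>a x y. \<lbrakk>a \<in> carrier B'; x \<in> S; y \<in> S\<rbrakk> \<Longrightarrow>
      graph_norm \<rho> a (g x \<ominus>\<^bsub>rep_space \<rho>\<^esub> g y) \<le> graph_norm \<sigma> a (x \<ominus>\<^bsub>rep_space \<sigma>\<^esub> y)"
  shows "graph_cauchy B' \<rho> (filtermap g F)"
  unfolding graph_cauchy_iff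
proof (intro conjI ballI allI impI)
  show "filtermap g F \<noteq> bot" using F by (simp add: graph_cauchy_iff filtermap_bot_iff)
  show "\<forall>\<^sub>F v in filtermap g F. v \<in> rep_dom \<rho>"
    unfolding eventually_filtermap using S by eventually_elim (rule dom)
  fix a and \<epsilon> :: real assume a: "a \<in> carrier B'" and \<epsilon>: "0 < \<epsilon>"
  obtain Q where Q: "eventually Q F" "\<And>x y. \<lbrakk>Q x; Q y\<rbrakk> \<Longrightarrow> graph_norm \<sigma> a (x \<ominus>\<^bsub>rep_space \<sigma>\<^esub> y) < \<epsilon>"
    using F a sub \<epsilon> unfolding graph_cauchy_iff by (meson subsetD)
  let ?Q = "\<lambda>v. \<exists>x. x \<in> S \<and> Q x \<and> v = g x"
  have "eventually ?Q (filtermap g F)"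
    unfolding eventually_filtermap using S Q(1) by eventually_elim blast
  moreover have "graph_norm \<rho> a (v \<ominus>\<^bsub>rep_space \<rho>\<^esub> w) < \<epsilon>" if v: "?Q v" and w: "?Q w" for v w
  proof -
    obtain x where x: "x \<in> S" "Q x" "v = g x" using v by blast
    obtain y where y: "y \<in> S" "Q y" "w = g y" using w by blast
    show ?thesis using le[OF a x(1) y(1)] Q(2)[OF x(2) y(2)] x(3) y(3) by simp
  qed
  ultimately show "\<exists>Q. eventually Q (filtermap g F) \<and>
      (\<forall>v w. Q v \<longrightarrow> Q w \<longrightarrow> graph_norm \<rho> a (v \<ominus>\<^bsub>rep_space \<rho>\<^esub> w) < \<epsilon>)" by (intro exI[of _ ?Q]) simp
qed

text \<open>Adherence in the graph topology, which has a subbasis of balls of single graph norms.\<close>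

definition graph_approximable :: "'a star_alg \<Rightarrow> ('a, 'h) rep \<Rightarrow> 'h set \<Rightarrow> 'h \<Rightarrow> bool" where
  "graph_approximable B \<pi> S x \<longleftrightarrow>
     (\<forall>Q. finite Q \<and> Q \<subseteq> carrier B \<times> {0<..} \<longrightarrow>
        (\<exists>y\<in>S. \<forall>(a, \<epsilon>)\<in>Q. graph_norm \<pi> a (y \<ominus>\<^bsub>rep_space \<pi>\<^esub> x) < \<epsilon>))"

context star_rep begin

lemma op_in_carrier: "\<lbrakk>a \<in> carrier B; \<phi> \<in> Dom\<rbrakk> \<Longrightarrow> rep_op \<pi> a \<phi> \<in> carrier (Hs)"
  using op_closed dom_facts(1) by blast

lemma graph_norm_minus:
  "\<lbrakk>a \<in> carrier B; x \<in> Dom; y \<in> Dom\<rbrakk> \<Longrightarrow> graph_norm \<pi> a (x \<ominus>\<^bsub>Hs\<^esub> y)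
    = hnorm (Hs) (x \<ominus>\<^bsub>Hs\<^esub> y)
      + hnorm (Hs) (rep_op \<pi> a x \<ominus>\<^bsub>Hs\<^esub> rep_op \<pi> a y)"
  by (simp add: graph_norm_def op_linear_simps)

lemma graph_norm_triangle:
  assumes "a \<in> carrier B" "x \<in> Dom" "y \<in> Dom" "z \<in> Dom"
  shows "graph_norm \<pi> a (x \<ominus>\<^bsub>Hs\<^esub> z)
    \<le> graph_norm \<pi> a (x \<ominus>\<^bsub>Hs\<^esub> y) + graph_norm \<pi> a (y \<ominus>\<^bsub>Hs\<^esub> z)"
  using assms dom_facts(1) op_in_carrier
    space.hnorm_minus_triangle[of x y z] space.hnorm_minus_triangle[of "rep_op \<pi> a x" "rep_op \<pi> a y" "rep_op \<pi> a z"]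
  by (simp add: graph_norm_minus)

lemma graph_norm_commute:
  assumes "a \<in> carrier B" "x \<in> Dom" "y \<in> Dom"
  shows "graph_norm \<pi> a (x \<ominus>\<^bsub>Hs\<^esub> y) = graph_norm \<pi> a (y \<ominus>\<^bsub>Hs\<^esub> x)"
  using assms dom_facts(1) op_in_carrier by (simp add: graph_norm_minus space.hnorm_minus_commute)

lemma graph_norm_self:
  assumes "a \<in> carrier B" "x \<in> Dom"
  shows "graph_norm \<pi> a (x \<ominus>\<^bsub>Hs\<^esub> x) = 0"
  using graph_norm_minus[OF assms assms(2)] space.minus_eq_zero_iff[of x x]
    space.minus_eq_zero_iff[of "rep_op \<pi> a x" "rep_op \<pi> a x"] assms dom_facts(1) op_in_carrier
  by simp

lemma openin_graph_ball:
  "\<lbrakk>a \<in> carrier B; \<phi> \<in> Dom; 0 < \<epsilon>\<rbrakk>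
    \<Longrightarrow> openin (graph_topology B \<pi>) {\<psi> \<in> Dom. graph_norm \<pi> a (\<psi> \<ominus>\<^bsub>Hs\<^esub> \<phi>) < \<epsilon>}"
  unfolding graph_topology_def by (rule topology_generated_by_Basis) blast

lemma topspace_graph: "topspace (graph_topology B \<pi>) \<subseteq> Dom"
  unfolding graph_topology_def topology_generated_by_topspace by blast

text \<open>The subbasic sets are balls around arbitrary centres.  By the triangle inequality
  each of them contains a ball of the same norm around any of its points.\<close>

lemma limitin_graph_iff:
  assumes "carrier B \<noteq> {}"
  shows "limitin (graph_topology B \<pi>) (\<lambda>x. x) \<phi> F \<longleftrightarrow> \<phi> \<in> Dom \<and>
    (\<forall>a\<in>carrier B. \<forall>\<epsilon>>0. \<forall>\<^sub>F \<psi> in F. \<psi> \<in> Dom \<and> graph_norm \<pi> a (\<psi> \<ominus>\<^bsub>Hs\<^esub> \<phi>) < \<epsilon>)"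
    (is "?L \<longleftrightarrow> ?R")
proof
  assume L: ?L
  have \<phi>: "\<phi> \<in> Dom" using subsetD[OF topspace_graph limitin_topspace[OF L]] .
  have nhd: "\<forall>\<^sub>F x in F. x \<in> U" if "openin (graph_topology B \<pi>) U" "\<phi> \<in> U" for U
    using L that unfolding limitin_def by blast
  have "\<forall>\<^sub>F \<psi> in F. \<psi> \<in> {\<psi> \<in> Dom. graph_norm \<pi> a (\<psi> \<ominus>\<^bsub>Hs\<^esub> \<phi>) < \<epsilon>}"
    if "a \<in> carrier B" "0 < \<epsilon>" for a \<epsilon>
  proof -
    have "\<phi> \<in> {\<psi> \<in> Dom. graph_norm \<pi> a (\<psi> \<ominus>\<^bsub>Hs\<^esub> \<phi>) < \<epsilon>}"
      using \<phi> graph_norm_self[OF that(1) \<phi>] that(2) by simp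
    with openin_graph_ball[OF that(1) \<phi> that(2)] show ?thesis by (rule nhd)
  qed
  then show ?R using \<phi> by simp
next
  assume R: ?R
  then have \<phi>: "\<phi> \<in> Dom" by blast
  obtain b where b: "b \<in> carrier B" using assms by blast
  have "\<phi> \<in> topspace (graph_topology B \<pi>)"
    using openin_subset[OF openin_graph_ball[OF b \<phi>, of 1]] graph_norm_self[OF b \<phi>] \<phi> by auto
  moreover have "\<forall>\<^sub>F x in F. x \<in> U" if "openin (graph_topology B \<pi>) U" "\<phi> \<in> U" for U
    using that unfolding graph_topology_def openin_topology_generated_by_iff
  proof (induction rule: generate_topology_on.induct)
    case (UN K)
    then obtain k where "k \<in> K" "\<phi> \<in> k" by blast
    then have "\<forall>\<^sub>F x in F. x \<in> k" using UN by blast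
    then show ?case by eventually_elim (use \<open>k \<in> K\<close> in blast)
  next
    case (Basis s)
    then obtain a \<phi>0 \<epsilon> where s: "s = {\<psi> \<in> Dom. graph_norm \<pi> a (\<psi> \<ominus>\<^bsub>Hs\<^esub> \<phi>0) < \<epsilon>}"
      and a: "a \<in> carrier B" "\<phi>0 \<in> Dom" "0 < \<epsilon>" by blast
    let ?\<delta> = "\<epsilon> - graph_norm \<pi> a (\<phi> \<ominus>\<^bsub>Hs\<^esub> \<phi>0)"
    have "0 < ?\<delta>" using Basis(2) s by simp
    then have "\<forall>\<^sub>F \<psi> in F. \<psi> \<in> Dom \<and> graph_norm \<pi> a (\<psi> \<ominus>\<^bsub>Hs\<^esub> \<phi>) < ?\<delta>"
      using R a(1) by blast
    then show ?case
    proof eventually_elim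
      case (elim \<psi>)
      then show ?case using graph_norm_triangle[OF a(1), of \<psi> \<phi> \<phi>0] \<phi> a(2) s by auto
    qed
  qed (auto intro: eventually_conj)
  ultimately show ?L unfolding limitin_def by blast
qed

text \<open>Finitely many subbasic balls around \<open>x\<close> intersect in an open set.\<close>

lemma graph_closure_approximable:
  assumes x: "x \<in> graph_topology B \<pi> closure_of S"
  shows "graph_approximable B \<pi> S x" "x \<in> Dom"
proof -
  have top: "x \<in> topspace (graph_topology B \<pi>)" using x by (simp add: in_closure_of)
  then show xd: "x \<in> Dom" using topspace_graph by blast
  show "graph_approximable B \<pi> S x"
    unfolding graph_approximable_def
  proof (intro allI impI)
    fix Q :: "('a \<times> real) set" assume "finite Q \<and> Q \<subseteq> carrier B \<times> {0<..}"
    then have Q: "finite Q" "Q \<subseteq> carrier B \<times> {0<..}" by auto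
    from Q have "\<exists>U. openin (graph_topology B \<pi>) U \<and> x \<in> U \<and>
      (\<forall>y\<in>U. \<forall>(a, \<epsilon>)\<in>Q. graph_norm \<pi> a (y \<ominus>\<^bsub>Hs\<^esub> x) < \<epsilon>)"
    proof (induction Q)
      case empty then show ?case using top by (intro exI[of _ "topspace (graph_topology B \<pi>)"]) auto
    next
      case (insert q Q)
      then obtain U where U: "openin (graph_topology B \<pi>) U" "x \<in> U"
        "\<forall>y\<in>U. \<forall>(a, \<epsilon>)\<in>Q. graph_norm \<pi> a (y \<ominus>\<^bsub>Hs\<^esub> x) < \<epsilon>" by auto
      obtain a \<epsilon> where q: "q = (a, \<epsilon>)" "a \<in> carrier B" "0 < \<epsilon>" using insert.prems by auto
      let ?W = "{\<psi> \<in> Dom. graph_norm \<pi> a (\<psi> \<ominus>\<^bsub>Hs\<^esub> x) < \<epsilon>}"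
      have "openin (graph_topology B \<pi>) (U \<inter> ?W)"
        using U(1) openin_graph_ball[OF q(2) xd q(3)] by (rule openin_Int)
      moreover have "x \<in> U \<inter> ?W" using U(2) xd graph_norm_self[OF q(2) xd] q(3) by simp
      moreover have "\<forall>y\<in>U \<inter> ?W. \<forall>(a, \<epsilon>)\<in>insert q Q. graph_norm \<pi> a (y \<ominus>\<^bsub>Hs\<^esub> x) < \<epsilon>"
        using U(3) q by auto
      ultimately show ?case by blast
    qed
    then obtain U where "openin (graph_topology B \<pi>) U" "x \<in> U"
      "\<forall>y\<in>U. \<forall>(a, \<epsilon>)\<in>Q. graph_norm \<pi> a (y \<ominus>\<^bsub>Hs\<^esub> x) < \<epsilon>" by blast
    moreover from this obtain y where "y \<in> S" "y \<in> U" using x unfolding in_closure_of by blast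
    ultimately show "\<exists>y\<in>S. \<forall>(a, \<epsilon>)\<in>Q. graph_norm \<pi> a (y \<ominus>\<^bsub>Hs\<^esub> x) < \<epsilon>" by blast
  qed
qed

text \<open>The graph topology need not be first countable, so the approximating net is indexed by the
  finite sets of requirements \<open>(a, \<epsilon>)\<close>.\<close>

lemma graph_approximable_filter:
  assumes "graph_approximable B \<pi> S x"
  obtains F where "F \<noteq> bot" "\<forall>\<^sub>F y in F. y \<in> S"
    "\<And>a \<epsilon>. \<lbrakk>a \<in> carrier B; 0 < \<epsilon>\<rbrakk> \<Longrightarrow> \<forall>\<^sub>F y in F. graph_norm \<pi> a (y \<ominus>\<^bsub>Hs\<^esub> x) < \<epsilon>"
proof -
  define \<Q> where "\<Q> = finite_subsets_at_top (carrier B \<times> {0<..} :: ('a \<times> real) set)"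
  have "\<forall>Q. \<exists>y. finite Q \<and> Q \<subseteq> carrier B \<times> {0<..} \<longrightarrow>
      y \<in> S \<and> (\<forall>(a, \<epsilon>)\<in>Q. graph_norm \<pi> a (y \<ominus>\<^bsub>Hs\<^esub> x) < \<epsilon>)"
    using assms unfolding graph_approximable_def by metis
  then obtain y where y: "\<And>Q. \<lbrakk>finite Q; Q \<subseteq> carrier B \<times> {0<..}\<rbrakk> \<Longrightarrow>
      y Q \<in> S \<and> (\<forall>(a, \<epsilon>)\<in>Q. graph_norm \<pi> a (y Q \<ominus>\<^bsub>Hs\<^esub> x) < \<epsilon>)"
    by metis
  show ?thesis
  proof (rule that[of "filtermap y \<Q>"])
    show "filtermap y \<Q> \<noteq> bot" by (simp add: \<Q>_def filtermap_bot_iff)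
    show "\<forall>\<^sub>F z in filtermap y \<Q>. z \<in> S"
      unfolding eventually_filtermap \<Q>_def eventually_finite_subsets_at_top
      by (intro exI[of _ "{}"]) (use y in auto)
    fix a and \<epsilon> :: real assume a: "a \<in> carrier B" "0 < \<epsilon>"
    show "\<forall>\<^sub>F z in filtermap y \<Q>. graph_norm \<pi> a (z \<ominus>\<^bsub>Hs\<^esub> x) < \<epsilon>"
      unfolding eventually_filtermap \<Q>_def eventually_finite_subsets_at_top
    proof (intro exI[of _ "{(a, \<epsilon>)}"] conjI allI impI)
      fix Q assume "finite Q \<and> {(a, \<epsilon>)} \<subseteq> Q \<and> Q \<subseteq> carrier B \<times> {0<..}"
      then show "graph_norm \<pi> a (y Q \<ominus>\<^bsub>Hs\<^esub> x) < \<epsilon>" using y[of Q] by auto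
    qed (use a in auto)
  qed
qed

lemma graph_convergent_imp_cauchy:
  assumes "F \<noteq> bot" "\<forall>\<^sub>F y in F. y \<in> Dom" and x: "x \<in> Dom"
    and lim: "\<And>a \<epsilon>. \<lbrakk>a \<in> carrier B; 0 < \<epsilon>\<rbrakk> \<Longrightarrow> \<forall>\<^sub>F y in F. graph_norm \<pi> a (y \<ominus>\<^bsub>Hs\<^esub> x) < \<epsilon>"
  shows "graph_cauchy B \<pi> F"
  unfolding graph_cauchy_iff
proof (intro conjI ballI allI impI assms(1,2))
  fix a and \<epsilon> :: real assume a: "a \<in> carrier B" and "0 < \<epsilon>"
  let ?Q = "\<lambda>y. y \<in> Dom \<and> graph_norm \<pi> a (y \<ominus>\<^bsub>Hs\<^esub> x) < \<epsilon> / 2"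
  have "eventually ?Q F" using lim[OF a, of "\<epsilon> / 2"] assms(2) \<open>0 < \<epsilon>\<close> by (simp add: eventually_conj)
  moreover have "graph_norm \<pi> a (y \<ominus>\<^bsub>Hs\<^esub> z) < \<epsilon>" if "?Q y" "?Q z" for y z
    using that x graph_norm_triangle[OF a, of y x z] graph_norm_commute[OF a x, of z] by simp
  ultimately show "\<exists>Q. eventually Q F \<and> (\<forall>y z. Q y \<longrightarrow> Q z \<longrightarrow> graph_norm \<pi> a (y \<ominus>\<^bsub>Hs\<^esub> z) < \<epsilon>)"
    by blast
qed

lemma graph_approximableE:
  assumes "graph_approximable B \<pi> S x" "finite Q" "Q \<subseteq> carrier B \<times> {0<..}"
  obtains y where "y \<in> S" "\<And>a \<epsilon>. (a, \<epsilon>) \<in> Q \<Longrightarrow> graph_norm \<pi> a (y \<ominus>\<^bsub>Hs\<^esub> x) < \<epsilon>"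
proof -
  have "\<exists>y\<in>S. \<forall>(a, \<epsilon>)\<in>Q. graph_norm \<pi> a (y \<ominus>\<^bsub>Hs\<^esub> x) < \<epsilon>"
    using assms(1)[unfolded graph_approximable_def, THEN spec, of Q] assms(2,3) by simp
  then obtain y where "y \<in> S" "\<forall>(a, \<epsilon>)\<in>Q. graph_norm \<pi> a (y \<ominus>\<^bsub>Hs\<^esub> x) < \<epsilon>"
    by (rule bexE)
  then show thesis by (intro that) auto
qed

lemma graph_approximable_trans:
  assumes S: "S \<subseteq> Dom" and x: "x \<in> Dom"
    and near: "\<And>Q. \<lbrakk>finite Q; Q \<subseteq> carrier B \<times> {0<..}\<rbrakk> \<Longrightarrow>
      \<exists>y\<in>Dom. graph_approximable B \<pi> S y \<and>
        (\<forall>(a, \<epsilon>)\<in>Q. graph_norm \<pi> a (y \<ominus>\<^bsub>Hs\<^esub> x) < \<epsilon>)"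
  shows "graph_approximable B \<pi> S x"
  unfolding graph_approximable_def
proof (intro allI impI)
  fix Q :: "('a \<times> real) set" assume "finite Q \<and> Q \<subseteq> carrier B \<times> {0<..}"
  then have Q: "finite Q" "Q \<subseteq> carrier B \<times> {0<..}" by auto
  let ?R = "(\<lambda>(a, \<epsilon>). (a, \<epsilon> / 2)) ` Q"
  have R: "finite ?R" "?R \<subseteq> carrier B \<times> {0<..}" using Q by auto
  obtain y where y: "y \<in> Dom" "graph_approximable B \<pi> S y"
    "\<forall>(a, \<epsilon>)\<in>?R. graph_norm \<pi> a (y \<ominus>\<^bsub>Hs\<^esub> x) < \<epsilon>" using near[OF R] by blast
  obtain z where z: "z \<in> S" "\<And>a \<epsilon>. (a, \<epsilon>) \<in> ?R \<Longrightarrow> graph_norm \<pi> a (z \<ominus>\<^bsub>Hs\<^esub> y) < \<epsilon>"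
    by (rule graph_approximableE[OF y(2) R]) (rule that)
  have "graph_norm \<pi> a (z \<ominus>\<^bsub>Hs\<^esub> x) < \<epsilon>" if "(a, \<epsilon>) \<in> Q" for a \<epsilon>
  proof -
    have a: "a \<in> carrier B" using that Q by blast
    have "(a, \<epsilon> / 2) \<in> ?R" using that by (rule rev_image_eqI) simp
    have "graph_norm \<pi> a (z \<ominus>\<^bsub>Hs\<^esub> y) < \<epsilon> / 2" "graph_norm \<pi> a (y \<ominus>\<^bsub>Hs\<^esub> x) < \<epsilon> / 2"
      using y(3) z(2) \<open>(a, \<epsilon> / 2) \<in> ?R\<close> by blast+
    then show ?thesis using graph_norm_triangle[OF a, of z y x] z(1) S y(1) x by auto
  qed
  then show "\<exists>y\<in>S. \<forall>(a, \<epsilon>)\<in>Q. graph_norm \<pi> a (y \<ominus>\<^bsub>Hs\<^esub> x) < \<epsilon>" using z(1) by blast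
qed

lemma graph_norm_add:
  assumes a: "a \<in> carrier B" and x: "x \<in> Dom" "x' \<in> Dom" and y: "y \<in> Dom" "y' \<in> Dom"
  shows "graph_norm \<pi> a ((x \<oplus>\<^bsub>Hs\<^esub> y) \<ominus>\<^bsub>Hs\<^esub> (x' \<oplus>\<^bsub>Hs\<^esub> y'))
    \<le> graph_norm \<pi> a (x \<ominus>\<^bsub>Hs\<^esub> x') + graph_norm \<pi> a (y \<ominus>\<^bsub>Hs\<^esub> y')"
proof -
  note d = dom_facts(1) op_in_carrier[OF a]
  show ?thesis
    using space.hnorm_minus_add[of x y x' y']
      space.hnorm_minus_add[of "rep_op \<pi> a x" "rep_op \<pi> a y" "rep_op \<pi> a x'" "rep_op \<pi> a y'"] assms d
    by (simp add: graph_norm_minus dom_facts(3) op_linear_simps(1))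
qed

lemma graph_approximable_add:
  assumes S: "S \<subseteq> Dom" "\<And>x y. \<lbrakk>x \<in> S; y \<in> S\<rbrakk> \<Longrightarrow> x \<oplus>\<^bsub>Hs\<^esub> y \<in> S"
    and x: "x \<in> Dom" "graph_approximable B \<pi> S x" and y: "y \<in> Dom" "graph_approximable B \<pi> S y"
  shows "graph_approximable B \<pi> S (x \<oplus>\<^bsub>Hs\<^esub> y)"
  unfolding graph_approximable_def
proof (intro allI impI)
  fix Q :: "('a \<times> real) set" assume "finite Q \<and> Q \<subseteq> carrier B \<times> {0<..}"
  then have Q: "finite Q" "Q \<subseteq> carrier B \<times> {0<..}" by auto
  let ?R = "(\<lambda>(a, \<epsilon>). (a, \<epsilon> / 2)) ` Q"
  have R: "finite ?R" "?R \<subseteq> carrier B \<times> {0<..}" using Q by auto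
  obtain u where u: "u \<in> S" "\<And>a \<epsilon>. (a, \<epsilon>) \<in> ?R \<Longrightarrow> graph_norm \<pi> a (u \<ominus>\<^bsub>Hs\<^esub> x) < \<epsilon>"
    by (rule graph_approximableE[OF x(2) R]) (rule that)
  obtain v where v: "v \<in> S" "\<And>a \<epsilon>. (a, \<epsilon>) \<in> ?R \<Longrightarrow> graph_norm \<pi> a (v \<ominus>\<^bsub>Hs\<^esub> y) < \<epsilon>"
    by (rule graph_approximableE[OF y(2) R]) (rule that)
  have "graph_norm \<pi> a ((u \<oplus>\<^bsub>Hs\<^esub> v) \<ominus>\<^bsub>Hs\<^esub> (x \<oplus>\<^bsub>Hs\<^esub> y)) < \<epsilon>" if "(a, \<epsilon>) \<in> Q" for a \<epsilon>
  proof -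
    have a: "a \<in> carrier B" using that Q by blast
    have "(a, \<epsilon> / 2) \<in> ?R" using that by (rule rev_image_eqI) simp
    have "graph_norm \<pi> a (u \<ominus>\<^bsub>Hs\<^esub> x) < \<epsilon> / 2" "graph_norm \<pi> a (v \<ominus>\<^bsub>Hs\<^esub> y) < \<epsilon> / 2"
      using u(2) v(2) \<open>(a, \<epsilon> / 2) \<in> ?R\<close> by blast+
    moreover have "u \<in> Dom" "v \<in> Dom" using u(1) v(1) S(1) by blast+
    ultimately show ?thesis using graph_norm_add[OF a, of u x v y] x(1) y(1) by simp
  qed
  then show "\<exists>z\<in>S. \<forall>(a, \<epsilon>)\<in>Q. graph_norm \<pi> a (z \<ominus>\<^bsub>Hs\<^esub> (x \<oplus>\<^bsub>Hs\<^esub> y)) < \<epsilon>"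
    by (intro bexI[OF _ S(2)[OF u(1) v(1)]]) auto
qed

lemma graph_approximable_self:
  assumes "x \<in> S" "S \<subseteq> Dom"
  shows "graph_approximable B \<pi> S x"
  unfolding graph_approximable_def
proof (intro allI impI bexI[of _ x] assms(1))
  fix Q :: "('a \<times> real) set" assume "finite Q \<and> Q \<subseteq> carrier B \<times> {0<..}"
  then show "\<forall>(a, \<epsilon>)\<in>Q. graph_norm \<pi> a (x \<ominus>\<^bsub>Hs\<^esub> x) < \<epsilon>"
    using graph_norm_self[of _ x] assms by (auto simp del: space.r_neg simp: subset_iff)
qed

lemma op_vsum:
  assumes a: "a \<in> carrier B" and u: "\<And>k. k \<in> Poly_Mapping.keys f \<Longrightarrow> u k \<in> Dom"
  shows "rep_op \<pi> a (vsum (Hs) f u) = vsum (Hs) f (\<lambda>k. rep_op \<pi> a (u k))"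
proof -
  have "rep_op \<pi> a (vsum (Hs) f u)
      = (\<Oplus>\<^bsub>Hs\<^esub>k\<in>Poly_Mapping.keys f. rep_op \<pi> a (Poly_Mapping.lookup f k \<odot>\<^bsub>Hs\<^esub> u k))"
    unfolding vsum_def
    by (rule linear_on_finsum[OF _ _ dom_subspace op_linear[OF a]])
      (unfold_locales, use op_in_carrier[OF a] u dom_facts(4) in auto)
  also have "\<dots> = vsum (Hs) f (\<lambda>k. rep_op \<pi> a (u k))"
    unfolding vsum_def using u op_in_carrier[OF a] by (intro space.finsum_cong') (auto simp: op_linear_simps(2)[OF a])
  finally show ?thesis .
qed

end

text \<open>The closure of a representation that is, up to a unitary, a graph-dense restriction of a closed
  one.  The operators of the closure are well defined because the limits along a Cauchy filter may be
  computed in the closed representation.\<close>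

lemma rep_closure_transport:
  assumes "star_rep B \<pi>" and ne: "carrier B \<noteq> {}" and closed: "closed_rep B \<pi>"
    and C: "pre_hilbert (rep_space \<sigma>)"
    and U: "form_hom (rep_space \<pi>) (rep_space \<sigma>) U"
    and onto: "U ` carrier (rep_space \<pi>) = carrier (rep_space \<sigma>)"
    and D0: "D0 \<subseteq> rep_dom \<pi>" and dom: "rep_dom \<sigma> = U ` D0"
    and opU: "\<And>a \<phi>. \<lbrakk>a \<in> carrier B; \<phi> \<in> D0\<rbrakk> \<Longrightarrow> rep_op \<sigma> a (U \<phi>) = U (rep_op \<pi> a \<phi>)"
    and D0_sub: "submodule D0 complex_ring (rep_space \<pi>)"
    and dense: "\<And>\<phi>. \<phi> \<in> rep_dom \<pi> \<Longrightarrow> graph_approximable B \<pi> D0 \<phi>"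
  shows "rep_dom (rep_closure B \<sigma>) = U ` rep_dom \<pi>"
    and "\<And>a \<phi>. \<lbrakk>a \<in> carrier B; \<phi> \<in> rep_dom \<pi>\<rbrakk> \<Longrightarrow> rep_op (rep_closure B \<sigma>) a (U \<phi>) = U (rep_op \<pi> a \<phi>)"
proof -
  interpret \<pi>: star_rep B \<pi> by fact
  interpret C: pre_hilbert "rep_space \<sigma>" by fact
  let ?H = "rep_space \<pi>" and ?C = "rep_space \<sigma>"
  define V where "V = inv_into (carrier ?H) U"
  note inv = form_hom_inverse[OF U \<pi>.space.pre_hilbert_axioms onto, folded V_def]
  have Um: "U x \<ominus>\<^bsub>?C\<^esub> U y = U (x \<ominus>\<^bsub>?H\<^esub> y)" if "x \<in> carrier ?H" "y \<in> carrier ?H" for x y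
    by (rule form_hom_minus[OF U _ _ that, symmetric]) unfold_locales
  have Hd: "x \<in> carrier ?H" if "x \<in> rep_dom \<pi>" for x using \<pi>.dom_facts(1) that .
  have Unorm: "hnorm ?C (U x \<ominus>\<^bsub>?C\<^esub> U y) = hnorm ?H (x \<ominus>\<^bsub>?H\<^esub> y)" if "x \<in> carrier ?H" "y \<in> carrier ?H" for x y
    using that by (simp add: Um form_homD(5)[OF U])
  have gn: "graph_norm \<sigma> a (U x \<ominus>\<^bsub>?C\<^esub> U y) = graph_norm \<pi> a (x \<ominus>\<^bsub>?H\<^esub> y)"
    if a: "a \<in> carrier B" and x: "x \<in> D0" and y: "y \<in> D0" for a x y
  proof -
    have "x \<ominus>\<^bsub>?H\<^esub> y \<in> D0" using \<pi>.space.submodule_facts(5)[OF D0_sub x y] .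
    then show ?thesis using D0 Hd x y a \<pi>.op_in_carrier
      by (simp add: graph_norm_def Um opU form_homD(5)[OF U] subset_iff)
  qed
  \<comment> \<open>Every Cauchy filter of \<open>\<sigma>\<close> comes from one of \<open>\<pi>\<close>, and converges there by closedness.\<close>
  have L: "\<exists>\<phi>\<in>rep_dom \<pi>. limitin (htopology ?C) (\<lambda>x. x) (U \<phi>) F \<and>
      (\<forall>a\<in>carrier B. limitin (htopology ?C) (rep_op \<sigma> a) (U (rep_op \<pi> a \<phi>)) F)"
    if F: "graph_cauchy B \<sigma> F" for F
  proof -
    have FD: "\<forall>\<^sub>F x in F. x \<in> U ` D0" using F dom by (simp add: graph_cauchy_iff)
    have VD: "V x \<in> D0 \<and> x = U (V x)" if "x \<in> U ` D0" for x
      using that D0 Hd inv(3) by auto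
    have ev: "\<forall>\<^sub>F x in F. V x \<in> D0 \<and> x = U (V x)" using FD by eventually_elim (rule VD)
    have "graph_cauchy B \<pi> (filtermap V F)"
    proof (rule graph_cauchy_image[OF F FD order_refl])
      show "V x \<in> rep_dom \<pi>" if "x \<in> U ` D0" for x using VD[OF that] D0 by blast
      show "graph_norm \<pi> a (V x \<ominus>\<^bsub>?H\<^esub> V y) \<le> graph_norm \<sigma> a (x \<ominus>\<^bsub>?C\<^esub> y)"
        if "a \<in> carrier B" "x \<in> U ` D0" "y \<in> U ` D0" for a x y
        using gn[OF that(1)] VD[OF that(2)] VD[OF that(3)] by (metis order_refl)
    qed
    then obtain \<phi> where "limitin (graph_topology B \<pi>) (\<lambda>x. x) \<phi> (filtermap V F)"
      using closed unfolding closed_rep_def by blast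
    then have \<phi>: "\<phi> \<in> rep_dom \<pi>" and lim: "\<And>a \<epsilon>. \<lbrakk>a \<in> carrier B; 0 < \<epsilon>\<rbrakk> \<Longrightarrow>
        \<forall>\<^sub>F x in F. V x \<in> rep_dom \<pi> \<and> graph_norm \<pi> a (V x \<ominus>\<^bsub>?H\<^esub> \<phi>) < \<epsilon>"
      unfolding \<pi>.limitin_graph_iff[OF ne] eventually_filtermap by blast+
    obtain b where b: "b \<in> carrier B" using ne by blast
    have "limitin (htopology ?C) (\<lambda>x. x) (U \<phi>) F"
      unfolding C.limitin_htopology_iff
    proof (intro conjI allI impI)
      show "U \<phi> \<in> carrier ?C" using form_homD(1)[OF U] Hd \<phi> by blast
      fix \<epsilon> :: real assume "0 < \<epsilon>"
      from lim[OF b this] ev show "\<forall>\<^sub>F x in F. x \<in> carrier ?C \<and> hnorm ?C (x \<ominus>\<^bsub>?C\<^esub> U \<phi>) < \<epsilon>"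
      proof eventually_elim
        case (elim x)
        then have x: "V x \<in> rep_dom \<pi>" "x = U (V x)" by auto
        have "hnorm ?H (V x \<ominus>\<^bsub>?H\<^esub> \<phi>) \<le> graph_norm \<pi> b (V x \<ominus>\<^bsub>?H\<^esub> \<phi>)"
          using x(1) \<phi> b Hd \<pi>.op_in_carrier by (simp add: \<pi>.graph_norm_minus)
        then have "hnorm ?H (V x \<ominus>\<^bsub>?H\<^esub> \<phi>) < \<epsilon>" using elim by simp
        then have "hnorm ?C (U (V x) \<ominus>\<^bsub>?C\<^esub> U \<phi>) < \<epsilon>" using x(1) \<phi> Hd by (simp add: Unorm)
        moreover have "U (V x) \<in> carrier ?C" using form_homD(1)[OF U] Hd x(1) by blast
        ultimately show ?case using x(2) by simp
      qed
    qed
    moreover have "limitin (htopology ?C) (rep_op \<sigma> a) (U (rep_op \<pi> a \<phi>)) F" if a: "a \<in> carrier B" for a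
      unfolding C.limitin_htopology_iff
    proof (intro conjI allI impI)
      show "U (rep_op \<pi> a \<phi>) \<in> carrier ?C" using form_homD(1)[OF U] \<pi>.op_in_carrier[OF a \<phi>] by blast
      fix \<epsilon> :: real assume "0 < \<epsilon>"
      from lim[OF a this] ev
      show "\<forall>\<^sub>F x in F. rep_op \<sigma> a x \<in> carrier ?C \<and> hnorm ?C (rep_op \<sigma> a x \<ominus>\<^bsub>?C\<^esub> U (rep_op \<pi> a \<phi>)) < \<epsilon>"
      proof eventually_elim
        case (elim x)
        then have x: "V x \<in> rep_dom \<pi>" "x = U (V x)" "V x \<in> D0" by auto
        have e: "rep_op \<sigma> a x = U (rep_op \<pi> a (V x))" using opU[OF a x(3)] x(2) by simp
        note c = \<pi>.op_in_carrier[OF a x(1)] \<pi>.op_in_carrier[OF a \<phi>]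
        have "hnorm ?H (rep_op \<pi> a (V x) \<ominus>\<^bsub>?H\<^esub> rep_op \<pi> a \<phi>) \<le> graph_norm \<pi> a (V x \<ominus>\<^bsub>?H\<^esub> \<phi>)"
          using x(1) \<phi> a Hd by (simp add: \<pi>.graph_norm_minus)
        then have "hnorm ?H (rep_op \<pi> a (V x) \<ominus>\<^bsub>?H\<^esub> rep_op \<pi> a \<phi>) < \<epsilon>" using elim by simp
        then show ?case unfolding e using c form_homD(1)[OF U] by (simp add: Unorm)
      qed
    qed
    ultimately show ?thesis using \<phi> by blast
  qed
  \<comment> \<open>Conversely each vector of the domain of \<open>\<pi>\<close> is the limit of such a filter, by graph density.\<close>
  have cauchy_ex: "\<exists>F. graph_cauchy B \<sigma> F \<and> limitin (htopology ?C) (\<lambda>x. x) (U \<phi>) F" if \<phi>: "\<phi> \<in> rep_dom \<pi>" for \<phi>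
  proof -
    obtain F0 where F0: "F0 \<noteq> bot" "\<forall>\<^sub>F y in F0. y \<in> D0"
      "\<And>a \<epsilon>. \<lbrakk>a \<in> carrier B; 0 < \<epsilon>\<rbrakk> \<Longrightarrow> \<forall>\<^sub>F y in F0. graph_norm \<pi> a (y \<ominus>\<^bsub>?H\<^esub> \<phi>) < \<epsilon>"
      using \<pi>.graph_approximable_filter[OF dense[OF \<phi>]] by metis
    have F0d: "\<forall>\<^sub>F y in F0. y \<in> rep_dom \<pi>" using F0(2) by eventually_elim (use D0 in blast)
    have "graph_cauchy B \<pi> F0" by (rule \<pi>.graph_convergent_imp_cauchy[OF F0(1) F0d \<phi> F0(3)])
    have "graph_cauchy B \<sigma> (filtermap U F0)"
      by (rule graph_cauchy_image[OF \<open>graph_cauchy B \<pi> F0\<close> F0(2) order_refl]) (simp_all add: dom gn)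
    moreover have "limitin (htopology ?C) (\<lambda>x. x) (U \<phi>) (filtermap U F0)"
      unfolding C.limitin_htopology_iff eventually_filtermap
    proof (intro conjI allI impI)
      show "U \<phi> \<in> carrier ?C" using form_homD(1)[OF U] Hd \<phi> by blast
      obtain b where b: "b \<in> carrier B" using ne by blast
      fix \<epsilon> :: real assume "0 < \<epsilon>"
      from F0(3)[OF b this] F0d show "\<forall>\<^sub>F x in F0. U x \<in> carrier ?C \<and> hnorm ?C (U x \<ominus>\<^bsub>?C\<^esub> U \<phi>) < \<epsilon>"
      proof eventually_elim
        case (elim x)
        have "hnorm ?H (x \<ominus>\<^bsub>?H\<^esub> \<phi>) \<le> graph_norm \<pi> b (x \<ominus>\<^bsub>?H\<^esub> \<phi>)"
          using elim(2) \<phi> b Hd \<pi>.op_in_carrier by (simp add: \<pi>.graph_norm_minus)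
        then show ?case using elim \<phi> Hd form_homD(1)[OF U] by (simp add: Unorm)
      qed
    qed
    ultimately show ?thesis by blast
  qed
  have nb: "F \<noteq> bot" if "graph_cauchy B \<sigma> F" for F using that by (simp add: graph_cauchy_iff)
  show "rep_dom (rep_closure B \<sigma>) = U ` rep_dom \<pi>"
  proof
    show "U ` rep_dom \<pi> \<subseteq> rep_dom (rep_closure B \<sigma>)"
      using cauchy_ex by (auto simp: rep_closure_def)
    show "rep_dom (rep_closure B \<sigma>) \<subseteq> U ` rep_dom \<pi>"
    proof
      fix z assume "z \<in> rep_dom (rep_closure B \<sigma>)"
      then obtain F where F: "graph_cauchy B \<sigma> F" "limitin (htopology ?C) (\<lambda>x. x) z F"
        by (auto simp: rep_closure_def)
      obtain \<phi> where "\<phi> \<in> rep_dom \<pi>" "limitin (htopology ?C) (\<lambda>x. x) (U \<phi>) F" using L[OF F(1)] by blast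
      then show "z \<in> U ` rep_dom \<pi>" using C.limit_unique[OF F(2) _ nb[OF F(1)]] by blast
    qed
  qed
  fix a \<phi> assume a: "a \<in> carrier B" and \<phi>: "\<phi> \<in> rep_dom \<pi>"
  have lim: "limitin (htopology ?C) (rep_op \<sigma> a) (U (rep_op \<pi> a \<phi>)) F"
    if F: "graph_cauchy B \<sigma> F" "limitin (htopology ?C) (\<lambda>x. x) (U \<phi>) F" for F
  proof -
    obtain \<psi> where \<psi>: "\<psi> \<in> rep_dom \<pi>" "limitin (htopology ?C) (\<lambda>x. x) (U \<psi>) F"
      "limitin (htopology ?C) (rep_op \<sigma> a) (U (rep_op \<pi> a \<psi>)) F" using L[OF F(1)] a by blast
    have "U \<phi> = U \<psi>" using C.limit_unique[OF F(2) \<psi>(2) nb[OF F(1)]] .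
    then have "\<phi> = \<psi>" using inv(3)[of \<phi>] inv(3)[of \<psi>] Hd \<phi> \<psi>(1) by metis
    then show ?thesis using \<psi>(3) by simp
  qed
  obtain F where F: "graph_cauchy B \<sigma> F" "limitin (htopology ?C) (\<lambda>x. x) (U \<phi>) F"
    using cauchy_ex[OF \<phi>] by blast
  show "rep_op (rep_closure B \<sigma>) a (U \<phi>) = U (rep_op \<pi> a \<phi>)"
    unfolding rep_closure_def rep.select_convs
  proof (rule the_equality)
    show "\<forall>F. graph_cauchy B \<sigma> F \<and> limitin (htopology ?C) (\<lambda>x. x) (U \<phi>) F \<longrightarrow>
        limitin (htopology ?C) (rep_op \<sigma> a) (U (rep_op \<pi> a \<phi>)) F" using lim by blast
    fix \<psi> assume "\<forall>F. graph_cauchy B \<sigma> F \<and> limitin (htopology ?C) (\<lambda>x. x) (U \<phi>) F \<longrightarrow>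
        limitin (htopology ?C) (rep_op \<sigma> a) \<psi> F"
    then have "limitin (htopology ?C) (rep_op \<sigma> a) \<psi> F" using F by blast
    then show "\<psi> = U (rep_op \<pi> a \<phi>)" using C.limit_unique lim[OF F] nb[OF F(1)] by blast
  qed
qed

section \<open>Closed subspaces and orthogonal projections\<close>

text \<open>Two candidates \<open>y\<close>, \<open>y'\<close> in \<open>M\<close> have the same inner products with all of \<open>M\<close>, in
  particular with \<open>y\<close> and \<open>y'\<close>.  Thus a projection is determined by exhibiting it.\<close>

lemma (in pre_hilbert) orth_proj_eq:
  assumes x: "x \<in> carrier V" and M: "M \<subseteq> carrier V" and y: "y \<in> M"
    and orth: "\<And>z. z \<in> M \<Longrightarrow> cinner V (x \<ominus> y) z = 0"
  shows "orth_proj V M x = y"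
  unfolding orth_proj_def
proof (rule the_equality)
  show "y \<in> M \<and> (\<forall>z\<in>M. cinner V (x \<ominus> y) z = 0)" using y orth by blast
  fix y' assume y': "y' \<in> M \<and> (\<forall>z\<in>M. cinner V (x \<ominus> y') z = 0)"
  have c: "y \<in> carrier V" "y' \<in> carrier V" using M y y' by auto
  have "cinner V y z = cinner V y' z" if "z \<in> M" for z
    using orth[OF that] y' that x c M by (auto simp: form_minus_left subset_iff)
  then have "cinner V (y' \<ominus> y) (y' \<ominus> y) = 0"
    using c y y' by (simp add: form_simps)
  then have "y' \<ominus> y = \<zero>" using c by (intro cinner_definite) auto
  then show "y' = y" using c minus_eq_zero_iff by blast
qed

lemma (in pre_hilbert) closure_span_facts:
  assumes S: "S \<subseteq> carrier V"
  shows "lspan V S \<subseteq> carrier V" "htopology V closure_of lspan V S \<subseteq> carrier V"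
    "S \<subseteq> htopology V closure_of lspan V S"
proof -
  show l: "lspan V S \<subseteq> carrier V" using submodule_facts(1)[OF lspan_submodule[OF S]] .
  show "htopology V closure_of lspan V S \<subseteq> carrier V" using closure_htopology_iff[OF l] by blast
  have "hnorm V (x \<ominus> x) = 0" if "x \<in> carrier V" for x
    using minus_eq_zero_iff[OF that that] by simp
  then have "lspan V S \<subseteq> htopology V closure_of lspan V S"
    using closure_htopology_iff[OF l] l by (metis subsetD subsetI)
  then show "S \<subseteq> htopology V closure_of lspan V S" using lspan_superset by blast
qed

lemma (in pre_hilbert) orthogonal_closure_span:
  assumes S: "S \<subseteq> carrier V" and w: "w \<in> carrier V" and orth: "\<And>z. z \<in> S \<Longrightarrow> cinner V w z = 0"
    and z: "z \<in> htopology V closure_of lspan V S"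
  shows "cinner V w z = 0"
proof -
  note l = closure_span_facts(1)[OF S]
  have "submodule {u \<in> carrier V. cinner V w u = 0} complex_ring V"
    by (rule submodule_criterion) (use w in \<open>auto simp: form_simps\<close>)
  then have "lspan V S \<subseteq> {u \<in> carrier V. cinner V w u = 0}"
    using S orth by (intro lspan_minimal) auto
  then have 0: "cinner V w u = 0" if "u \<in> lspan V S" for u using that by blast
  have zV: "z \<in> carrier V" using z closure_span_facts(2)[OF S] by blast
  have "cmod (cinner V w z) \<le> 0"
  proof (rule field_le_epsilon)
    fix e :: real assume e: "0 < e"
    then have "0 < e / (hnorm V w + 1)" using w by (simp add: add_nonneg_pos)
    then obtain u where u: "u \<in> lspan V S" "hnorm V (z \<ominus> u) < e / (hnorm V w + 1)"
      using z closure_htopology_iff[OF l] by blast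
    have uV: "u \<in> carrier V" using u l by blast
    have "cmod (cinner V w z) = cmod (cinner V w (z \<ominus> u))"
      using w zV uV 0[OF u(1)] by (simp add: form_simps)
    also have "\<dots> \<le> hnorm V w * hnorm V (z \<ominus> u)" using w zV uV by (intro Cauchy_Schwarz) auto
    also have "\<dots> \<le> (hnorm V w + 1) * hnorm V (z \<ominus> u)" using zV uV by (intro mult_right_mono) auto
    also have "\<dots> \<le> (hnorm V w + 1) * (e / (hnorm V w + 1))"
      using u(2) w by (intro mult_left_mono) auto
    also have "\<dots> = e" using add_nonneg_pos[OF hnorm_nonneg[OF w], of 1] by simp
    finally show "cmod (cinner V w z) \<le> 0 + e" by simp
  qed
  then show ?thesis by simp
qed

context pre_hilbert begin

lemma subspace_minus:
  assumes S: "submodule S complex_ring V" and "x \<in> S" "y \<in> S"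
  shows "x \<ominus>\<^bsub>V\<lparr>carrier := S\<rparr>\<^esub> y = x \<ominus> y"
proof -
  have "module complex_ring (V\<lparr>carrier := S\<rparr>)" using submodule.submodule_is_module[OF S module_axioms] .
  then interpret S: complex_module "V\<lparr>carrier := S\<rparr>" by (simp add: complex_module_def)
  have "x \<in> carrier V" "y \<in> carrier V" using submodule_facts(1)[OF S] assms by auto
  then show ?thesis using assms S.minus_eq_smult[of x y] by (simp add: minus_eq_smult)
qed

lemma subspace_hnorm [simp]: "hnorm (V\<lparr>carrier := S\<rparr>) = hnorm V"
  by (simp add: hnorm_def fun_eq_iff)

lemma subspace_pre_hilbert:
  assumes S: "submodule S complex_ring V"
  shows "pre_hilbert (V\<lparr>carrier := S\<rparr>)"
proof -
  have "module complex_ring (V\<lparr>carrier := S\<rparr>)" using submodule.submodule_is_module[OF S module_axioms] .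
  then interpret S: complex_module "V\<lparr>carrier := S\<rparr>" by (simp add: complex_module_def)
  have "x \<in> carrier V" if "x \<in> S" for x using that submodule_facts(1)[OF S] by blast
  then show ?thesis
    by unfold_locales
      (auto simp: form_add_left form_smult_left form_nonneg cinner_definite intro: form_commute)
qed

end

lemma (in hilbert) closed_subspace_hilbert:
  assumes S: "submodule S complex_ring V"
    and closed: "\<And>x. \<lbrakk>x \<in> carrier V; \<And>\<epsilon>. 0 < \<epsilon> \<Longrightarrow> \<exists>y\<in>S. hnorm V (x \<ominus> y) < \<epsilon>\<rbrakk> \<Longrightarrow> x \<in> S"
  shows "hilbert (V\<lparr>carrier := S\<rparr>)"
proof -
  let ?S = "V\<lparr>carrier := S\<rparr>"
  interpret S: pre_hilbert ?S by (rule subspace_pre_hilbert[OF S])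
  note SV = submodule_facts(1)[OF S]
  have "\<exists>x. limitin (htopology ?S) s x sequentially" if s: "S.metric.MCauchy s" for s
  proof -
    have sS: "s n \<in> S" for n using s S.MCauchy_iff by simp
    have "metric.MCauchy s"
      using s SV unfolding MCauchy_iff S.MCauchy_iff by (auto simp: subspace_minus[OF S])
    then obtain x where x: "limitin (htopology V) s x sequentially"
      using complete unfolding metric.mcomplete_def htopology_def by blast
    then have xV: "x \<in> carrier V" and lim: "\<And>\<epsilon>. 0 < \<epsilon> \<Longrightarrow> \<forall>\<^sub>F n in sequentially. hnorm V (s n \<ominus> x) < \<epsilon>"
      unfolding limitin_htopology_iff by (auto simp: eventually_conj_iff)
    have "x \<in> S"
    proof (rule closed[OF xV])
      fix \<epsilon> :: real assume "0 < \<epsilon>"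
      then obtain n where "hnorm V (s n \<ominus> x) < \<epsilon>" using lim eventually_happens by fastforce
      then show "\<exists>y\<in>S. hnorm V (x \<ominus> y) < \<epsilon>"
        using sS[of n] hnorm_minus_commute[of "s n" x] xV SV by (intro bexI[of _ "s n"]) auto
    qed
    then have "limitin (htopology ?S) s x sequentially"
      unfolding S.limitin_htopology_iff using lim sS by (simp add: subspace_minus[OF S])
    then show ?thesis by blast
  qed
  then have "S.metric.mcomplete"
    unfolding S.metric.mcomplete_def htopology_def by blast
  then show ?thesis by unfold_locales
qed

lemma (in hermitian_space) projection_facts:
  assumes "is_projection V P"
  shows "x \<in> carrier V \<Longrightarrow> P x \<in> carrier V"
    "\<lbrakk>x \<in> carrier V; y \<in> carrier V\<rbrakk> \<Longrightarrow> P (x \<oplus> y) = P x \<oplus> P y"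
    "x \<in> carrier V \<Longrightarrow> P (c \<odot> x) = c \<odot> P x"
    "\<lbrakk>x \<in> carrier V; y \<in> carrier V\<rbrakk> \<Longrightarrow> P (x \<ominus> y) = P x \<ominus> P y"
    "x \<in> carrier V \<Longrightarrow> P (P x) = P x"
    "\<lbrakk>x \<in> carrier V; y \<in> carrier V\<rbrakk> \<Longrightarrow> cinner V (P x) y = cinner V x (P y)"
    "P \<zero> = \<zero>"
proof -
  have P: "linear_on (carrier V) V V P" "P ` carrier V \<subseteq> carrier V"
    using assms by (auto simp: is_projection_def)
  show "P (x \<ominus> y) = P x \<ominus> P y" if "x \<in> carrier V" "y \<in> carrier V"
    by (rule linear_on_minus[OF _ _ carrier_submodule P that]) unfold_locales
  show "P \<zero> = \<zero>"
    by (rule linear_on_zero[OF _ _ carrier_submodule P]) unfold_locales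
qed (use assms in \<open>auto simp: is_projection_def linear_on_def\<close>)

lemma (in semi_inner_space) projection_norm_le:
  assumes P: "is_projection V P" and x: "x \<in> carrier V"
  shows "hnorm V (P x) \<le> hnorm V x"
proof -
  note f = projection_facts[OF P]
  have "(hnorm V (P x))\<^sup>2 = Re (cinner V (P x) x)"
    using x f(1)[OF x] f(5)[OF x] f(6)[of "P x" x] by (simp add: hnorm_sq)
  also have "\<dots> \<le> hnorm V (P x) * hnorm V x"
    using Cauchy_Schwarz[OF f(1)[OF x] x] complex_Re_le_cmod order_trans by blast
  finally have "hnorm V (P x) * hnorm V (P x) \<le> hnorm V (P x) * hnorm V x"
    by (simp add: power2_eq_square)
  then show ?thesis using hnorm_nonneg[OF x] hnorm_nonneg[OF f(1)[OF x]]
    by (cases "hnorm V (P x) = 0") auto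
qed

text \<open>A projection is continuous, so its fixed vectors form a closed set.\<close>

lemma (in pre_hilbert) projection_fixed_closed:
  assumes P: "is_projection V P" and x: "x \<in> carrier V"
    and near: "\<And>\<epsilon>. 0 < \<epsilon> \<Longrightarrow> \<exists>y\<in>carrier V. P y = y \<and> hnorm V (x \<ominus> y) < \<epsilon>"
  shows "P x = x"
proof -
  note f = projection_facts[OF P]
  have "hnorm V (P x \<ominus> x) \<le> 0"
  proof (rule field_le_epsilon)
    fix e :: real assume "0 < e"
    then obtain y where y: "y \<in> carrier V" "P y = y" "hnorm V (x \<ominus> y) < e / 2"
      using near[of "e / 2"] by auto
    have "hnorm V (P x \<ominus> x) \<le> hnorm V (P x \<ominus> y) + hnorm V (y \<ominus> x)"
      using x y(1) f(1) by (intro hnorm_minus_triangle) auto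
    also have "hnorm V (P x \<ominus> y) \<le> hnorm V (x \<ominus> y)"
      using projection_norm_le[OF P, of "x \<ominus> y"] x y(1,2) f(4)[of x y] by simp
    also have "hnorm V (y \<ominus> x) = hnorm V (x \<ominus> y)" using x y(1) by (rule hnorm_minus_commute[rotated])
    finally show "hnorm V (P x \<ominus> x) \<le> 0 + e" using y(3) by simp
  qed
  then have "hnorm V (P x \<ominus> x) = 0" using f(1) x by (intro antisym) auto
  then show ?thesis using f(1) x by (simp add: hnorm_eq_0_iff minus_eq_zero_iff)
qed

section \<open>Systems of imprimitivity\<close>

locale imprimitivity = graded_algebra_subgroup G A \<A> H + pi: star_rep A \<pi>
  for G :: "('g, 'm) monoid_scheme" and A :: "'a star_alg" (structure)
    and \<A> :: "'g \<Rightarrow> 'a set" and H :: "'g set" and \<pi> :: "('a, 'h) rep" and E :: "'g set \<Rightarrow> 'h \<Rightarrow> 'h" +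
  assumes closed: "closed_rep A \<pi>" and system: "system_of_imprimitivity G H A \<A> \<pi> E"
begin

abbreviation Hs where "Hs \<equiv> rep_space \<pi>"
abbreviation Dom where "Dom \<equiv> rep_dom \<pi>"
abbreviation cosets where "cosets \<equiv> lcosets\<^bsub>G\<^esub> H"
abbreviation DH where "DH \<equiv> sys_dom \<pi> E H"
abbreviation HE where "HE \<equiv> Hs\<lparr>carrier := E H ` carrier Hs\<rparr>"
abbreviation \<F> where "\<F> \<equiv> finite_subsets_at_top cosets"
abbreviation psum where "psum T x \<equiv> \<Oplus>\<^bsub>Hs\<^esub>t\<in>T. E t x"

lemma subgroup_H: "subgroup H G" ..

lemma cosetI: "g \<in> carrier G \<Longrightarrow> g <#\<^bsub>G\<^esub> H \<in> cosets"
  by (auto simp: LCOSETS_def)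

lemma cosetE:
  assumes "t \<in> cosets" obtains g where "g \<in> carrier G" "t = g <#\<^bsub>G\<^esub> H"
  using assms by (auto simp: LCOSETS_def)

lemma coset_subset: "t \<in> cosets \<Longrightarrow> t \<subseteq> carrier G"
  using G.l_coset_subset_G[OF subset_G(1)] by (auto elim!: cosetE)

lemma H_coset: "H \<in> cosets"
  using cosetI[of "\<one>\<^bsub>G\<^esub>"] G.lcos_mult_one[OF subset_G(1)] by simp

lemma translate_coset:
  assumes "g \<in> carrier G" "t \<in> cosets" shows "g <#\<^bsub>G\<^esub> t \<in> cosets"
proof -
  obtain k where "k \<in> carrier G" "t = k <#\<^bsub>G\<^esub> H" using assms(2) by (rule cosetE)
  then show ?thesis using assms(1) G.lcos_m_assoc[OF subset_G(1), of g k] cosetI[of "g \<otimes>\<^bsub>G\<^esub> k"] by simp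
qed

lemma translate_inverse:
  assumes g: "g \<in> carrier G" and t: "t \<in> cosets"
  shows "inv\<^bsub>G\<^esub> g <#\<^bsub>G\<^esub> (g <#\<^bsub>G\<^esub> t) = t" "g <#\<^bsub>G\<^esub> (inv\<^bsub>G\<^esub> g <#\<^bsub>G\<^esub> t) = t"
  using G.lcos_m_assoc[OF coset_subset[OF t], of "inv\<^bsub>G\<^esub> g" g] G.lcos_m_assoc[OF coset_subset[OF t], of g "inv\<^bsub>G\<^esub> g"]
    G.lcos_mult_one[OF coset_subset[OF t]] g by simp_all

lemma coset_of_element:
  assumes "t \<in> cosets" "g \<in> t" shows "g <#\<^bsub>G\<^esub> H = t" "g \<in> carrier G"
proof -
  obtain k where k: "k \<in> carrier G" "t = k <#\<^bsub>G\<^esub> H" using assms(1) by (rule cosetE)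
  then show "g <#\<^bsub>G\<^esub> H = t" using G.l_repr_independence[of g k H] assms(2) subgroup_H by simp
  show "g \<in> carrier G" using coset_subset assms by blast
qed

lemma coset_of_compl: "g \<in> carrier G - H \<Longrightarrow> g <#\<^bsub>G\<^esub> H \<noteq> H"
  using G.lcos_self[OF _ subgroup_H] by blast

lemma E_projection: "t \<in> cosets \<Longrightarrow> is_projection Hs (E t)"
  using system by (simp add: system_of_imprimitivity_def)

lemmas E_facts = pi.space.projection_facts[OF E_projection]
lemmas E_norm_le = pi.space.projection_norm_le[OF E_projection]

lemma E_orthogonal: "\<lbrakk>s \<in> cosets; t \<in> cosets; s \<noteq> t; x \<in> carrier Hs\<rbrakk> \<Longrightarrow> E s (E t x) = \<zero>\<^bsub>Hs\<^esub>"
  using system by (simp add: system_of_imprimitivity_def)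

lemma E_sum: "x \<in> carrier Hs \<Longrightarrow>
    limitin (htopology Hs) (\<lambda>T. \<Oplus>\<^bsub>Hs\<^esub>t\<in>T. E t x) x (finite_subsets_at_top cosets)"
  using system by (simp add: system_of_imprimitivity_def)

lemma E_op:
  "\<lbrakk>g \<in> carrier G; t \<in> cosets; a \<in> \<A> g; \<phi> \<in> Dom\<rbrakk> \<Longrightarrow> E (g <#\<^bsub>G\<^esub> t) (rep_op \<pi> a \<phi>) = rep_op \<pi> a (E t \<phi>)"
  using system by (simp add: system_of_imprimitivity_def)

text \<open>The invariance of the domain is part of the intertwining relation, for instance
  for \<open>a = 0\<close> in degree \<open>1\<close>.\<close>

lemma E_dom: "\<lbrakk>t \<in> cosets; \<phi> \<in> Dom\<rbrakk> \<Longrightarrow> E t \<phi> \<in> Dom"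
  using system grade_facts(2)[OF G.one_closed] unfolding system_of_imprimitivity_def by blast

lemma sys_dom_iff: "t \<in> cosets \<Longrightarrow> \<phi> \<in> sys_dom \<pi> E t \<longleftrightarrow> \<phi> \<in> Dom \<and> E t \<phi> = \<phi>"
  using E_facts(5)[of t] pi.dom_facts(1) by (force simp: sys_dom_def)

lemma sys_dom_closed:
  assumes t: "t \<in> cosets" and x: "x \<in> sys_dom \<pi> E t"
  shows "x \<in> Dom" "x \<in> carrier Hs" "E t x = x"
    "c \<odot>\<^bsub>Hs\<^esub> x \<in> sys_dom \<pi> E t" "y \<in> sys_dom \<pi> E t \<Longrightarrow> x \<oplus>\<^bsub>Hs\<^esub> y \<in> sys_dom \<pi> E t"
  using x sys_dom_iff[OF t] pi.dom_facts E_facts(2,3)[OF t] by auto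

lemma sys_dom_submodule: "t \<in> cosets \<Longrightarrow> submodule (sys_dom \<pi> E t) complex_ring Hs"
  by (rule pi.space.submodule_criterion)
    (auto simp: sys_dom_iff pi.dom_facts E_facts(2,3,7))

lemma E_sys_dom: "\<lbrakk>t \<in> cosets; \<phi> \<in> Dom\<rbrakk> \<Longrightarrow> E t \<phi> \<in> sys_dom \<pi> E t"
  by (simp add: sys_dom_iff E_dom E_facts(5) pi.dom_facts(1))

lemma pi_add: "\<lbrakk>a \<in> carrier A; b \<in> carrier A; \<phi> \<in> Dom\<rbrakk>
    \<Longrightarrow> rep_op \<pi> (a \<oplus> b) \<phi> = rep_op \<pi> a \<phi> \<oplus>\<^bsub>Hs\<^esub> rep_op \<pi> b \<phi>"
  by (rule pi.op_add)

lemma pi_zero: "\<phi> \<in> Dom \<Longrightarrow> rep_op \<pi> \<zero> \<phi> = \<zero>\<^bsub>Hs\<^esub>"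
  using pi.op_smult[of \<zero> \<phi> 0] pi.op_in_carrier[of \<zero> \<phi>] by simp

text \<open>The intertwining relation at the coset \<open>H\<close>: if \<open>x\<close> has degree \<open>g\<close>, then \<open>E (gH) \<pi>(x) v = \<pi>(x) (E H v)\<close>,
  which is \<open>\<pi>(x) v\<close>.\<close>

lemma op_coset_sys_dom:
  assumes t: "t \<in> cosets" and v: "v \<in> DH" and a: "a \<in> part t"
  shows "rep_op \<pi> a v \<in> sys_dom \<pi> E t"
proof -
  note vd = sys_dom_closed(1,3)[OF H_coset v]
  show ?thesis
    using coset_subset[OF t] a
  proof (induction rule: part_induct)
    case zero then show ?case
      using pi_zero[OF vd(1)] pi.space.submodule_facts(2)[OF sys_dom_submodule[OF t]] by simp
  next
    case (add g x b)
    have "E (g <#\<^bsub>G\<^esub> H) (rep_op \<pi> x v) = rep_op \<pi> x v"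
      using E_op[OF _ H_coset add(2) vd(1)] coset_of_element[OF t add(1)] vd(2) by simp
    then have "rep_op \<pi> x v \<in> sys_dom \<pi> E t"
      using coset_of_element[OF t add(1)] sys_dom_iff[OF t] pi.op_closed[OF add(3) vd(1)] by simp
    then show ?case using add sys_dom_closed(5)[OF t] by (simp add: pi_add vd(1))
  qed
qed

text \<open>Degrees outside \<open>H\<close> lead to other cosets, whose ranges are orthogonal to that of
  \<open>E H\<close>.\<close>

lemma E_op_part_compl:
  assumes v: "v \<in> DH" and a: "a \<in> part (carrier G - H)"
  shows "E H (rep_op \<pi> a v) = \<zero>\<^bsub>Hs\<^esub>"
  using subset_G(2) a
proof (induction rule: part_induct)
  note vd = sys_dom_closed(1,3)[OF H_coset v]
  case zero then show ?case by (simp add: pi_zero vd E_facts(7)[OF H_coset])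
next
  note vd = sys_dom_closed(1,3)[OF H_coset v]
  case (add g x b)
  have g: "g \<in> carrier G" "g <#\<^bsub>G\<^esub> H \<noteq> H" using add(1) coset_of_compl by auto
  have x: "rep_op \<pi> x v \<in> carrier Hs" using pi.op_in_carrier[OF add(3) vd(1)] .
  have "E (g <#\<^bsub>G\<^esub> H) (rep_op \<pi> x v) = rep_op \<pi> x v"
    using E_op[OF g(1) H_coset add(2) vd(1)] vd(2) by simp
  then have "E H (rep_op \<pi> x v) = \<zero>\<^bsub>Hs\<^esub>"
    using E_orthogonal[OF H_coset cosetI[OF g(1)] _ x] g(2) by simp
  then show ?case using add vd x E_facts(2)[OF H_coset] pi.op_in_carrier by (simp add: pi_add)
qed

section \<open>The inducing representation\<close>

definition \<rho>0 :: "('a, 'h) rep" where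
  "\<rho>0 = \<lparr>rep_space = HE, rep_dom = DH, rep_op = rep_op \<pi>\<rparr>"

lemma \<rho>0_simps [simp]:
  "rep_space \<rho>0 = HE" "rep_dom \<rho>0 = DH" "rep_op \<rho>0 = rep_op \<pi>"
  by (simp_all add: \<rho>0_def)

lemma range_E_H: "x \<in> E H ` carrier Hs \<longleftrightarrow> x \<in> carrier Hs \<and> E H x = x"
  using E_facts(1,5)[OF H_coset] by force

lemma range_E_H_submodule: "submodule (E H ` carrier Hs) complex_ring Hs"
  by (rule pi.space.submodule_criterion) (auto simp: range_E_H E_facts(1,2,3,7)[OF H_coset] simp del: image_iff)

text \<open>The range of a projection is closed.\<close>

lemma hilbert_\<rho>0: "hilbert HE"
proof (rule pi.space.closed_subspace_hilbert[OF range_E_H_submodule])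
  fix x assume x: "x \<in> carrier Hs"
    and near: "\<And>\<epsilon>. 0 < \<epsilon> \<Longrightarrow> \<exists>y\<in>E H ` carrier Hs. hnorm Hs (x \<ominus>\<^bsub>Hs\<^esub> y) < \<epsilon>"
  have "E H x = x"
  proof (rule pi.space.projection_fixed_closed[OF E_projection[OF H_coset] x])
    fix \<epsilon> :: real assume "0 < \<epsilon>"
    then show "\<exists>y\<in>carrier Hs. E H y = y \<and> hnorm Hs (x \<ominus>\<^bsub>Hs\<^esub> y) < \<epsilon>"
      using near range_E_H by metis
  qed
  then show "x \<in> E H ` carrier Hs" using x range_E_H by blast
qed

lemma sub_minus: "\<lbrakk>x \<in> E H ` carrier Hs; y \<in> E H ` carrier Hs\<rbrakk>
    \<Longrightarrow> x \<ominus>\<^bsub>HE\<^esub> y = x \<ominus>\<^bsub>Hs\<^esub> y"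
  by (rule pi.space.subspace_minus[OF range_E_H_submodule])

lemma DH_range: "v \<in> DH \<Longrightarrow> v \<in> E H ` carrier Hs"
  by (simp add: sys_dom_def)

lemma DH_op: "\<lbrakk>a \<in> part H; v \<in> DH\<rbrakk> \<Longrightarrow> rep_op \<pi> a v \<in> DH"
  by (rule op_coset_sys_dom[OF H_coset])

lemma star_rep_\<rho>0: "star_rep B \<rho>0"
proof -
  interpret S: hilbert "HE" by (rule hilbert_\<rho>0)
  note d = sys_dom_closed[OF H_coset]
  have sub: "DH \<subseteq> E H ` carrier Hs" using DH_range by blast
  show ?thesis
  proof (rule star_rep.intro, unfold \<rho>0_simps B_simps)
    show "submodule DH complex_ring HE"
      by (rule S.submodule_criterion)
        (use sub d pi.space.submodule_facts(2)[OF sys_dom_submodule[OF H_coset]] in auto)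
    show "htopology HE closure_of DH
        = carrier HE"
    proof -
      have "\<exists>y\<in>DH. hnorm Hs (x \<ominus>\<^bsub>Hs\<^esub> y) < \<epsilon>" if x: "x \<in> E H ` carrier Hs" and \<epsilon>: "0 < \<epsilon>" for x \<epsilon>
      proof -
        have xH: "x \<in> carrier Hs" "E H x = x" using x range_E_H by auto
        have "Dom \<subseteq> carrier Hs" using pi.dom_facts(1) by blast
        then obtain \<phi> where \<phi>: "\<phi> \<in> Dom" "hnorm Hs (x \<ominus>\<^bsub>Hs\<^esub> \<phi>) < \<epsilon>"
          using pi.dom_dense pi.space.closure_htopology_iff[of Dom x] xH(1) \<epsilon> by auto
        have \<phi>H: "\<phi> \<in> carrier Hs" using \<phi>(1) pi.dom_facts(1) by blast
        have "x \<ominus>\<^bsub>Hs\<^esub> E H \<phi> = E H (x \<ominus>\<^bsub>Hs\<^esub> \<phi>)"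
          using E_facts(4)[OF H_coset xH(1) \<phi>H] xH(2) by simp
        then have "hnorm Hs (x \<ominus>\<^bsub>Hs\<^esub> E H \<phi>) \<le> hnorm Hs (x \<ominus>\<^bsub>Hs\<^esub> \<phi>)"
          using E_norm_le[OF H_coset, of "x \<ominus>\<^bsub>Hs\<^esub> \<phi>"] xH \<phi>H by simp
        then show ?thesis using E_sys_dom[OF H_coset \<phi>(1)] \<phi>(2) by (intro bexI[of _ "E H \<phi>"]) auto
      qed
      moreover have "x \<ominus>\<^bsub>HE\<^esub> y = x \<ominus>\<^bsub>Hs\<^esub> y"
        if "x \<in> E H ` carrier Hs" "y \<in> DH" for x y using that sub sub_minus by blast
      ultimately show ?thesis
        using S.closure_htopology_iff[of DH] sub by (auto simp del: image_iff)
    qed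
    fix a assume a: "a \<in> part H"
    then have aA: "a \<in> carrier A" by (rule part_H_carrier)
    show "linear_on DH HE HE (rep_op \<pi> a)"
      using d pi.op_linear_simps[OF aA] by (simp add: linear_on_def)
    fix \<phi> assume \<phi>: "\<phi> \<in> DH"
    show "rep_op \<pi> a \<phi> \<in> DH" using a \<phi> by (rule DH_op)
    show "rep_op \<pi> (c \<odot> a) \<phi> = c \<odot>\<^bsub>HE\<^esub> rep_op \<pi> a \<phi>" for c
      using pi.op_smult[OF aA d(1)[OF \<phi>]] by simp
    show "cinner HE (rep_op \<pi> a \<phi>) \<psi>
        = cinner HE \<phi> (rep_op \<pi> (star A a) \<psi>)" if "\<psi> \<in> DH" for \<psi>
      using pi.op_adjoint[OF aA d(1)[OF \<phi>] d(1)[OF that]] by simp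
    fix b assume b: "b \<in> part H"
    then have bA: "b \<in> carrier A" by (rule part_H_carrier)
    show "rep_op \<pi> (a \<oplus> b) \<phi> = rep_op \<pi> a \<phi> \<oplus>\<^bsub>HE\<^esub> rep_op \<pi> b \<phi>"
      using pi.op_add[OF aA bA d(1)[OF \<phi>]] by simp
    show "rep_op \<pi> (a \<otimes> b) \<phi> = rep_op \<pi> a (rep_op \<pi> b \<phi>)"
      using pi.op_mult[OF aA bA d(1)[OF \<phi>]] .
  next
    show "rep_op \<pi> \<one> \<phi> = \<phi>" if "\<phi> \<in> DH" for \<phi> using pi.op_one d(1)[OF that] .
  qed (use S.hilbert_axioms in auto)
qed

text \<open>For \<open>a\<close> homogeneous, \<open>a\<^sup>* a\<close> has degree \<open>1\<close> and \<open>\<parallel>\<pi>(a) v\<parallel>\<^sup>2 = \<langle>\<pi>(a\<^sup>* a) v, v\<rangle>\<close>: on the range of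
  \<open>E H\<close> the graph topologies of \<open>A\<close> and of the subalgebra over \<open>H\<close> agree.\<close>

lemma homogeneous_graph_norm:
  assumes g: "g \<in> carrier G" and x: "x \<in> \<A> g" and v: "v \<in> Dom"
  shows "star A x \<otimes> x \<in> part H" "hnorm Hs (rep_op \<pi> x v) \<le> graph_norm \<pi> (star A x \<otimes> x) v"
proof -
  have xA: "x \<in> carrier A" using x grade_facts(1)[OF g] by blast
  let ?y = "star A x \<otimes> x"
  have "?y \<in> \<A> (inv\<^bsub>G\<^esub> g \<otimes>\<^bsub>G\<^esub> g)" using g x by (intro grade_mult grade_star) auto
  then show "?y \<in> part H" using part_homogeneous[OF subset_G(1) H.one_closed] g by simp
  have yA: "?y \<in> carrier A" using xA star_closed by simp
  have vH: "v \<in> carrier Hs" using v pi.dom_facts(1) by blast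
  note xv = pi.op_in_carrier[OF xA v] and yv = pi.op_in_carrier[OF yA v]
  have "cinner Hs (rep_op \<pi> x v) (rep_op \<pi> x v) = cinner Hs v (rep_op \<pi> ?y v)"
    using pi.op_adjoint[OF xA v pi.op_closed[OF xA v]] pi.op_mult[OF star_closed[OF xA] xA v] by simp
  then have "(hnorm Hs (rep_op \<pi> x v))\<^sup>2 \<le> hnorm Hs v * hnorm Hs (rep_op \<pi> ?y v)"
    using pi.space.Cauchy_Schwarz[OF vH yv] complex_Re_le_cmod[of "cinner Hs v (rep_op \<pi> ?y v)"] xv
    by (simp add: pi.space.hnorm_sq)
  also have "\<dots> \<le> (graph_norm \<pi> ?y v)\<^sup>2"
    unfolding graph_norm_def power2_eq_square using vH yv by (intro mult_mono) auto
  finally show "hnorm Hs (rep_op \<pi> x v) \<le> graph_norm \<pi> ?y v"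
    by (rule power2_le_imp_le) (use vH yv in \<open>simp add: graph_norm_def\<close>)
qed

text \<open>A Cauchy filter for the subalgebra on the range of \<open>E H\<close> is one for the whole
  algebra, hence converges in the domain of \<open>\<pi>\<close>; the limit is fixed by \<open>E H\<close>.\<close>

lemma closed_\<rho>0: "closed_rep B \<rho>0"
  unfolding closed_rep_def
proof (intro allI impI)
  fix F :: "'h filter" assume F: "graph_cauchy B \<rho>0 F"
  interpret \<rho>0: star_rep B \<rho>0 by (rule star_rep_\<rho>0)
  have ev: "\<forall>\<^sub>F v in F. v \<in> DH" and nb: "F \<noteq> bot" using F by (simp_all add: graph_cauchy_iff)
  note d = sys_dom_closed[OF H_coset]
  have gn: "graph_norm \<rho>0 a (x \<ominus>\<^bsub>rep_space \<rho>0\<^esub> y) = graph_norm \<pi> a (x \<ominus>\<^bsub>Hs\<^esub> y)"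
    if "x \<in> DH" "y \<in> DH" for a x y
    using that by (simp add: graph_norm_def sub_minus DH_range)
  have FH: "\<exists>Q. eventually Q F \<and> (\<forall>x y. Q x \<longrightarrow> Q y \<longrightarrow> x \<in> DH \<and> y \<in> DH \<and> graph_norm \<pi> a (x \<ominus>\<^bsub>Hs\<^esub> y) < \<epsilon>)"
    if a: "a \<in> part H" and \<epsilon>: "0 < \<epsilon>" for a \<epsilon>
  proof -
    obtain Q where Q: "eventually Q F" "\<And>x y. \<lbrakk>Q x; Q y\<rbrakk> \<Longrightarrow> graph_norm \<rho>0 a (x \<ominus>\<^bsub>rep_space \<rho>0\<^esub> y) < \<epsilon>"
      using F a \<epsilon> unfolding graph_cauchy_iff B_simps by meson
    have "eventually (\<lambda>x. Q x \<and> x \<in> DH) F" using Q(1) ev by (rule eventually_conj)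
    moreover have "graph_norm \<pi> a (x \<ominus>\<^bsub>Hs\<^esub> y) < \<epsilon>" if "Q x \<and> x \<in> DH" "Q y \<and> y \<in> DH" for x y
      using Q(2)[of x y] gn[of x y a] that by simp
    ultimately show ?thesis by (intro exI[of _ "\<lambda>x. Q x \<and> x \<in> DH"]) blast
  qed
  \<comment> \<open>Extension of \<open>FH\<close> from the subalgebra to the whole algebra, one homogeneous summand at a time.\<close>
  have cauchy: "\<exists>Q. eventually Q F \<and> (\<forall>x y. Q x \<longrightarrow> Q y \<longrightarrow> x \<in> DH \<and> y \<in> DH \<and> graph_norm \<pi> a (x \<ominus>\<^bsub>Hs\<^esub> y) < \<epsilon>)"
    if "0 < \<epsilon>" "a \<in> part (carrier G)" for a \<epsilon>
    using order_refl that(2,1)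
  proof (induction arbitrary: \<epsilon> rule: part_induct)
    case zero then show ?case using FH zero_in_part by blast
  next
    case (add g x b)
    have y: "star A x \<otimes> x \<in> part H" using homogeneous_graph_norm(1)[OF add(1,2), of "\<zero>\<^bsub>Hs\<^esub>"] pi.dom_facts(2) by blast
    obtain Q where Q: "eventually Q F"
      "\<And>u w. \<lbrakk>Q u; Q w\<rbrakk> \<Longrightarrow> u \<in> DH \<and> w \<in> DH \<and> graph_norm \<pi> (star A x \<otimes> x) (u \<ominus>\<^bsub>Hs\<^esub> w) < \<epsilon> / 2"
      using FH[OF y, of "\<epsilon> / 2"] add.prems by auto
    obtain R where R: "eventually R F"
      "\<And>u w. \<lbrakk>R u; R w\<rbrakk> \<Longrightarrow> u \<in> DH \<and> w \<in> DH \<and> graph_norm \<pi> b (u \<ominus>\<^bsub>Hs\<^esub> w) < \<epsilon> / 2"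
      using add.IH[of "\<epsilon> / 2"] add.prems by auto
    have "graph_norm \<pi> (x \<oplus> b) (u \<ominus>\<^bsub>Hs\<^esub> w) < \<epsilon>" if "Q u" "R u" "Q w" "R w" for u w
    proof -
      have "u \<in> DH" "w \<in> DH" using Q(2) that by blast+
      then have dom: "u \<ominus>\<^bsub>Hs\<^esub> w \<in> Dom" using d(1) pi.dom_facts(5) by blast
      have "hnorm Hs (rep_op \<pi> (x \<oplus> b) (u \<ominus>\<^bsub>Hs\<^esub> w))
          \<le> hnorm Hs (rep_op \<pi> x (u \<ominus>\<^bsub>Hs\<^esub> w)) + hnorm Hs (rep_op \<pi> b (u \<ominus>\<^bsub>Hs\<^esub> w))"
        using dom add by (simp add: pi_add pi.space.hnorm_triangle pi.op_in_carrier)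
      also have "hnorm Hs (rep_op \<pi> x (u \<ominus>\<^bsub>Hs\<^esub> w)) < \<epsilon> / 2"
        using homogeneous_graph_norm(2)[OF add(1,2) dom] Q(2)[OF that(1,3)] by simp
      finally show ?thesis using R(2)[OF that(2,4)] by (simp add: graph_norm_def)
    qed
    then show ?case using Q R eventually_conj[OF Q(1) R(1)]
      by (intro exI[of _ "\<lambda>z. Q z \<and> R z"]) blast
  qed
  have "graph_cauchy A \<pi> F"
    unfolding graph_cauchy_iff
  proof (intro conjI ballI allI impI nb)
    show "\<forall>\<^sub>F v in F. v \<in> Dom" using ev by eventually_elim (rule d(1))
    fix a and \<epsilon> :: real assume "a \<in> carrier A" "0 < \<epsilon>"
    then obtain Q where "eventually Q F" "\<And>x y. \<lbrakk>Q x; Q y\<rbrakk> \<Longrightarrow> graph_norm \<pi> a (x \<ominus>\<^bsub>Hs\<^esub> y) < \<epsilon>"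
      using cauchy[of \<epsilon> a] carrier_eq_part by auto
    then show "\<exists>Q. eventually Q F \<and> (\<forall>x y. Q x \<longrightarrow> Q y \<longrightarrow> graph_norm \<pi> a (x \<ominus>\<^bsub>Hs\<^esub> y) < \<epsilon>)"
      by (intro exI[of _ Q]) simp
  qed
  then obtain \<phi> where lim: "limitin (graph_topology A \<pi>) (\<lambda>x. x) \<phi> F"
    using closed unfolding closed_rep_def by blast
  have ne: "carrier A \<noteq> {}" "carrier B \<noteq> {}" using one_in_part_H by auto
  have \<phi>: "\<phi> \<in> Dom" and conv: "\<And>a \<epsilon>. \<lbrakk>a \<in> carrier A; 0 < \<epsilon>\<rbrakk> \<Longrightarrow>
      \<forall>\<^sub>F v in F. v \<in> Dom \<and> graph_norm \<pi> a (v \<ominus>\<^bsub>Hs\<^esub> \<phi>) < \<epsilon>"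
    using lim unfolding pi.limitin_graph_iff[OF ne(1)] by blast+
  have \<phi>H: "\<phi> \<in> carrier Hs" using \<phi> pi.dom_facts(1) by blast
  have "E H \<phi> = \<phi>"
  proof (rule pi.space.projection_fixed_closed[OF E_projection[OF H_coset] \<phi>H])
    fix \<epsilon> :: real assume "0 < \<epsilon>"
    then have "\<forall>\<^sub>F v in F. v \<in> DH \<and> graph_norm \<pi> \<one> (v \<ominus>\<^bsub>Hs\<^esub> \<phi>) < \<epsilon>"
      using conv[OF one_closed, of \<epsilon>] ev by (simp add: eventually_conj_iff)
    then obtain v where v: "v \<in> DH" "graph_norm \<pi> \<one> (v \<ominus>\<^bsub>Hs\<^esub> \<phi>) < \<epsilon>"
      using nb eventually_happens by blast
    have "hnorm Hs (v \<ominus>\<^bsub>Hs\<^esub> \<phi>) \<le> graph_norm \<pi> \<one> (v \<ominus>\<^bsub>Hs\<^esub> \<phi>)"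
      using pi.op_in_carrier[OF one_closed pi.dom_facts(5)[OF d(1)[OF v(1)] \<phi>]] by (simp add: graph_norm_def)
    then show "\<exists>y\<in>carrier Hs. E H y = y \<and> hnorm Hs (\<phi> \<ominus>\<^bsub>Hs\<^esub> y) < \<epsilon>"
      using v d[OF v(1)] pi.space.hnorm_minus_commute[OF \<phi>H, of v] by (intro bexI[of _ v]) auto
  qed
  then have \<phi>D: "\<phi> \<in> DH" using \<phi> sys_dom_iff[OF H_coset] by simp
  have "limitin (graph_topology B \<rho>0) (\<lambda>x. x) \<phi> F"
    unfolding \<rho>0.limitin_graph_iff[OF ne(2)]
  proof (intro conjI ballI allI impI)
    show "\<phi> \<in> rep_dom \<rho>0" using \<phi>D by simp
    fix a and \<epsilon> :: real assume "a \<in> carrier B" "0 < \<epsilon>"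
    then have "a \<in> carrier A" using part_H_carrier by simp
    from conv[OF this \<open>0 < \<epsilon>\<close>] ev
    show "\<forall>\<^sub>F v in F. v \<in> rep_dom \<rho>0 \<and> graph_norm \<rho>0 a (v \<ominus>\<^bsub>rep_space \<rho>0\<^esub> \<phi>) < \<epsilon>"
      by eventually_elim (use gn \<phi>D in simp)
  qed
  then show "\<exists>\<phi>. limitin (graph_topology B \<rho>0) (\<lambda>x. x) \<phi> F" by blast
qed

end

section \<open>Existence\<close>

context imprimitivity begin

sublocale R: induction_data G A \<A> H \<rho>0
  by (intro induction_data.intro graded_algebra_subgroup_axioms star_rep_\<rho>0)

text \<open>This map will be seen to identify the induced space with the space of \<open>\<pi>\<close>.\<close>

definition \<Phi> :: "('a \<times> 'h \<Rightarrow>\<^sub>0 complex) \<Rightarrow> 'h" where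
  "\<Phi> f = vsum Hs f (\<lambda>k. rep_op \<pi> (fst k) (snd k))"

lemma FT_key:
  assumes "f \<in> carrier R.FT" "k \<in> Poly_Mapping.keys f"
  shows "fst k \<in> carrier A" "snd k \<in> DH" "snd k \<in> Dom" "rep_op \<pi> (fst k) (snd k) \<in> Dom"
    "rep_op \<pi> (fst k) (snd k) \<in> carrier Hs"
proof -
  have k: "k \<in> carrier A \<times> DH" using R.keysD[OF assms] by simp
  then show a: "fst k \<in> carrier A" "snd k \<in> DH" by auto
  then show "snd k \<in> Dom" using sys_dom_closed(1)[OF H_coset] by blast
  then show "rep_op \<pi> (fst k) (snd k) \<in> Dom" "rep_op \<pi> (fst k) (snd k) \<in> carrier Hs"
    using a(1) pi.op_closed pi.op_in_carrier by auto
qed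

lemma \<Phi>_dom: "f \<in> carrier R.FT \<Longrightarrow> \<Phi> f \<in> Dom"
  unfolding \<Phi>_def by (rule pi.space.vsum_in_submodule[OF pi.dom_subspace]) (rule FT_key)

lemma \<Phi>_carrier: "f \<in> carrier R.FT \<Longrightarrow> \<Phi> f \<in> carrier Hs"
  using \<Phi>_dom pi.dom_facts(1) by blast

lemma form_\<Phi>_left:
  "\<lbrakk>f \<in> carrier R.FT; z \<in> carrier Hs\<rbrakk>
    \<Longrightarrow> cinner Hs (\<Phi> f) z = lsum f (\<lambda>k. cinner Hs (rep_op \<pi> (fst k) (snd k)) z)"
  unfolding \<Phi>_def by (rule pi.space.form_vsum_left) (auto intro: FT_key)

lemma \<Phi>_single: "\<lbrakk>a \<in> carrier A; v \<in> DH\<rbrakk> \<Longrightarrow> \<Phi> (Poly_Mapping.single (a, v) 1) = rep_op \<pi> a v"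
  using pi.op_in_carrier[OF _ sys_dom_closed(1)[OF H_coset]] by (simp add: \<Phi>_def vsum_def)

text \<open>Degrees outside \<open>H\<close> do not contribute to \<open>\<langle>\<pi>(a) v, w\<rangle>\<close> when \<open>v\<close> and \<open>w\<close> are in the range of
  \<open>E H\<close>, so that the form of the induced representation is the one of the ambient space.\<close>

lemma form_expectation:
  assumes b: "b \<in> carrier A" and v: "v \<in> DH" and w: "w \<in> DH"
  shows "cinner Hs (rep_op \<pi> (p b) v) w = cinner Hs (rep_op \<pi> b v) w"
proof -
  obtain q c where c: "q = p b" "q \<in> carrier A" "c \<in> part (carrier G - H)" "c \<in> carrier A" "b = q \<oplus> c"
    using split_H[OF b] by metis
  note d = sys_dom_closed[OF H_coset]
  have "cinner Hs (rep_op \<pi> c v) w = cinner Hs (E H (rep_op \<pi> c v)) w"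
    using E_facts(6)[OF H_coset pi.op_in_carrier[OF c(4) d(1)[OF v]] d(2)[OF w]] d(3)[OF w] by simp
  also have "\<dots> = 0" using E_op_part_compl[OF v c(3)] d(2)[OF w] by simp
  finally have "cinner Hs (rep_op \<pi> (q \<oplus> c) v) w = cinner Hs (rep_op \<pi> q v) w"
    using c(2,4) d(1)[OF v] d(2)[OF w] by (simp add: pi_add pi.space.form_add_left pi.op_in_carrier)
  then show ?thesis unfolding c(5)[symmetric] c(1)[symmetric] by (rule sym)
qed

lemma \<Phi>_form_hom: "form_hom R.FT Hs \<Phi>"
proof (rule form_homI[OF R.hermitian_FT pi.space.pre_hilbert_axioms])
  fix f g assume f: "f \<in> carrier R.FT" and g: "g \<in> carrier R.FT"
  note d = sys_dom_closed[OF H_coset]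
  have t: "R.tform k l = cinner Hs (rep_op \<pi> (fst k) (snd k)) (rep_op \<pi> (fst l) (snd l))"
    if k: "k \<in> Poly_Mapping.keys f" and l: "l \<in> Poly_Mapping.keys g" for k l
  proof -
    note kk = FT_key[OF f k] and ll = FT_key[OF g l]
    note sl = star_closed[OF ll(1)]
    have "R.tform k l = cinner Hs (rep_op \<pi> (star A (fst l) \<otimes> fst k) (snd k)) (snd l)"
      unfolding R.tform_def using form_expectation[of "star A (fst l) \<otimes> fst k" "snd k" "snd l"] kk ll sl by simp
    also have "\<dots> = cinner Hs (rep_op \<pi> (fst k) (snd k)) (rep_op \<pi> (fst l) (snd l))"
      using pi.op_mult[OF sl kk(1,3)] pi.op_adjoint[OF sl kk(4) ll(3)] star_star[OF ll(1)] by simp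
    finally show ?thesis .
  qed
  have "cinner Hs (\<Phi> f) (\<Phi> g) = lsum f (\<lambda>k. cinner Hs (rep_op \<pi> (fst k) (snd k)) (\<Phi> g))"
    by (rule form_\<Phi>_left[OF f \<Phi>_carrier[OF g]])
  also have "\<dots> = lsum f (\<lambda>k. cnj (lsum g (\<lambda>l. cnj (R.tform k l))))"
  proof (rule lsum_cong)
    fix k assume k: "k \<in> Poly_Mapping.keys f"
    note kk = FT_key[OF f k]
    have "cinner Hs (\<Phi> g) (rep_op \<pi> (fst k) (snd k)) = lsum g (\<lambda>l. cnj (R.tform k l))"
      unfolding form_\<Phi>_left[OF g kk(5)]
      using t[OF k] pi.space.form_commute[OF kk(5) FT_key(5)[OF g]] by (intro lsum_cong) simp
    then show "cinner Hs (rep_op \<pi> (fst k) (snd k)) (\<Phi> g) = cnj (lsum g (\<lambda>l. cnj (R.tform k l)))"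
      using pi.space.form_commute[OF \<Phi>_carrier[OF g] kk(5)] by simp
  qed
  also have "\<dots> = cinner R.FT f g" by (rule R.FT_form[symmetric])
  finally show "cinner Hs (\<Phi> f) (\<Phi> g) = cinner R.FT f g" .
qed (rule \<Phi>_carrier)

text \<open>A Gram form is nonnegative.\<close>

lemma inducible_\<rho>0: "inducible G H A \<A> \<rho>0"
  unfolding inducible_def
proof
  fix \<eta> assume "\<eta> \<in> carrier R.T"
  then obtain f where f: "f \<in> carrier R.FT" "\<eta> = R.ker +>\<^bsub>R.FT\<^esub> f"
    using R.tensor_map(2) by blast
  have "cinner R.T \<eta> \<eta> = cinner Hs (\<Phi> f) (\<Phi> f)"
    using form_homD(4)[OF R.tensor_map(1) f(1) f(1)] form_homD(4)[OF \<Phi>_form_hom f(1) f(1)] f(2) by simp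
  then show "cinner R.T \<eta> \<eta> \<in> \<real>\<^sub>\<ge>\<^sub>0"
    using pi.space.form_self[OF \<Phi>_carrier[OF f(1)]]
    by (simp only: nonneg_Reals_of_real_iff zero_le_power2)
qed

sublocale R: inducible_data G A \<A> H \<rho>0
  by unfold_locales (rule inducible_\<rho>0)

lemma \<Phi>_left_mult:
  assumes a: "a \<in> carrier A" and f: "f \<in> carrier R.FT"
  shows "\<Phi> (left_mult A a f) = rep_op \<pi> a (\<Phi> f)"
proof (rule pi.space.eq_by_form)
  note af = R.left_mult_in_FT[OF a f]
  show "\<Phi> (left_mult A a f) \<in> carrier Hs" "rep_op \<pi> a (\<Phi> f) \<in> carrier Hs"
    using \<Phi>_carrier[OF af] pi.op_in_carrier[OF a \<Phi>_dom[OF f]] by auto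
  fix z assume z: "z \<in> carrier Hs"
  have "rep_op \<pi> a (\<Phi> f) = vsum Hs f (\<lambda>k. rep_op \<pi> a (rep_op \<pi> (fst k) (snd k)))"
    unfolding \<Phi>_def by (rule pi.op_vsum[OF a]) (rule FT_key[OF f])
  then have "cinner Hs (rep_op \<pi> a (\<Phi> f)) z = lsum f (\<lambda>k. cinner Hs (rep_op \<pi> a (rep_op \<pi> (fst k) (snd k))) z)"
    using pi.op_in_carrier[OF a] FT_key(4)[OF f] z by (simp add: pi.space.form_vsum_left)
  also have "\<dots> = lsum f (\<lambda>k. cinner Hs (rep_op \<pi> (a \<otimes> fst k) (snd k)) z)"
    using pi.op_mult[OF a] FT_key[OF f] by (intro lsum_cong) simp
  also have "\<dots> = cinner Hs (\<Phi> (left_mult A a f)) z"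
    unfolding form_\<Phi>_left[OF af z] lsum_left_mult by (simp add: case_prod_unfold)
  finally show "cinner Hs (\<Phi> (left_mult A a f)) z = cinner Hs (rep_op \<pi> a (\<Phi> f)) z" by simp
qed

abbreviation D0 where "D0 \<equiv> \<Phi> ` carrier R.FT"

lemma D0_dom: "D0 \<subseteq> Dom"
  using \<Phi>_dom by blast

lemma D0_submodule: "submodule D0 complex_ring Hs"
proof (rule pi.space.submodule_criterion)
  note h = form_homD[OF \<Phi>_form_hom]
  show "D0 \<subseteq> carrier Hs" using \<Phi>_carrier by blast
  have "\<Phi> \<zero>\<^bsub>R.FT\<^esub> = \<zero>\<^bsub>Hs\<^esub>"
    using h(3)[OF R.FT.M.zero_closed, of 0] \<Phi>_carrier[OF R.FT.M.zero_closed] by simp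
  then show "\<zero>\<^bsub>Hs\<^esub> \<in> D0" using R.FT.M.zero_closed by (metis imageI)
  show "x \<oplus>\<^bsub>Hs\<^esub> y \<in> D0" if "x \<in> D0" "y \<in> D0" for x y
    using that by (auto simp flip: h(2) intro!: imageI)
  show "c \<odot>\<^bsub>Hs\<^esub> x \<in> D0" if "x \<in> D0" for c x
    using that by (auto simp flip: h(3) intro!: imageI)
qed

lemma op_DH_in_D0: "\<lbrakk>a \<in> carrier A; v \<in> DH\<rbrakk> \<Longrightarrow> rep_op \<pi> a v \<in> D0"
  using R.single_in_FT[of a v 1] by (simp flip: \<Phi>_single)

text \<open>The partial sums of \<open>\<Sum> E t \<phi>\<close> converge to \<open>\<phi>\<close> even in the graph topology, because a
  homogeneous operator only permutes the cosets that occur.\<close>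

lemma partial_sums_op:
  assumes \<phi>: "\<phi> \<in> Dom" and a: "a \<in> part (carrier G)" and \<epsilon>: "0 < \<epsilon>"
  shows "\<forall>\<^sub>F T in \<F>.
    hnorm Hs (rep_op \<pi> a (psum T \<phi>) \<ominus>\<^bsub>Hs\<^esub> rep_op \<pi> a \<phi>) < \<epsilon>"
  using order_refl a \<epsilon>
proof (induction arbitrary: \<epsilon> rule: part_induct)
  have sumD: "(psum T \<phi>) \<in> Dom" if "finite T" "T \<subseteq> cosets" for T
    using that E_dom[OF _ \<phi>] by (intro pi.space.submodule_finsum[OF pi.dom_subspace]) auto
  have ev: "\<forall>\<^sub>F T in \<F>. finite T \<and> T \<subseteq> cosets"
    by (rule eventually_finite_subsets_at_top_weakI) simp
  {
    case zero
    from ev show ?case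
    proof eventually_elim
      case (elim T)
      then show ?case using zero sumD[of T] \<phi> pi.space.minus_eq_zero_iff[of "\<zero>\<^bsub>Hs\<^esub>" "\<zero>\<^bsub>Hs\<^esub>"]
        by (simp add: pi_zero)
    qed
  next
    case (add g x b)
    have g: "g \<in> carrier G" using add(1) .
    note xp = pi.op_in_carrier[OF add(3) \<phi>]
    have "\<forall>\<^sub>F S in \<F>. (psum S (rep_op \<pi> x \<phi>)) \<in> carrier Hs \<and>
        hnorm Hs ((psum S (rep_op \<pi> x \<phi>)) \<ominus>\<^bsub>Hs\<^esub> rep_op \<pi> x \<phi>) < \<epsilon> / 2"
      using E_sum[OF xp] half_gt_zero[OF add.prems] unfolding pi.space.limitin_htopology_iff by blast
    then have "\<exists>S0. finite S0 \<and> S0 \<subseteq> cosets \<and> (\<forall>S. finite S \<and> S0 \<subseteq> S \<and> S \<subseteq> cosets \<longrightarrow>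
        (psum S (rep_op \<pi> x \<phi>)) \<in> carrier Hs \<and>
        hnorm Hs ((psum S (rep_op \<pi> x \<phi>)) \<ominus>\<^bsub>Hs\<^esub> rep_op \<pi> x \<phi>) < \<epsilon> / 2)"
      by (simp only: eventually_finite_subsets_at_top)
    then obtain S0 where S0: "finite S0" "S0 \<subseteq> cosets" and "\<forall>S. finite S \<and> S0 \<subseteq> S \<and> S \<subseteq> cosets \<longrightarrow>
        (psum S (rep_op \<pi> x \<phi>)) \<in> carrier Hs \<and>
        hnorm Hs ((psum S (rep_op \<pi> x \<phi>)) \<ominus>\<^bsub>Hs\<^esub> rep_op \<pi> x \<phi>) < \<epsilon> / 2"
      by (elim exE conjE)
    then have near: "hnorm Hs ((psum S (rep_op \<pi> x \<phi>)) \<ominus>\<^bsub>Hs\<^esub> rep_op \<pi> x \<phi>) < \<epsilon> / 2"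
      if "finite S" "S0 \<subseteq> S" "S \<subseteq> cosets" for S using that by blast
    let ?h = "\<lambda>t. g <#\<^bsub>G\<^esub> t" and ?h' = "\<lambda>t. inv\<^bsub>G\<^esub> g <#\<^bsub>G\<^esub> t"
    \<comment> \<open>The translate of \<open>T\<close> by \<open>g\<close> contains \<open>S0\<close> as soon as \<open>T\<close> contains the translate of \<open>S0\<close> back.\<close>
    have "\<forall>\<^sub>F T in \<F>. finite T \<and> ?h' ` S0 \<subseteq> T \<and> T \<subseteq> cosets"
      unfolding eventually_finite_subsets_at_top
      using S0(1,2) translate_coset[of "inv\<^bsub>G\<^esub> g"] g by (intro exI[of _ "?h' ` S0"]) auto
    moreover have "\<forall>\<^sub>F T in \<F>.
        hnorm Hs (rep_op \<pi> b (psum T \<phi>) \<ominus>\<^bsub>Hs\<^esub> rep_op \<pi> b \<phi>) < \<epsilon> / 2"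
      using add.IH[of "\<epsilon> / 2"] add.prems by simp
    ultimately show ?case
    proof eventually_elim
      case (elim T)
      then have T: "finite T" "T \<subseteq> cosets" "?h' ` S0 \<subseteq> T" by auto
      let ?s = "psum T \<phi>"
      note sD = sumD[OF T(1,2)]
      have inj: "inj_on ?h T"
        using translate_inverse(1)[OF g] T(2) by (intro inj_on_inverseI[of _ ?h']) auto
      have hT: "?h ` T \<subseteq> cosets" using T(2) translate_coset[OF g] by auto
      have sub: "S0 \<subseteq> ?h ` T"
      proof
        fix s assume "s \<in> S0"
        then have "?h' s \<in> T" "?h (?h' s) = s" using T(3) translate_inverse(2)[OF g] S0(2) by auto
        then show "s \<in> ?h ` T" by (metis imageI)
      qed
      have "rep_op \<pi> x ?s = (\<Oplus>\<^bsub>Hs\<^esub>t\<in>T. rep_op \<pi> x (E t \<phi>))"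
        by (rule linear_on_finsum[OF _ _ pi.dom_subspace pi.op_linear[OF add(3)] _ T(1)])
          (unfold_locales, use pi.op_in_carrier[OF add(3)] E_dom[OF _ \<phi>] T(2) in auto)
      also have "\<dots> = (\<Oplus>\<^bsub>Hs\<^esub>t\<in>T. E (?h t) (rep_op \<pi> x \<phi>))"
        using E_op[OF g _ add(2) \<phi>] E_facts(1)[OF _ xp] translate_coset[OF g] T(2)
        by (intro pi.space.finsum_cong') auto
      also have "\<dots> = (\<Oplus>\<^bsub>Hs\<^esub>s\<in>?h ` T. E s (rep_op \<pi> x \<phi>))"
        using E_facts(1)[OF _ xp] hT inj by (intro pi.space.finsum_reindex[symmetric]) auto
      finally have "hnorm Hs (rep_op \<pi> x ?s \<ominus>\<^bsub>Hs\<^esub> rep_op \<pi> x \<phi>) < \<epsilon> / 2"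
        using near[OF _ sub hT] T(1) by simp
      then show ?case
        using elim pi.space.hnorm_minus_add[of "rep_op \<pi> x ?s" "rep_op \<pi> b ?s" "rep_op \<pi> x \<phi>" "rep_op \<pi> b \<phi>"]
          pi.op_in_carrier[OF add(3)] pi.op_in_carrier[OF add(5)] sD \<phi> add(3,5)
        by (simp add: pi_add)
    qed
  }
qed

end

locale nondegenerate_imprimitivity = imprimitivity G A \<A> H \<pi> E
  for G :: "('g, 'm) monoid_scheme" and A :: "'a star_alg" (structure)
    and \<A> :: "'g \<Rightarrow> 'a set" and H :: "'g set" and \<pi> :: "('a, 'h) rep" and E :: "'g set \<Rightarrow> 'h \<Rightarrow> 'h" +
  assumes nondegenerate: "nondegenerate_system G H A \<A> \<pi> E"
begin

abbreviation gens where "gens t \<equiv> {rep_op \<pi> a \<phi> |a \<phi>. a \<in> part t \<and> \<phi> \<in> DH}"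

lemma gens_subset: "t \<in> cosets \<Longrightarrow> gens t \<subseteq> D0"
  using op_DH_in_D0 part_in_carrier[OF coset_subset] by blast

lemma gens_carrier: "t \<in> cosets \<Longrightarrow> gens t \<subseteq> carrier Hs"
  using gens_subset pi.space.submodule_facts(1)[OF D0_submodule] by blast

lemma sys_dom_closure:
  assumes "t \<in> cosets" "x \<in> sys_dom \<pi> E t"
  shows "x \<in> graph_topology A \<pi> closure_of lspan Hs (gens t)"
  using nondegenerate assms unfolding nondegenerate_system_def by blast

lemma sys_dom_approximable:
  assumes t: "t \<in> cosets" and x: "x \<in> sys_dom \<pi> E t"
  shows "graph_approximable A \<pi> (lspan Hs (gens t)) x"
  using pi.graph_closure_approximable(1)[OF sys_dom_closure[OF t x]] .

text \<open>Partial sums of \<open>\<Sum> E t \<phi>\<close> are close to \<open>\<phi>\<close>, and each summand is close to the span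
  of the \<open>\<pi>(a) v\<close> with \<open>a\<close> over \<open>t\<close> by nondegeneracy.\<close>

lemma D0_approximable:
  assumes \<phi>: "\<phi> \<in> Dom"
  shows "graph_approximable A \<pi> D0 \<phi>"
proof (rule pi.graph_approximable_trans[OF D0_dom \<phi>])
  fix Q :: "('a \<times> real) set" assume Q: "finite Q" "Q \<subseteq> carrier A \<times> {0<..}"
  have each: "graph_approximable A \<pi> D0 (E t \<phi>)" if t: "t \<in> cosets" for t
  proof -
    have "lspan Hs (gens t) \<subseteq> D0"
      using gens_subset[OF t] D0_submodule by (rule pi.space.lspan_minimal)
    then show ?thesis using sys_dom_approximable[OF t E_sys_dom[OF t \<phi>]]
      unfolding graph_approximable_def by (meson subsetD)
  qed
  have sums: "(psum T \<phi>) \<in> Dom \<and> graph_approximable A \<pi> D0 (psum T \<phi>)"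
    if "finite T" "T \<subseteq> cosets" for T
    using that
  proof (induction T)
    case empty
    then show ?case
      using pi.graph_approximable_self[OF pi.space.submodule_facts(2)[OF D0_submodule] D0_dom] pi.dom_facts(2) by simp
  next
    case (insert t T)
    have "(psum (insert t T) \<phi>) = E t \<phi> \<oplus>\<^bsub>Hs\<^esub> (psum T \<phi>)"
      using insert E_dom[OF _ \<phi>] pi.dom_facts(1) by (intro pi.space.finsum_insert) auto
    moreover have "E t \<phi> \<in> Dom" "graph_approximable A \<pi> D0 (E t \<phi>)" using insert E_dom[OF _ \<phi>] each by auto
    ultimately show ?case
      using insert pi.graph_approximable_add[OF D0_dom pi.space.submodule_facts(3)[OF D0_submodule]] pi.dom_facts(3)
      by simp
  qed
  have "\<forall>\<^sub>F T in \<F>. \<forall>q\<in>Q.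
      graph_norm \<pi> (fst q) ((psum T \<phi>) \<ominus>\<^bsub>Hs\<^esub> \<phi>) < snd q"
  proof (rule eventually_ball_finite[OF Q(1)], rule ballI)
    fix q assume "q \<in> Q"
    then have q: "fst q \<in> carrier A" "0 < snd q / 2" using Q(2) by auto
    have "\<forall>\<^sub>F T in \<F>. (psum T \<phi>) \<in> carrier Hs \<and>
        hnorm Hs ((psum T \<phi>) \<ominus>\<^bsub>Hs\<^esub> \<phi>) < snd q / 2"
      using E_sum[OF pi.dom_facts(1)[OF \<phi>]] q(2) unfolding pi.space.limitin_htopology_iff by blast
    then have "\<forall>\<^sub>F T in \<F>. hnorm Hs ((psum T \<phi>) \<ominus>\<^bsub>Hs\<^esub> \<phi>) < snd q / 2"
      by eventually_elim (rule conjunct2)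
    moreover have "\<forall>\<^sub>F T in \<F>.
        hnorm Hs (rep_op \<pi> (fst q) (psum T \<phi>) \<ominus>\<^bsub>Hs\<^esub> rep_op \<pi> (fst q) \<phi>) < snd q / 2"
      using q by (intro partial_sums_op[OF \<phi>]) (simp_all add: carrier_eq_part)
    moreover have "\<forall>\<^sub>F T in \<F>. finite T \<and> T \<subseteq> cosets"
      by (rule eventually_finite_subsets_at_top_weakI) simp
    ultimately show "\<forall>\<^sub>F T in \<F>.
        graph_norm \<pi> (fst q) ((psum T \<phi>) \<ominus>\<^bsub>Hs\<^esub> \<phi>) < snd q"
    proof eventually_elim
      case (elim T)
      then show ?case using sums[of T] q(1) \<phi> by (simp add: pi.graph_norm_minus)
    qed
  qed
  moreover have "\<forall>\<^sub>F T in \<F>. finite T \<and> T \<subseteq> cosets"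
    by (rule eventually_finite_subsets_at_top_weakI) simp
  ultimately have "\<forall>\<^sub>F T in \<F>. (finite T \<and> T \<subseteq> cosets) \<and> (\<forall>q\<in>Q.
      graph_norm \<pi> (fst q) ((psum T \<phi>) \<ominus>\<^bsub>Hs\<^esub> \<phi>) < snd q)"
    by eventually_elim blast
  from eventually_happens'[OF finite_subsets_at_top_neq_bot this]
  obtain T where T: "finite T" "T \<subseteq> cosets"
      "\<forall>q\<in>Q. graph_norm \<pi> (fst q) ((psum T \<phi>) \<ominus>\<^bsub>Hs\<^esub> \<phi>) < snd q"
    by (elim exE conjE)
  show "\<exists>y\<in>Dom. graph_approximable A \<pi> D0 y \<and> (\<forall>(a, \<epsilon>)\<in>Q. graph_norm \<pi> a (y \<ominus>\<^bsub>Hs\<^esub> \<phi>) < \<epsilon>)"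
    using sums[OF T(1,2)] T(3) by (intro bexI[of _ "psum T \<phi>"]) auto
qed

lemma approximable_norm:
  assumes "graph_approximable A \<pi> S x" "x \<in> Dom" "S \<subseteq> Dom" "0 < \<epsilon>"
  obtains y where "y \<in> S" "hnorm Hs (x \<ominus>\<^bsub>Hs\<^esub> y) < \<epsilon>"
proof -
  have "finite {(\<one>, \<epsilon>)}" "{(\<one>, \<epsilon>)} \<subseteq> carrier A \<times> {0<..}" using assms(4) by auto
  then obtain y where y: "y \<in> S" "graph_norm \<pi> \<one> (y \<ominus>\<^bsub>Hs\<^esub> x) < \<epsilon>"
    using pi.graph_approximableE[OF assms(1)] by (metis singletonI)
  have yD: "y \<in> Dom" using y(1) assms(3) by blast
  have "hnorm Hs (y \<ominus>\<^bsub>Hs\<^esub> x) \<le> graph_norm \<pi> \<one> (y \<ominus>\<^bsub>Hs\<^esub> x)"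
    using pi.op_in_carrier[OF one_closed pi.dom_facts(5)[OF yD assms(2)]] by (simp add: graph_norm_def)
  then show ?thesis
    using that[OF y(1)] y(2) pi.space.hnorm_minus_commute[of x y] pi.dom_facts(1) assms(2) yD by simp
qed

lemma dom_near:
  assumes "x \<in> carrier Hs" "0 < \<epsilon>"
  obtains \<phi> where "\<phi> \<in> Dom" "hnorm Hs (x \<ominus>\<^bsub>Hs\<^esub> \<phi>) < \<epsilon>"
proof -
  have "Dom \<subseteq> carrier Hs" using pi.dom_facts(1) by blast
  then show ?thesis using that pi.dom_dense pi.space.closure_htopology_iff[of Dom x] assms by auto
qed

lemma D0_dense: "htopology Hs closure_of D0 = carrier Hs"
proof -
  have D0H: "D0 \<subseteq> carrier Hs" using pi.space.submodule_facts(1)[OF D0_submodule] .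
  have "\<exists>y\<in>D0. hnorm Hs (x \<ominus>\<^bsub>Hs\<^esub> y) < \<epsilon>" if x: "x \<in> carrier Hs" and \<epsilon>: "0 < \<epsilon>" for x \<epsilon>
  proof -
    obtain \<phi> where \<phi>: "\<phi> \<in> Dom" "hnorm Hs (x \<ominus>\<^bsub>Hs\<^esub> \<phi>) < \<epsilon> / 2" using dom_near[OF x, of "\<epsilon> / 2"] \<epsilon> by auto
    obtain y where y: "y \<in> D0" "hnorm Hs (\<phi> \<ominus>\<^bsub>Hs\<^esub> y) < \<epsilon> / 2"
      using approximable_norm[OF D0_approximable[OF \<phi>(1)] \<phi>(1) D0_dom, of "\<epsilon> / 2"] \<epsilon> by auto
    have "y \<in> carrier Hs" using y(1) D0H by blast
    then show ?thesis
      using pi.space.hnorm_minus_triangle[OF x pi.dom_facts(1)[OF \<phi>(1)], of y] \<phi>(2) y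
      by (intro bexI[OF _ y(1)]) simp
  qed
  then show ?thesis using pi.space.closure_htopology_iff[OF D0H] by blast
qed

text \<open>The inverse of the isometry from the completed induced space onto the space of \<open>\<pi>\<close>
  is the required unitary.  It carries the range of \<open>E t\<close> onto the closed span of the tensors
  \<open>a \<otimes> v\<close> with \<open>a\<close> over \<open>t\<close>, so it intertwines the projections.\<close>

lemma induces: "induces_system G H A \<A> \<pi> E \<rho>0"
proof -
  obtain W where W: "form_hom R.C Hs W" "W ` carrier R.C = carrier Hs"
    "\<And>f. f \<in> carrier R.FT \<Longrightarrow> W (R.\<iota> f) = \<Phi> f"
    using R.induced_space_universal[OF pi.hilbert_space \<Phi>_form_hom D0_dense] by blast
  define U where "U = inv_into (carrier R.C) W"
  note inv = form_hom_inverse[OF W(1) R.C.pre_hilbert_axioms W(2), folded U_def]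
  note U = inv(1) and Uonto = inv(2)
  have U\<Phi>: "U (\<Phi> f) = R.\<iota> f" if f: "f \<in> carrier R.FT" for f
    using inv(3)[OF R.\<iota>_simps(1)[OF f]] W(3)[OF f] by simp
  have UC: "U x \<in> carrier R.C" if "x \<in> carrier Hs" for x using form_homD(1)[OF U that] .
  have Umin: "U x \<ominus>\<^bsub>R.C\<^esub> U y = U (x \<ominus>\<^bsub>Hs\<^esub> y)" if "x \<in> carrier Hs" "y \<in> carrier Hs" for x y
    by (rule form_hom_minus[OF U _ _ that, symmetric]) unfold_locales
  have ne: "carrier A \<noteq> {}" by auto
  have pre: "rep_dom R.pre = U ` D0"
    unfolding R.pre_simps image_image using U\<Phi> by (intro image_cong) simp_all
  have opU: "rep_op R.pre a (U \<phi>) = U (rep_op \<pi> a \<phi>)" if a: "a \<in> carrier A" and \<phi>: "\<phi> \<in> D0" for a \<phi>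
  proof -
    obtain f where f: "f \<in> carrier R.FT" "\<phi> = \<Phi> f" using \<phi> by blast
    then show ?thesis
      using R.pre_op[OF a f(1)] U\<Phi>[OF f(1)] U\<Phi>[OF R.left_mult_in_FT[OF a f(1)]] \<Phi>_left_mult[OF a f(1)] by simp
  qed
  let ?I = "induced_rep G H A \<A> \<rho>0"
  note prems = R.C.pre_hilbert_axioms U Uonto D0_dom pre opU D0_submodule D0_approximable
  have T: "rep_dom ?I = U ` Dom"
    unfolding induced_rep_def
    by (rule rep_closure_transport(1)[OF pi.star_rep_axioms ne closed], unfold R.pre_simps(1))
      (assumption | rule prems)+
  have T': "rep_op ?I a (U \<phi>) = U (rep_op \<pi> a \<phi>)" if "a \<in> carrier A" "\<phi> \<in> Dom" for a \<phi>
    unfolding induced_rep_def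
    by (rule rep_closure_transport(2)[OF pi.star_rep_axioms ne closed], unfold R.pre_simps(1))
      (assumption | rule prems that)+
  have IC: "rep_space ?I = R.C" by (simp add: induced_rep_def rep_closure_def R.pre_simps)
  have injU: "inj_on U (carrier Hs)" by (rule form_hom_inj[OF U pi.space.pre_hilbert_axioms])
  have injD: "inj_on U Dom" using injU pi.dom_facts(1) by (meson inj_on_subset subsetI)
  have "implements_equivalence A \<pi> ?I U"
    unfolding implements_equivalence_def isometry_onto_def IC
  proof (intro conjI ballI)
    show "linear_on Dom Hs R.C U"
      using form_homD(2,3)[OF U] pi.dom_facts(1) by (simp add: linear_on_def)
    show "hnorm R.C (U x) = hnorm Hs x" if "x \<in> Dom" for x using form_homD(5)[OF U] pi.dom_facts(1) that by blast
    show "U ` Dom = rep_dom ?I" using T by simp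
    fix a \<psi> assume a: "a \<in> carrier A" and "\<psi> \<in> rep_dom ?I"
    then obtain \<phi> where \<phi>: "\<phi> \<in> Dom" "\<psi> = U \<phi>" using T by auto
    then show "rep_op ?I a \<psi> = U (rep_op \<pi> a (inv_into Dom U \<psi>))"
      using T'[OF a] inv_into_f_f[OF injD] by simp
  qed
  moreover have "isometry_onto Hs (carrier Hs) (rep_space ?I) (carrier (rep_space ?I)) U"
    using U Uonto form_homD(5)[OF U] by (simp add: isometry_onto_def IC form_hom_def)
  moreover have "U (E t x) = induced_projection G H A \<A> \<rho>0 t (U x)" if t: "t \<in> cosets" and x: "x \<in> carrier Hs" for t x
  proof -
    let ?g = "{R.\<iota> (Poly_Mapping.single (a, v) 1) |a v. a \<in> part t \<and> v \<in> DH}"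
    let ?M = "htopology R.C closure_of lspan R.C ?g"
    have tA: "a \<in> carrier A" if "a \<in> part t" for a using part_in_carrier[OF coset_subset[OF t] that] .
    have gen: "R.\<iota> (Poly_Mapping.single (a, v) 1) = U (rep_op \<pi> a v)" if "a \<in> part t" "v \<in> DH" for a v
      using U\<Phi>[OF R.single_in_FT[of a v 1]] \<Phi>_single[of a v] tA that by simp
    have gC: "?g \<subseteq> carrier R.C"
    proof
      fix z assume "z \<in> ?g"
      then obtain a v where av: "a \<in> part t" "v \<in> DH" "z = R.\<iota> (Poly_Mapping.single (a, v) 1)" by blast
      have "rep_op \<pi> a v \<in> carrier Hs" using sys_dom_closed(2)[OF t op_coset_sys_dom[OF t av(2,1)]] .
      then show "z \<in> carrier R.C" using UC gen[OF av(1,2)] av(3) by simp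
    qed
    note M = R.C.closure_span_facts[OF gC]
    have spanU: "lspan Hs (gens t) \<subseteq> {y \<in> carrier Hs. U y \<in> lspan R.C ?g}"
    proof (rule pi.space.lspan_minimal)
      note sp = R.C.submodule_facts[OF R.C.lspan_submodule[OF gC]]
      have "U \<zero>\<^bsub>Hs\<^esub> = \<zero>\<^bsub>R.C\<^esub>"
        using form_homD(3)[OF U pi.space.M.zero_closed, of 0] UC[OF pi.space.M.zero_closed] by simp
      then show "submodule {y \<in> carrier Hs. U y \<in> lspan R.C ?g} complex_ring Hs"
        by (intro pi.space.submodule_criterion) (auto simp: form_homD(2,3)[OF U] sp)
      show "gens t \<subseteq> {y \<in> carrier Hs. U y \<in> lspan R.C ?g}"
      proof
        fix y assume y: "y \<in> gens t"
        then obtain a v where av: "a \<in> part t" "v \<in> DH" "y = rep_op \<pi> a v" by blast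
        then have "U y \<in> ?g" using gen[OF av(1,2)] by (metis (mono_tags, lifting) mem_Collect_eq)
        then have "U y \<in> lspan R.C ?g" using R.C.lspan_superset by (rule subsetD[rotated])
        then show "y \<in> {y \<in> carrier Hs. U y \<in> lspan R.C ?g}" using y gens_carrier[OF t] by blast
      qed
    qed
    have Ex: "E t x \<in> carrier Hs" using E_facts(1)[OF t x] .
    \<comment> \<open>Approximate \<open>x\<close> by a vector of the domain, apply \<open>E t\<close>, and use nondegeneracy.\<close>
    have "U (E t x) \<in> ?M"
      unfolding R.C.closure_htopology_iff[OF M(1)]
    proof (intro conjI allI impI UC Ex)
      fix \<epsilon> :: real assume \<epsilon>: "0 < \<epsilon>"
      obtain \<phi> where \<phi>: "\<phi> \<in> Dom" "hnorm Hs (x \<ominus>\<^bsub>Hs\<^esub> \<phi>) < \<epsilon> / 2" using dom_near[OF x, of "\<epsilon> / 2"] \<epsilon> by auto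
      note \<phi>H = pi.dom_facts(1)[OF \<phi>(1)]
      note E\<phi> = E_sys_dom[OF t \<phi>(1)]
      have "lspan Hs (gens t) \<subseteq> Dom"
        using pi.space.lspan_minimal[OF gens_subset[OF t] D0_submodule] D0_dom by blast
      then obtain y where y: "y \<in> lspan Hs (gens t)" "hnorm Hs (E t \<phi> \<ominus>\<^bsub>Hs\<^esub> y) < \<epsilon> / 2"
        using approximable_norm[OF sys_dom_approximable[OF t E\<phi>] sys_dom_closed(1)[OF t E\<phi>], of "\<epsilon> / 2"] \<epsilon> by auto
      have yH: "y \<in> carrier Hs" "U y \<in> lspan R.C ?g" using y(1) spanU by auto
      have "hnorm Hs (E t x \<ominus>\<^bsub>Hs\<^esub> y) \<le> hnorm Hs (E t x \<ominus>\<^bsub>Hs\<^esub> E t \<phi>) + hnorm Hs (E t \<phi> \<ominus>\<^bsub>Hs\<^esub> y)"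
        using Ex sys_dom_closed(2)[OF t E\<phi>] yH(1) by (rule pi.space.hnorm_minus_triangle)
      also have "hnorm Hs (E t x \<ominus>\<^bsub>Hs\<^esub> E t \<phi>) \<le> hnorm Hs (x \<ominus>\<^bsub>Hs\<^esub> \<phi>)"
        using E_norm_le[OF t, of "x \<ominus>\<^bsub>Hs\<^esub> \<phi>"] E_facts(4)[OF t x \<phi>H] x \<phi>H by simp
      finally have "hnorm Hs (E t x \<ominus>\<^bsub>Hs\<^esub> y) < \<epsilon>" using \<phi>(2) y(2) by simp
      then show "\<exists>z\<in>lspan R.C ?g. hnorm R.C (U (E t x) \<ominus>\<^bsub>R.C\<^esub> z) < \<epsilon>"
        using Umin[OF Ex yH(1)] form_homD(5)[OF U, of "E t x \<ominus>\<^bsub>Hs\<^esub> y"] Ex yH by (intro bexI[OF _ yH(2)]) simp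
    qed
    moreover have "cinner R.C (U x \<ominus>\<^bsub>R.C\<^esub> U (E t x)) z = 0" if z: "z \<in> ?M" for z
    proof (rule R.C.orthogonal_closure_span[OF gC _ _ z])
      show "U x \<ominus>\<^bsub>R.C\<^esub> U (E t x) \<in> carrier R.C" using UC x Ex by simp
      fix w assume "w \<in> ?g"
      then obtain a v where av: "a \<in> part t" "v \<in> DH" "w = R.\<iota> (Poly_Mapping.single (a, v) 1)" by blast
      then have wU: "w = U (rep_op \<pi> a v)" using gen by simp
      have y: "rep_op \<pi> a v \<in> carrier Hs" "E t (rep_op \<pi> a v) = rep_op \<pi> a v"
        using sys_dom_closed(2,3)[OF t op_coset_sys_dom[OF t av(2,1)]] by auto
      have "cinner R.C (U x \<ominus>\<^bsub>R.C\<^esub> U (E t x)) w = cinner Hs (x \<ominus>\<^bsub>Hs\<^esub> E t x) (rep_op \<pi> a v)"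
        using Umin[OF x Ex] form_homD(4)[OF U _ y(1), of "x \<ominus>\<^bsub>Hs\<^esub> E t x"] x Ex wU by simp
      also have "\<dots> = 0"
        using E_facts(6)[OF t x y(1)] y x Ex by (simp add: pi.space.form_minus_left)
      finally show "cinner R.C (U x \<ominus>\<^bsub>R.C\<^esub> U (E t x)) w = 0" .
    qed
    ultimately have "orth_proj R.C ?M (U x) = U (E t x)"
      by (intro R.C.orth_proj_eq UC x M(2)) auto
    then show ?thesis by (simp add: induced_projection_def IC Let_def)
  qed
  ultimately have "systems_equivalent G H A \<pi> E ?I (induced_projection G H A \<A> \<rho>0)"
    unfolding systems_equivalent_def by blast
  then show ?thesis
    using star_rep_\<rho>0 closed_\<rho>0 inducible_\<rho>0 by (simp add: induces_system_def)
qed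

end

section \<open>Closability of the induced operators\<close>

text \<open>If \<open>n \<ge> e\<close>, then \<open>n (n - e / 2) \<ge> e\<^sup>2 / 2\<close>.\<close>

lemma quadratic_bound:
  fixes e n :: real
  assumes "0 < e" "n\<^sup>2 \<le> n * (e / 2) + e\<^sup>2 / 4"
  shows "n < e"
proof (rule ccontr)
  assume "\<not> n < e"
  then have "e * (e / 2) \<le> n * (n - e / 2)" using assms(1) by (intro mult_mono) auto
  moreover have "n * (n - e / 2) = n\<^sup>2 - n * (e / 2)" by (simp add: power2_eq_square right_diff_distrib)
  moreover have "e * (e / 2) = e\<^sup>2 / 2" by (simp add: power2_eq_square)
  moreover have "0 < e\<^sup>2" using assms(1) by simp
  ultimately show False using assms(2) by linarith
qed

context inducible_data begin

lemma range_\<iota>_submodule: "submodule (pdom) complex_ring C"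
proof (rule C.submodule_criterion)
  show "pdom \<subseteq> carrier C" using \<iota>_simps(1) by blast
  have "\<iota> \<zero>\<^bsub>FT\<^esub> = \<zero>\<^bsub>C\<^esub>"
    using \<iota>_simps(3)[OF FT.M.zero_closed, of 0] \<iota>_simps(1)[OF FT.M.zero_closed] by simp
  then show "\<zero>\<^bsub>C\<^esub> \<in> pdom" using FT.M.zero_closed by (metis imageI)
  show "x \<oplus>\<^bsub>C\<^esub> y \<in> pdom" if "x \<in> pdom" "y \<in> pdom" for x y
    using that by (auto simp flip: \<iota>_simps(2) intro!: imageI)
  show "c \<odot>\<^bsub>C\<^esub> x \<in> pdom" if "x \<in> pdom" for c x
    using that by (auto simp flip: \<iota>_simps(3) intro!: imageI)
qed

lemmas range_facts = C.submodule_facts[OF range_\<iota>_submodule]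

lemma range_carrier: "x \<in> pdom \<Longrightarrow> x \<in> carrier C"
  using range_facts(1) by blast

text \<open>Their difference lies in the range as well.\<close>

lemma range_eqI:
  assumes x: "x \<in> pdom" and y: "y \<in> pdom"
    and eq: "\<And>h. h \<in> carrier FT \<Longrightarrow> cinner C x (\<iota> h) = cinner C y (\<iota> h)"
  shows "x = y"
proof -
  obtain h where h: "h \<in> carrier FT" "x \<ominus>\<^bsub>C\<^esub> y = \<iota> h" using range_facts(5)[OF x y] by blast
  have "cinner C (x \<ominus>\<^bsub>C\<^esub> y) (\<iota> h) = 0"
    using eq[OF h(1)] range_carrier[OF x] range_carrier[OF y] \<iota>_simps(1)[OF h(1)]
    by (simp add: C.form_minus_left)
  then have "cinner C (x \<ominus>\<^bsub>C\<^esub> y) (x \<ominus>\<^bsub>C\<^esub> y) = 0" using h(2) by simp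
  then have "x \<ominus>\<^bsub>C\<^esub> y = \<zero>\<^bsub>C\<^esub>" using range_carrier[OF x] range_carrier[OF y] by (intro C.cinner_definite) auto
  then show ?thesis using range_carrier[OF x] range_carrier[OF y] by (simp add: C.minus_eq_zero_iff)
qed

lemma pre_closed:
  assumes "a \<in> carrier A" "x \<in> pdom"
  shows "rep_op pre a x \<in> pdom"
  using assms pre_op left_mult_in_FT by force

lemma pre_adjoint:
  assumes a: "a \<in> carrier A" and x: "x \<in> pdom" and y: "y \<in> pdom"
  shows "cinner C (rep_op pre a x) y = cinner C x (rep_op pre (star A a) y)"
proof -
  obtain f where f: "f \<in> carrier FT" "x = \<iota> f" using x by blast
  obtain g where g: "g \<in> carrier FT" "y = \<iota> g" using y by blast
  show ?thesis
    using left_mult_adjoint[OF a f(1) g(1)] left_mult_in_FT[OF a f(1)] left_mult_in_FT[OF star_closed[OF a] g(1)]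
      pre_op[OF a f(1)] pre_op[OF star_closed[OF a] g(1)] f g by (simp add: \<iota>_simps)
qed

lemma pre_minus:
  assumes a: "a \<in> carrier A" and x: "x \<in> pdom" and y: "y \<in> pdom"
  shows "rep_op pre a (x \<ominus>\<^bsub>C\<^esub> y) = rep_op pre a x \<ominus>\<^bsub>C\<^esub> rep_op pre a y"
proof (rule range_eqI)
  note xy = range_facts(5)[OF x y]
  show "rep_op pre a (x \<ominus>\<^bsub>C\<^esub> y) \<in> pdom" using pre_closed[OF a xy] .
  show "rep_op pre a x \<ominus>\<^bsub>C\<^esub> rep_op pre a y \<in> pdom"
    using range_facts(5)[OF pre_closed[OF a x] pre_closed[OF a y]] .
  fix h assume "h \<in> carrier FT"
  then have h: "\<iota> h \<in> pdom" by blast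
  show "cinner C (rep_op pre a (x \<ominus>\<^bsub>C\<^esub> y)) (\<iota> h) = cinner C (rep_op pre a x \<ominus>\<^bsub>C\<^esub> rep_op pre a y) (\<iota> h)"
    using pre_adjoint[OF a xy h] pre_adjoint[OF a x h] pre_adjoint[OF a y h]
      range_carrier[OF x] range_carrier[OF y] range_carrier[OF h] range_carrier[OF pre_closed[OF star_closed[OF a] h]]
      range_carrier[OF pre_closed[OF a x]] range_carrier[OF pre_closed[OF a y]]
    by (simp add: C.form_minus_left)
qed

text \<open>The operators are closable: along a Cauchy filter converging to \<open>x0\<close>, the vectors
  \<open>z = a (x - x0)\<close> form a Cauchy filter that tends to zero weakly on the domain, and
  \<open>\<parallel>z\<parallel>\<^sup>2 = \<langle>z, z - z'\<rangle> + \<langle>z, z'\<rangle>\<close> for a fixed late \<open>z'\<close>.\<close>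

lemma pre_closable:
  assumes F: "graph_cauchy A pre F" and x0: "x0 \<in> pdom"
    and lim: "limitin (htopology C) (\<lambda>x. x) x0 F" and a: "a \<in> carrier A"
  shows "limitin (htopology C) (rep_op pre a) (rep_op pre a x0) F"
  unfolding C.limitin_htopology_iff
proof (intro conjI allI impI)
  let ?z = "\<lambda>x. rep_op pre a x \<ominus>\<^bsub>C\<^esub> rep_op pre a x0"
  have zr: "?z x \<in> pdom" if "x \<in> pdom" for x
    using range_facts(5)[OF pre_closed[OF a that] pre_closed[OF a x0]] .
  show "rep_op pre a x0 \<in> carrier C" using range_carrier[OF pre_closed[OF a x0]] .
  fix e :: real assume e: "0 < e"
  obtain Q where Q: "eventually Q F" "\<And>x y. \<lbrakk>Q x; Q y\<rbrakk> \<Longrightarrow> graph_norm pre a (x \<ominus>\<^bsub>C\<^esub> y) < e / 2"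
    using F a half_gt_zero[OF e] unfolding graph_cauchy_iff pre_simps by meson
  have dom: "\<forall>\<^sub>F x in F. x \<in> pdom" and nb: "F \<noteq> bot"
    using F by (simp_all add: graph_cauchy_iff pre_simps)
  have "\<forall>\<^sub>F x in F. Q x \<and> x \<in> pdom" using Q(1) dom by (rule eventually_conj)
  then obtain y where y: "Q y" "y \<in> pdom" using eventually_happens'[OF nb] by blast
  let ?u = "rep_op pre (star A a) (?z y)"
  have ur: "?u \<in> pdom" using pre_closed[OF star_closed[OF a] zr[OF y(2)]] .
  note uC = range_carrier[OF ur]
  have pos: "0 < e\<^sup>2 / 4 / (hnorm C ?u + 1)" using e uC by (simp add: add_nonneg_pos)
  have near: "\<forall>\<^sub>F x in F. x \<in> carrier C \<and> hnorm C (x \<ominus>\<^bsub>C\<^esub> x0) < e\<^sup>2 / 4 / (hnorm C ?u + 1)"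
    using lim pos unfolding C.limitin_htopology_iff by blast
  from Q(1) dom near show "\<forall>\<^sub>F x in F. rep_op pre a x \<in> carrier C \<and> hnorm C (?z x) < e"
  proof eventually_elim
    case (elim x)
    note xr = elim(2)
    note zx = range_carrier[OF zr[OF xr]] and zy = range_carrier[OF zr[OF y(2)]]
    note c = range_carrier[OF xr] range_carrier[OF x0] range_carrier[OF y(2)]
      range_carrier[OF pre_closed[OF a xr]] range_carrier[OF pre_closed[OF a y(2)]] range_carrier[OF pre_closed[OF a x0]]
    have "hnorm C (?z x \<ominus>\<^bsub>C\<^esub> ?z y) = hnorm C (rep_op pre a x \<ominus>\<^bsub>C\<^esub> rep_op pre a y)"
      using c by (intro C.hnorm_eq_by_form) (auto simp: C.form_simps)
    also have "\<dots> \<le> graph_norm pre a (x \<ominus>\<^bsub>C\<^esub> y)"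
      using c unfolding graph_norm_def pre_minus[OF a xr y(2)] pre_simps(1) by simp
    finally have d1: "hnorm C (?z x \<ominus>\<^bsub>C\<^esub> ?z y) < e / 2" using Q(2)[OF elim(1) y(1)] by simp
    have "cinner C (?z x) (?z y) = cinner C (x \<ominus>\<^bsub>C\<^esub> x0) ?u"
      using pre_adjoint[OF a range_facts(5)[OF xr x0] zr[OF y(2)]] pre_minus[OF a xr x0] by simp
    then have "cmod (cinner C (?z x) (?z y)) \<le> hnorm C (x \<ominus>\<^bsub>C\<^esub> x0) * hnorm C ?u"
      using C.Cauchy_Schwarz[of "x \<ominus>\<^bsub>C\<^esub> x0" ?u] c uC by simp
    also have "\<dots> \<le> e\<^sup>2 / 4 / (hnorm C ?u + 1) * (hnorm C ?u + 1)"
      using elim(3) uC c pos by (intro mult_mono) auto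
    also have "\<dots> = e\<^sup>2 / 4"
      using add_nonneg_pos[OF C.hnorm_nonneg[OF uC], of 1] by (metis less_irrefl nonzero_divide_eq_eq zero_less_one)
    finally have d2: "cmod (cinner C (?z x) (?z y)) \<le> e\<^sup>2 / 4" .
    have "(hnorm C (?z x))\<^sup>2 = Re (cinner C (?z x) (?z x \<ominus>\<^bsub>C\<^esub> ?z y) + cinner C (?z x) (?z y))"
      using zx zy by (simp add: C.hnorm_sq C.form_minus_right)
    also have "\<dots> \<le> cmod (cinner C (?z x) (?z x \<ominus>\<^bsub>C\<^esub> ?z y)) + cmod (cinner C (?z x) (?z y))"
      using complex_Re_le_cmod norm_triangle_ineq order_trans by blast
    also have "\<dots> \<le> hnorm C (?z x) * hnorm C (?z x \<ominus>\<^bsub>C\<^esub> ?z y) + e\<^sup>2 / 4"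
      using C.Cauchy_Schwarz[OF zx, of "?z x \<ominus>\<^bsub>C\<^esub> ?z y"] zx zy d2 by simp
    also have "\<dots> \<le> hnorm C (?z x) * (e / 2) + e\<^sup>2 / 4"
      using d1 zx by (intro add_right_mono mult_left_mono) auto
    finally have sq: "(hnorm C (?z x))\<^sup>2 \<le> hnorm C (?z x) * (e / 2) + e\<^sup>2 / 4" .
    with e have "hnorm C (?z x) < e" by (rule quadratic_bound)
    then show ?case using c by simp
  qed
qed

abbreviation Ind where "Ind \<equiv> induced_rep G H A \<A> \<rho>"

lemma Ind_space: "rep_space Ind = C"
  by (simp add: induced_rep_def rep_closure_def pre_simps)

lemma Ind_domE:
  assumes "x \<in> rep_dom Ind"
  obtains F where "graph_cauchy A pre F" "limitin (htopology C) (\<lambda>x. x) x F"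
  using assms by (auto simp: induced_rep_def rep_closure_def pre_simps)

text \<open>Constant filters show that the closure extends the original representation.\<close>

lemma constant_filter:
  assumes x: "x \<in> pdom"
  shows "graph_cauchy A pre (principal {x})" "limitin (htopology C) (\<lambda>x. x) x (principal {x})"
proof -
  have 0: "x \<ominus>\<^bsub>C\<^esub> x = \<zero>\<^bsub>C\<^esub>" "rep_op pre a x \<ominus>\<^bsub>C\<^esub> rep_op pre a x = \<zero>\<^bsub>C\<^esub>" if "a \<in> carrier A" for a
    using C.minus_eq_zero_iff range_carrier[OF x] range_carrier[OF pre_closed[OF that x]] by blast+
  have gn: "graph_norm pre a (x \<ominus>\<^bsub>C\<^esub> x) = 0" if "a \<in> carrier A" for a
    unfolding graph_norm_def pre_simps(1) trans[OF pre_minus[OF that x x] 0(2)[OF that]]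
    by (simp only: 0(1)[OF that] C.hnorm_zero add_0)
  show "graph_cauchy A pre (principal {x})"
    unfolding graph_cauchy_iff pre_simps
  proof (intro conjI ballI allI impI)
    fix a and \<epsilon> :: real assume "a \<in> carrier A" "0 < \<epsilon>"
    then have "graph_norm pre a (x \<ominus>\<^bsub>C\<^esub> x) < \<epsilon>" using gn[of a] by linarith
    then show "\<exists>Q. eventually Q (principal {x}) \<and> (\<forall>y z. Q y \<longrightarrow> Q z \<longrightarrow> graph_norm pre a (y \<ominus>\<^bsub>C\<^esub> z) < \<epsilon>)"
      by (intro exI[of _ "\<lambda>y. y = x"]) (auto simp only: eventually_principal)
  qed (use x in \<open>simp_all add: eventually_principal principal_eq_bot_iff\<close>)
  show "limitin (htopology C) (\<lambda>x. x) x (principal {x})"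
    unfolding C.limitin_htopology_iff using range_carrier[OF x] 0(1)[OF one_closed]
    by (simp add: eventually_principal)
qed

lemma Ind_extends_pre:
  assumes x: "x \<in> pdom"
  shows "x \<in> rep_dom Ind" "a \<in> carrier A \<Longrightarrow> rep_op Ind a x = rep_op pre a x"
proof -
  show "x \<in> rep_dom Ind"
    using constant_filter[OF x] by (auto simp: induced_rep_def rep_closure_def pre_simps)
  assume a: "a \<in> carrier A"
  have nb: "principal {x} \<noteq> bot" by (simp add: principal_eq_bot_iff)
  show "rep_op Ind a x = rep_op pre a x"
    unfolding induced_rep_def rep_closure_def rep.select_convs pre_simps(1)
  proof (rule the_equality)
    show "\<forall>F. graph_cauchy A pre F \<and> limitin (htopology C) (\<lambda>x. x) x F \<longrightarrow>
        limitin (htopology C) (rep_op pre a) (rep_op pre a x) F"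
      using pre_closable[OF _ x _ a] by blast
    fix \<psi> assume "\<forall>F. graph_cauchy A pre F \<and> limitin (htopology C) (\<lambda>x. x) x F \<longrightarrow>
        limitin (htopology C) (rep_op pre a) \<psi> F"
    then have "limitin (htopology C) (rep_op pre a) \<psi> (principal {x})" using constant_filter[OF x] by blast
    then show "\<psi> = rep_op pre a x"
      using C.limit_unique pre_closable[OF constant_filter(1)[OF x] x constant_filter(2)[OF x] a] nb by blast
  qed
qed

section \<open>The inducing representation inside the induced one\<close>

definition j :: "'k \<Rightarrow> ('a, 'k) ind_vector" where
  "j v = \<iota> (Poly_Mapping.single (\<one>, v) 1)"

lemma unit_in_FT: "v \<in> D \<Longrightarrow> Poly_Mapping.single (\<one>, v) 1 \<in> carrier FT"
  by (simp add: single_in_FT)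

lemma j_range: "v \<in> D \<Longrightarrow> j v \<in> pdom"
  unfolding j_def using unit_in_FT by blast

lemma j_carrier: "v \<in> D \<Longrightarrow> j v \<in> carrier C"
  using j_range range_carrier by blast

lemma tform_unit:
  assumes "k \<in> carrier A \<times> D" "w \<in> D"
  shows "tform k (\<one>, w) = cinner K (rep_op \<rho> (p (fst k)) (snd k)) w"
  using assms by (auto simp: tform_def star_one)

text \<open>Pairing with \<open>1 \<otimes> w\<close> sees only the expectations of the algebra elements.\<close>

lemma form_j_right:
  assumes f: "f \<in> carrier FT" and w: "w \<in> D"
  shows "cinner C (\<iota> f) (j w) = lsum f (\<lambda>k. cinner K (rep_op \<rho> (p (fst k)) (snd k)) w)"
proof -
  have "cinner C (\<iota> f) (j w) = lsum f (\<lambda>k. tform k (\<one>, w))"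
    unfolding j_def using f unit_in_FT[OF w] by (simp add: \<iota>_simps FT_form)
  also have "\<dots> = lsum f (\<lambda>k. cinner K (rep_op \<rho> (p (fst k)) (snd k)) w)"
    using keysD[OF f] w by (intro lsum_cong tform_unit)
  finally show ?thesis .
qed

lemma rho_one: "v \<in> D \<Longrightarrow> rep_op \<rho> \<one> v = v"
  using rho.op_one by simp

lemma j_form: "\<lbrakk>v \<in> D; w \<in> D\<rbrakk> \<Longrightarrow> cinner C (j v) (j w) = cinner K v w"
  using form_j_right[OF unit_in_FT, of v w] by (simp add: j_def[of v] p_one rho_one)

lemma dom_pre_hilbert: "pre_hilbert (K\<lparr>carrier := D\<rparr>)"
  by (rule rho.space.subspace_pre_hilbert[OF rho.dom_subspace])

lemma j_form_hom: "form_hom (K\<lparr>carrier := D\<rparr>) C j"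
proof (rule form_homI[OF _ C.pre_hilbert_axioms])
  show "hermitian_space (K\<lparr>carrier := D\<rparr>)" by (rule pre_hilbert_imp(1)[OF dom_pre_hilbert])
qed (simp_all add: j_carrier j_form)

lemma j_linear:
  "\<lbrakk>v \<in> D; w \<in> D\<rbrakk> \<Longrightarrow> j (v \<oplus>\<^bsub>K\<^esub> w) = j v \<oplus>\<^bsub>C\<^esub> j w"
  "v \<in> D \<Longrightarrow> j (c \<odot>\<^bsub>K\<^esub> v) = c \<odot>\<^bsub>C\<^esub> j v"
  "v \<in> D \<Longrightarrow> hnorm C (j v) = hnorm K v"
  "\<lbrakk>v \<in> D; w \<in> D\<rbrakk> \<Longrightarrow> j (v \<ominus>\<^bsub>K\<^esub> w) = j v \<ominus>\<^bsub>C\<^esub> j w"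
proof -
  show "j (v \<ominus>\<^bsub>K\<^esub> w) = j v \<ominus>\<^bsub>C\<^esub> j w" if "v \<in> D" "w \<in> D"
  proof -
    have "j (v \<ominus>\<^bsub>K\<lparr>carrier := D\<rparr>\<^esub> w) = j v \<ominus>\<^bsub>C\<^esub> j w"
      by (rule form_hom_minus[OF j_form_hom pre_hilbert_imp(2)[OF dom_pre_hilbert] pre_hilbert_imp(2)[OF C.pre_hilbert_axioms]])
        (simp_all add: that)
    then show ?thesis using rho.space.subspace_minus[OF rho.dom_subspace that] by simp
  qed
qed (use form_homD(2,3,5)[OF j_form_hom] in simp_all)

lemma j_inj: "inj_on j D"
  using form_hom_inj[OF j_form_hom dom_pre_hilbert] by simp

text \<open>This is the balanced relation \<open>1 a \<otimes> v = 1 \<otimes> \<rho>(a) v\<close>.\<close>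

lemma \<iota>_single_H:
  assumes a: "a \<in> part H" and v: "v \<in> D"
  shows "\<iota> (Poly_Mapping.single (a, v) 1) = j (rep_op \<rho> a v)"
proof (rule range_eqI)
  have aA: "a \<in> carrier A" using part_H_carrier[OF a] .
  note av = single_in_FT[OF aA v, of 1] and rv = unit_in_FT[OF rho_closed(1)[OF a v]]
  show "\<iota> (Poly_Mapping.single (a, v) 1) \<in> pdom" using av by blast
  show "j (rep_op \<rho> a v) \<in> pdom" using j_range[OF rho_closed(1)[OF a v]] .
  fix h assume h: "h \<in> carrier FT"
  have "tform (a, v) l = tform (\<one>, rep_op \<rho> a v) l" if "l \<in> Poly_Mapping.keys h" for l
    using tform_simps(5)[OF keysD[OF h that] one_closed v a] aA by simp
  then have "cinner FT (Poly_Mapping.single (a, v) 1) h = cinner FT (Poly_Mapping.single (\<one>, rep_op \<rho> a v) 1) h"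
    by (simp add: FT_form cong: lsum_cong)
  then show "cinner C (\<iota> (Poly_Mapping.single (a, v) 1)) (\<iota> h) = cinner C (j (rep_op \<rho> a v)) (\<iota> h)"
    unfolding j_def using av rv h by (simp add: \<iota>_simps)
qed

lemma pre_op_j:
  assumes a: "a \<in> part H" and v: "v \<in> D"
  shows "rep_op pre a (j v) = j (rep_op \<rho> a v)"
proof -
  have aA: "a \<in> carrier A" using part_H_carrier[OF a] .
  show ?thesis
    using pre_op[OF aA unit_in_FT[OF v]] \<iota>_single_H[OF a v] aA by (simp add: j_def)
qed

text \<open>The projection onto the part over \<open>H\<close> is \<open>a \<otimes> v \<mapsto> 1 \<otimes> \<rho>(p a) v\<close>.\<close>

definition q :: "('a \<times> 'k \<Rightarrow>\<^sub>0 complex) \<Rightarrow> 'k" where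
  "q f = vsum K f (\<lambda>k. rep_op \<rho> (p (fst k)) (snd k))"

lemma q_key:
  assumes "f \<in> carrier FT" "k \<in> Poly_Mapping.keys f"
  shows "rep_op \<rho> (p (fst k)) (snd k) \<in> D"
  using keysD[OF assms] by (auto intro!: rho_closed(1) p_closed)

lemma q_dom: "f \<in> carrier FT \<Longrightarrow> q f \<in> D"
  unfolding q_def by (rule rho.space.vsum_in_submodule[OF rho.dom_subspace]) (rule q_key)

lemma form_q:
  assumes f: "f \<in> carrier FT" and w: "w \<in> carrier K"
  shows "cinner K (q f) w = lsum f (\<lambda>k. cinner K (rep_op \<rho> (p (fst k)) (snd k)) w)"
  unfolding q_def using q_key[OF f] rho.dom_facts(1) w by (intro rho.space.form_vsum_left) auto

lemma q_left_mult:
  assumes a: "a \<in> part H" and f: "f \<in> carrier FT"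
  shows "q (left_mult A a f) = rep_op \<rho> a (q f)"
proof (rule rho.space.eq_by_form)
  have aA: "a \<in> carrier A" using part_H_carrier[OF a] .
  note af = left_mult_in_FT[OF aA f]
  show "q (left_mult A a f) \<in> carrier K" "rep_op \<rho> a (q f) \<in> carrier K"
    using q_dom[OF af] rho.dom_facts(1) rho_closed(2)[OF a q_dom[OF f]] by auto
  fix z assume z: "z \<in> carrier K"
  have "rep_op \<rho> a (q f) = vsum K f (\<lambda>k. rep_op \<rho> a (rep_op \<rho> (p (fst k)) (snd k)))"
    unfolding q_def by (rule rho.op_vsum) (use a q_key[OF f] in auto)
  then have "cinner K (rep_op \<rho> a (q f)) z = lsum f (\<lambda>k. cinner K (rep_op \<rho> a (rep_op \<rho> (p (fst k)) (snd k))) z)"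
    using rho_closed(2)[OF a q_key[OF f]] z by (simp add: rho.space.form_vsum_left)
  also have "\<dots> = lsum f (\<lambda>k. cinner K (rep_op \<rho> (p (a \<otimes> fst k)) (snd k)) z)"
  proof (rule lsum_cong)
    fix k assume k: "k \<in> Poly_Mapping.keys f"
    have "fst k \<in> carrier A" "snd k \<in> D" using keysD[OF f k] by auto
    then show "cinner K (rep_op \<rho> a (rep_op \<rho> (p (fst k)) (snd k))) z = cinner K (rep_op \<rho> (p (a \<otimes> fst k)) (snd k)) z"
      using rho.op_mult[of a "p (fst k)" "snd k"] a p_closed by (simp add: p_mult_left)
  qed
  also have "\<dots> = cinner K (q (left_mult A a f)) z"
    unfolding form_q[OF af z] lsum_left_mult by (simp add: case_prod_unfold)
  finally show "cinner K (q (left_mult A a f)) z = cinner K (rep_op \<rho> a (q f)) z" by simp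
qed

abbreviation PH where "PH \<equiv> induced_projection G H A \<A> \<rho> H"

text \<open>The vectors \<open>1 \<otimes> w\<close> span the closed subspace onto which \<open>PH\<close> projects, and by
  \<open>form_j_right\<close> the difference of \<open>\<iota> f\<close> and \<open>j (q f)\<close> is orthogonal to all of them.\<close>

lemma PH_\<iota>:
  assumes f: "f \<in> carrier FT"
  shows "PH (\<iota> f) = j (q f)"
proof -
  let ?g = "{\<iota> (Poly_Mapping.single (a, v) 1) |a v. a \<in> part H \<and> v \<in> D}"
  have g: "?g \<subseteq> j ` D" using \<iota>_single_H rho_closed(1) by blast
  have "j ` D \<subseteq> carrier C" using j_carrier by blast
  then have gC: "?g \<subseteq> carrier C" by (rule subset_trans[OF g])
  note M = C.closure_span_facts[OF gC]
  have "j (q f) \<in> ?g" unfolding j_def using one_in_part_H q_dom[OF f] by blast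
  then have "j (q f) \<in> htopology C closure_of lspan C ?g" using M(3) by blast
  moreover have "cinner C (\<iota> f \<ominus>\<^bsub>C\<^esub> j (q f)) z = 0" if z: "z \<in> htopology C closure_of lspan C ?g" for z
  proof (rule C.orthogonal_closure_span[OF gC _ _ z])
    show "\<iota> f \<ominus>\<^bsub>C\<^esub> j (q f) \<in> carrier C" using \<iota>_simps(1)[OF f] j_carrier[OF q_dom[OF f]] by simp
    fix z assume "z \<in> ?g"
    then obtain w where w: "w \<in> D" "z = j w" using g by blast
    have "cinner C (\<iota> f) (j w) = cinner C (j (q f)) (j w)"
      using form_j_right[OF f w(1)] form_q[OF f, of w] j_form[OF q_dom[OF f] w(1)] rho.dom_facts(1)[OF w(1)] by simp
    then show "cinner C (\<iota> f \<ominus>\<^bsub>C\<^esub> j (q f)) z = 0"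
      using w j_carrier \<iota>_simps(1)[OF f] q_dom[OF f] by (simp add: C.form_minus_left)
  qed
  ultimately have "orth_proj C (htopology C closure_of lspan C ?g) (\<iota> f) = j (q f)"
    by (intro C.orth_proj_eq \<iota>_simps(1)[OF f] M(2)) auto
  then show ?thesis by (simp add: induced_projection_def Ind_space Let_def)
qed

lemma PH_j: assumes v: "v \<in> D" shows "PH (j v) = j v"
proof -
  have "q (Poly_Mapping.single (\<one>, v) 1) = v"
    using rho.dom_facts(1)[OF v] rho_one[OF v] by (simp add: q_def vsum_def p_one)
  then show ?thesis using PH_\<iota>[OF unit_in_FT[OF v]] by (simp add: j_def)
qed

end

section \<open>Uniqueness\<close>

text \<open>Compose one equivalence with the inverse of the other.\<close>

lemma unitarily_equivalent_via:
  assumes r1: "star_rep B \<rho>1" and r2: "star_rep B \<rho>2" and s: "star_rep B \<sigma>"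
    and e1: "unitarily_equivalent B \<rho>1 \<sigma>" and e2: "unitarily_equivalent B \<rho>2 \<sigma>"
  shows "unitarily_equivalent B \<rho>1 \<rho>2"
proof -
  interpret r1: star_rep B \<rho>1 by fact
  interpret r2: star_rep B \<rho>2 by fact
  interpret s: star_rep B \<sigma> by fact
  obtain V1 where V1: "implements_equivalence B \<rho>1 \<sigma> V1" using e1 by (auto simp: unitarily_equivalent_def)
  obtain V2 where V2: "implements_equivalence B \<rho>2 \<sigma> V2" using e2 by (auto simp: unitarily_equivalent_def)
  have facts: "inj_on V (rep_dom \<rho>)"
    "\<And>a v. \<lbrakk>a \<in> carrier B; v \<in> rep_dom \<rho>\<rbrakk> \<Longrightarrow> rep_op \<sigma> a (V v) = V (rep_op \<rho> a v)"
    if V: "implements_equivalence B \<rho> \<sigma> V" and r: "star_rep B \<rho>" for \<rho> :: "('a, 'x) rep" and V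
  proof -
    interpret r: star_rep B \<rho> by fact
    have lin: "linear_on (rep_dom \<rho>) (rep_space \<rho>) (rep_space \<sigma>) V" and im: "V ` rep_dom \<rho> = rep_dom \<sigma>"
      and norm: "\<And>x. x \<in> rep_dom \<rho> \<Longrightarrow> hnorm (rep_space \<sigma>) (V x) = hnorm (rep_space \<rho>) x"
      using V by (auto simp: implements_equivalence_def isometry_onto_def)
    have VH: "V ` rep_dom \<rho> \<subseteq> carrier (rep_space \<sigma>)" using im s.dom_facts(1) by blast
    show inj: "inj_on V (rep_dom \<rho>)"
    proof (rule inj_onI)
      fix v w assume vw: "v \<in> rep_dom \<rho>" "w \<in> rep_dom \<rho>" "V v = V w"
      have "V (v \<ominus>\<^bsub>rep_space \<rho>\<^esub> w) = V v \<ominus>\<^bsub>rep_space \<sigma>\<^esub> V w"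
        by (rule linear_on_minus[OF _ _ r.dom_subspace lin VH vw(1,2)]) unfold_locales
      also have "\<dots> = \<zero>\<^bsub>rep_space \<sigma>\<^esub>"
        using vw VH s.space.minus_eq_zero_iff[of "V v" "V w"] by blast
      finally have "hnorm (rep_space \<rho>) (v \<ominus>\<^bsub>rep_space \<rho>\<^esub> w) = 0"
        using norm[OF r.dom_facts(5)[OF vw(1,2)]] by simp
      then show "v = w"
        using r.dom_facts(1) vw(1,2) by (simp add: r.space.hnorm_eq_0_iff r.space.minus_eq_zero_iff)
    qed
    fix a v assume "a \<in> carrier B" and v: "v \<in> rep_dom \<rho>"
    then have "rep_op \<sigma> a (V v) = V (rep_op \<rho> a (inv_into (rep_dom \<rho>) V (V v)))"
      using V im unfolding implements_equivalence_def by blast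
    then show "rep_op \<sigma> a (V v) = V (rep_op \<rho> a v)" using inv_into_f_f[OF inj v] by simp
  qed
  have f1: "linear_on (rep_dom \<rho>1) (rep_space \<rho>1) (rep_space \<sigma>) V1" "V1 ` rep_dom \<rho>1 = rep_dom \<sigma>"
      "\<And>x. x \<in> rep_dom \<rho>1 \<Longrightarrow> hnorm (rep_space \<sigma>) (V1 x) = hnorm (rep_space \<rho>1) x"
    using V1 by (auto simp: implements_equivalence_def isometry_onto_def)
  have f2: "linear_on (rep_dom \<rho>2) (rep_space \<rho>2) (rep_space \<sigma>) V2" "V2 ` rep_dom \<rho>2 = rep_dom \<sigma>"
      "\<And>x. x \<in> rep_dom \<rho>2 \<Longrightarrow> hnorm (rep_space \<sigma>) (V2 x) = hnorm (rep_space \<rho>2) x"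
    using V2 by (auto simp: implements_equivalence_def isometry_onto_def)
  note g1 = facts[OF V1 r1] and g2 = facts[OF V2 r2]
  define W where "W = (\<lambda>v. inv_into (rep_dom \<rho>2) V2 (V1 v))"
  have W: "W v \<in> rep_dom \<rho>2" "V2 (W v) = V1 v" if "v \<in> rep_dom \<rho>1" for v
  proof -
    have "V1 v \<in> V2 ` rep_dom \<rho>2" using that f1(2) f2(2) by blast
    then show "W v \<in> rep_dom \<rho>2" "V2 (W v) = V1 v"
      by (simp_all add: W_def inv_into_into f_inv_into_f)
  qed
  have W_eq: "W v = w" if "v \<in> rep_dom \<rho>1" "w \<in> rep_dom \<rho>2" "V2 w = V1 v" for v w
    using that W inj_onD[OF g2(1)] by metis
  have "implements_equivalence B \<rho>1 \<rho>2 W"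
    unfolding implements_equivalence_def isometry_onto_def
  proof (intro conjI ballI)
    show "linear_on (rep_dom \<rho>1) (rep_space \<rho>1) (rep_space \<rho>2) W"
      unfolding linear_on_def
    proof (intro conjI ballI allI)
      fix v w c assume v: "v \<in> rep_dom \<rho>1"
      show "W (c \<odot>\<^bsub>rep_space \<rho>1\<^esub> v) = c \<odot>\<^bsub>rep_space \<rho>2\<^esub> W v"
        using W[OF v] v r1.dom_facts(4) r2.dom_facts(4) f1(1) f2(1) by (intro W_eq) (auto simp: linear_on_def)
      assume w: "w \<in> rep_dom \<rho>1"
      show "W (v \<oplus>\<^bsub>rep_space \<rho>1\<^esub> w) = W v \<oplus>\<^bsub>rep_space \<rho>2\<^esub> W w"
        using W[OF v] W[OF w] v w r1.dom_facts(3) r2.dom_facts(3) f1(1) f2(1)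
        by (intro W_eq) (auto simp: linear_on_def)
    qed
    show "hnorm (rep_space \<rho>2) (W v) = hnorm (rep_space \<rho>1) v" if "v \<in> rep_dom \<rho>1" for v
      using f2(3)[OF W(1)[OF that]] f1(3)[OF that] W(2)[OF that] by simp
    show onto: "W ` rep_dom \<rho>1 = rep_dom \<rho>2"
    proof
      show "W ` rep_dom \<rho>1 \<subseteq> rep_dom \<rho>2" using W(1) by blast
      show "rep_dom \<rho>2 \<subseteq> W ` rep_dom \<rho>1"
      proof
        fix w assume w: "w \<in> rep_dom \<rho>2"
        then obtain v where "v \<in> rep_dom \<rho>1" "V2 w = V1 v" using f1(2) f2(2) by (metis imageE imageI)
        then show "w \<in> W ` rep_dom \<rho>1" using W_eq w by (metis imageI)
      qed
    qed
    fix a \<psi> assume a: "a \<in> carrier B" and "\<psi> \<in> rep_dom \<rho>2"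
    then have im: "\<psi> \<in> W ` rep_dom \<rho>1" using onto by simp
    let ?v = "inv_into (rep_dom \<rho>1) W \<psi>"
    have v: "?v \<in> rep_dom \<rho>1" "W ?v = \<psi>" using im by (simp_all add: inv_into_into f_inv_into_f)
    have "V2 (rep_op \<rho>2 a \<psi>) = V1 (rep_op \<rho>1 a ?v)"
      using g1(2)[OF a v(1)] g2(2)[OF a W(1)[OF v(1)]] W(2)[OF v(1)] v(2) by simp
    then show "rep_op \<rho>2 a \<psi> = W (rep_op \<rho>1 a ?v)"
      using W_eq[OF r1.op_closed[OF a v(1)] r2.op_closed[OF a W(1)[OF v(1)]]] v(2) by simp
  qed
  then show ?thesis by (auto simp: unitarily_equivalent_def)
qed

text \<open>The equivalence sends \<open>v\<close> to the vector that corresponds to \<open>1 \<otimes> v\<close> under the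
  given equivalence \<open>U\<close> of the system with the induced one.\<close>

lemma (in imprimitivity) inducing_rep_unique:
  fixes \<rho> :: "('a, 'k) rep"
  assumes "induces_system G H A \<A> \<pi> E \<rho>"
  shows "unitarily_equivalent B \<rho> \<rho>0"
proof -
  have rep: "star_rep B \<rho>" and cl: "closed_rep B \<rho>" and ind: "inducible G H A \<A> \<rho>"
    and eqv: "systems_equivalent G H A \<pi> E (induced_rep G H A \<A> \<rho>) (induced_projection G H A \<A> \<rho>)"
    using assms by (simp_all add: induces_system_def)
  interpret I: inducible_data G A \<A> H \<rho>
    by (intro inducible_data.intro induction_data.intro graded_algebra_subgroup_axioms rep
      inducible_data_axioms.intro ind)
  obtain U where U: "isometry_onto Hs (carrier Hs) I.C (carrier I.C) U"
    and Ueq: "implements_equivalence A \<pi> I.Ind U"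
    and UE: "\<And>t x. \<lbrakk>t \<in> cosets; x \<in> carrier Hs\<rbrakk> \<Longrightarrow> U (E t x) = induced_projection G H A \<A> \<rho> t (U x)"
    using eqv unfolding systems_equivalent_def I.Ind_space by blast
  have Ulin: "linear_on (carrier Hs) Hs I.C U" and Unorm: "\<And>x. x \<in> carrier Hs \<Longrightarrow> hnorm I.C (U x) = hnorm Hs x"
    and Uonto: "U ` carrier Hs = carrier I.C"
    using U by (auto simp: isometry_onto_def)
  have UC: "U x \<in> carrier I.C" if "x \<in> carrier Hs" for x using Uonto that by blast
  have Uminus: "U (x \<ominus>\<^bsub>Hs\<^esub> y) = U x \<ominus>\<^bsub>I.C\<^esub> U y" if "x \<in> carrier Hs" "y \<in> carrier Hs" for x y
    by (rule linear_on_minus[OF _ _ pi.space.carrier_submodule Ulin _ that]) (unfold_locales, use UC in blast)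
  have Uinj: "x = y" if "U x = U y" "x \<in> carrier Hs" "y \<in> carrier Hs" for x y
  proof -
    have "U (x \<ominus>\<^bsub>Hs\<^esub> y) = \<zero>\<^bsub>I.C\<^esub>" using Uminus[OF that(2,3)] that UC I.C.minus_eq_zero_iff by simp
    then have "hnorm Hs (x \<ominus>\<^bsub>Hs\<^esub> y) = 0" using Unorm[of "x \<ominus>\<^bsub>Hs\<^esub> y"] that by simp
    then show ?thesis using that by (simp add: pi.space.hnorm_eq_0_iff pi.space.minus_eq_zero_iff)
  qed
  have Udom: "U ` Dom = rep_dom I.Ind" using Ueq by (simp add: implements_equivalence_def isometry_onto_def)
  have injD: "inj_on U Dom" using Uinj pi.dom_facts(1) by (auto intro: inj_onI)
  have Uop: "rep_op I.Ind a (U \<phi>) = U (rep_op \<pi> a \<phi>)" if "a \<in> carrier A" "\<phi> \<in> Dom" for a \<phi>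
  proof -
    have "rep_op I.Ind a (U \<phi>) = U (rep_op \<pi> a (inv_into Dom U (U \<phi>)))"
      using Ueq Udom that unfolding implements_equivalence_def by blast
    then show ?thesis using inv_into_f_f[OF injD that(2)] by simp
  qed
  \<comment> \<open>Transported along \<open>U\<close>, \<open>E H\<close> shows that the induced projection is a contraction.\<close>
  have PH_contract: "I.PH x \<in> carrier I.C" "hnorm I.C (I.PH x \<ominus>\<^bsub>I.C\<^esub> I.PH y) \<le> hnorm I.C (x \<ominus>\<^bsub>I.C\<^esub> y)"
    if x: "x \<in> carrier I.C" and y: "y \<in> carrier I.C" for x y
  proof -
    obtain u w where u: "u \<in> carrier Hs" "x = U u" and w: "w \<in> carrier Hs" "y = U w"
      using x y Uonto by (metis imageE)
    note Eu = E_facts(1)[OF H_coset u(1)] and Ew = E_facts(1)[OF H_coset w(1)]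
    have P: "I.PH x = U (E H u)" "I.PH y = U (E H w)" using UE[OF H_coset] u w by simp_all
    show "I.PH x \<in> carrier I.C" using P UC Eu by simp
    have "hnorm I.C (I.PH x \<ominus>\<^bsub>I.C\<^esub> I.PH y) = hnorm Hs (E H (u \<ominus>\<^bsub>Hs\<^esub> w))"
      using P Uminus[OF Eu Ew] Unorm[of "E H u \<ominus>\<^bsub>Hs\<^esub> E H w"] E_facts(4)[OF H_coset u(1) w(1)] Eu Ew by simp
    also have "\<dots> \<le> hnorm Hs (u \<ominus>\<^bsub>Hs\<^esub> w)" using E_norm_le[OF H_coset] u(1) w(1) by simp
    also have "\<dots> = hnorm I.C (x \<ominus>\<^bsub>I.C\<^esub> y)"
      using Uminus[OF u(1) w(1)] Unorm[of "u \<ominus>\<^bsub>Hs\<^esub> w"] u w by simp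
    finally show "hnorm I.C (I.PH x \<ominus>\<^bsub>I.C\<^esub> I.PH y) \<le> hnorm I.C (x \<ominus>\<^bsub>I.C\<^esub> y)" .
  qed
  define V where "V = (\<lambda>v. inv_into Dom U (I.j v))"
  have V: "V v \<in> DH" "U (V v) = I.j v" if v: "v \<in> I.D" for v
  proof -
    have "I.j v \<in> U ` Dom" using I.Ind_extends_pre(1)[OF I.j_range[OF v]] Udom by simp
    then have VD: "V v \<in> Dom" and UV: "U (V v) = I.j v" by (simp_all add: V_def inv_into_into f_inv_into_f)
    note VH = pi.dom_facts(1)[OF VD]
    have "U (E H (V v)) = U (V v)" using UE[OF H_coset VH] UV I.PH_j[OF v] by simp
    then have "E H (V v) = V v" using Uinj E_facts(1)[OF H_coset VH] VH by blast
    then show "V v \<in> DH" "U (V v) = I.j v" using VD UV sys_dom_iff[OF H_coset] by simp_all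
  qed
  note d = sys_dom_closed[OF H_coset]
  have VH: "V v \<in> carrier Hs" if "v \<in> I.D" for v using d(2)[OF V(1)[OF that]] .
  have V_eq: "V v = x" if "v \<in> I.D" "x \<in> carrier Hs" "U x = I.j v" for v x
    using Uinj V(2)[OF that(1)] VH[OF that(1)] that by simp
  \<comment> \<open>Surjectivity is where closedness of \<open>\<rho>\<close> enters: apply the projection to a filter that
    defines a vector of the closure.\<close>
  have onto: "DH \<subseteq> V ` I.D"
  proof
    fix x assume x: "x \<in> DH"
    note xH = d(2)[OF x]
    have "U x \<in> rep_dom I.Ind" using Udom d(1)[OF x] by blast
    then obtain F where F: "graph_cauchy A I.pre F" "limitin (htopology I.C) (\<lambda>x. x) (U x) F"
      by (rule I.Ind_domE)
    have PHx: "I.PH (U x) = U x" using UE[OF H_coset xH] d(3)[OF x] by simp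
    \<comment> \<open>On the vectors \<open>\<iota> f\<close> this is \<open>q f\<close>: the projection, read in the domain of \<open>\<rho>\<close>.\<close>
    define g where "g = (\<lambda>y. inv_into I.D I.j (I.PH y))"
    have g\<iota>: "g (I.\<iota> f) = I.q f" if "f \<in> carrier I.FT" for f
      using I.PH_\<iota>[OF that] inv_into_f_f[OF I.j_inj I.q_dom[OF that]] by (simp add: g_def)
    have gD: "g y \<in> I.D" "I.j (g y) = I.PH y" if "y \<in> I.pdom" for y
      using that g\<iota> I.q_dom I.PH_\<iota> by auto
    have gop: "I.j (rep_op \<rho> a (g y)) = I.PH (rep_op I.pre a y)" if a: "a \<in> part H" and y: "y \<in> I.pdom" for a y
    proof -
      obtain f where f: "f \<in> carrier I.FT" "y = I.\<iota> f" using y by blast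
      have aA: "a \<in> carrier A" using part_H_carrier[OF a] .
      show ?thesis
        using I.pre_op[OF aA f(1)] I.PH_\<iota>[OF I.left_mult_in_FT[OF aA f(1)]] I.q_left_mult[OF a f(1)] g\<iota>[OF f(1)] f(2)
        by simp
    qed
    have gn: "graph_norm \<rho> a (g y \<ominus>\<^bsub>I.K\<^esub> g z) \<le> graph_norm I.pre a (y \<ominus>\<^bsub>I.C\<^esub> z)"
      if a: "a \<in> part H" and y: "y \<in> I.pdom" and z: "z \<in> I.pdom" for a y z
    proof -
      have aA: "a \<in> carrier A" using part_H_carrier[OF a] .
      note ra = I.rho_closed(1)[OF a gD(1)[OF y]] I.rho_closed(1)[OF a gD(1)[OF z]]
      have "hnorm I.K (g y \<ominus>\<^bsub>I.K\<^esub> g z) = hnorm I.C (I.PH y \<ominus>\<^bsub>I.C\<^esub> I.PH z)"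
        using I.j_linear(3)[OF I.rho.dom_facts(5)[OF gD(1)[OF y] gD(1)[OF z]]]
          I.j_linear(4)[OF gD(1)[OF y] gD(1)[OF z]] gD(2)[OF y] gD(2)[OF z] by simp
      also have "\<dots> \<le> hnorm I.C (y \<ominus>\<^bsub>I.C\<^esub> z)"
        using I.range_carrier[OF y] I.range_carrier[OF z] by (rule PH_contract(2))
      finally have 1: "hnorm I.K (g y \<ominus>\<^bsub>I.K\<^esub> g z) \<le> hnorm I.C (y \<ominus>\<^bsub>I.C\<^esub> z)" .
      have "hnorm I.K (rep_op \<rho> a (g y) \<ominus>\<^bsub>I.K\<^esub> rep_op \<rho> a (g z))
          = hnorm I.C (I.PH (rep_op I.pre a y) \<ominus>\<^bsub>I.C\<^esub> I.PH (rep_op I.pre a z))"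
        using I.j_linear(3)[OF I.rho.dom_facts(5)[OF ra]] I.j_linear(4)[OF ra] gop[OF a y] gop[OF a z] by simp
      also have "\<dots> \<le> hnorm I.C (rep_op I.pre a y \<ominus>\<^bsub>I.C\<^esub> rep_op I.pre a z)"
        using I.range_carrier[OF I.pre_closed[OF aA y]] I.range_carrier[OF I.pre_closed[OF aA z]] by (rule PH_contract(2))
      finally have 2: "hnorm I.K (rep_op \<rho> a (g y) \<ominus>\<^bsub>I.K\<^esub> rep_op \<rho> a (g z))
          \<le> hnorm I.C (rep_op I.pre a y \<ominus>\<^bsub>I.C\<^esub> rep_op I.pre a z)" .
      have "graph_norm \<rho> a (g y \<ominus>\<^bsub>I.K\<^esub> g z)
          = hnorm I.K (g y \<ominus>\<^bsub>I.K\<^esub> g z) + hnorm I.K (rep_op \<rho> a (g y) \<ominus>\<^bsub>I.K\<^esub> rep_op \<rho> a (g z))"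
        using I.rho.graph_norm_minus[of a "g y" "g z"] a gD(1)[OF y] gD(1)[OF z] by simp
      also have "\<dots> \<le> graph_norm I.pre a (y \<ominus>\<^bsub>I.C\<^esub> z)"
        unfolding graph_norm_def I.pre_simps(1) I.pre_minus[OF aA y z] using 1 2 by (rule add_mono)
      finally show ?thesis .
    qed
    have dom: "\<forall>\<^sub>F y in F. y \<in> I.pdom" and nb: "F \<noteq> bot"
      using F(1) by (simp_all add: graph_cauchy_iff I.pre_simps)
    have "graph_cauchy B \<rho> (filtermap g F)"
      using gD(1) gn part_H_carrier by (intro graph_cauchy_image[OF F(1) dom]) (auto simp: I.pre_simps(1))
    then obtain v0 where "limitin (graph_topology B \<rho>) (\<lambda>x. x) v0 (filtermap g F)"
      using cl unfolding closed_rep_def by blast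
    moreover have ne: "carrier B \<noteq> {}" using one_in_part_H by auto
    ultimately have v0: "v0 \<in> I.D" and lim0: "\<And>a \<epsilon>. \<lbrakk>a \<in> carrier B; 0 < \<epsilon>\<rbrakk> \<Longrightarrow>
        \<forall>\<^sub>F y in F. g y \<in> I.D \<and> graph_norm \<rho> a (g y \<ominus>\<^bsub>I.K\<^esub> v0) < \<epsilon>"
      unfolding I.rho.limitin_graph_iff[OF ne] eventually_filtermap by blast+
    have "limitin (htopology I.C) I.PH (I.j v0) F"
      unfolding I.C.limitin_htopology_iff
    proof (intro conjI allI impI I.j_carrier v0)
      fix \<epsilon> :: real assume "0 < \<epsilon>"
      moreover have "\<one> \<in> carrier B" using one_in_part_H by simp
      ultimately have "\<forall>\<^sub>F y in F. g y \<in> I.D \<and> graph_norm \<rho> \<one> (g y \<ominus>\<^bsub>I.K\<^esub> v0) < \<epsilon>" by (intro lim0)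
      then show "\<forall>\<^sub>F y in F. I.PH y \<in> carrier I.C \<and> hnorm I.C (I.PH y \<ominus>\<^bsub>I.C\<^esub> I.j v0) < \<epsilon>"
        using dom
      proof eventually_elim
        case (elim y)
        then have y: "g y \<in> I.D" "y \<in> I.pdom" by auto
        note dv = I.rho.dom_facts(5)[OF y(1) v0]
        have "hnorm I.K (g y \<ominus>\<^bsub>I.K\<^esub> v0) \<le> graph_norm \<rho> \<one> (g y \<ominus>\<^bsub>I.K\<^esub> v0)"
          using I.rho_closed(2)[OF one_in_part_H dv] by (simp add: graph_norm_def)
        then have "hnorm I.C (I.j (g y) \<ominus>\<^bsub>I.C\<^esub> I.j v0) < \<epsilon>"
          using I.j_linear(3)[OF dv] I.j_linear(4)[OF y(1) v0] elim(1) by simp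
        then show ?case using gD(2)[OF y(2)] I.j_carrier[OF y(1)] by simp
      qed
    qed
    moreover have "limitin (htopology I.C) I.PH (U x) F"
      unfolding I.C.limitin_htopology_iff
    proof (intro conjI allI impI UC xH)
      fix \<epsilon> :: real assume "0 < \<epsilon>"
      then have "\<forall>\<^sub>F y in F. y \<in> carrier I.C \<and> hnorm I.C (y \<ominus>\<^bsub>I.C\<^esub> U x) < \<epsilon>"
        using F(2) unfolding I.C.limitin_htopology_iff by blast
      then show "\<forall>\<^sub>F y in F. I.PH y \<in> carrier I.C \<and> hnorm I.C (I.PH y \<ominus>\<^bsub>I.C\<^esub> U x) < \<epsilon>"
      proof eventually_elim
        case (elim y)
        then show ?case using PH_contract[of y "U x"] UC[OF xH] PHx by simp
      qed
    qed
    ultimately have "I.j v0 = U x" using I.C.limit_unique nb by blast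
    then have "V v0 = x" using V_eq[OF v0 xH] by simp
    then show "x \<in> V ` I.D" using v0 by blast
  qed
  have "implements_equivalence B \<rho> \<rho>0 V"
    unfolding implements_equivalence_def isometry_onto_def \<rho>0_simps
  proof (intro conjI ballI)
    show "linear_on I.D I.K HE V"
      unfolding linear_on_def
    proof (intro conjI ballI allI)
      fix v w c assume v: "v \<in> I.D"
      have "V (c \<odot>\<^bsub>I.K\<^esub> v) = c \<odot>\<^bsub>Hs\<^esub> V v"
        using v V(2)[OF v] VH[OF v] Ulin I.rho.dom_facts(4) I.j_linear(2) by (intro V_eq) (auto simp: linear_on_def)
      then show "V (c \<odot>\<^bsub>I.K\<^esub> v) = c \<odot>\<^bsub>HE\<^esub> V v" by simp
      assume w: "w \<in> I.D"
      have "V (v \<oplus>\<^bsub>I.K\<^esub> w) = V v \<oplus>\<^bsub>Hs\<^esub> V w"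
        using v w V(2)[OF v] V(2)[OF w] VH[OF v] VH[OF w] Ulin I.rho.dom_facts(3) I.j_linear(1)
        by (intro V_eq) (auto simp: linear_on_def)
      then show "V (v \<oplus>\<^bsub>I.K\<^esub> w) = V v \<oplus>\<^bsub>HE\<^esub> V w" by simp
    qed
    show "hnorm HE (V v) = hnorm I.K v" if v: "v \<in> I.D" for v
      using Unorm[OF VH[OF v]] V(2)[OF v] I.j_linear(3)[OF v] by simp
    show im: "V ` I.D = DH" using onto V(1) by blast
    fix a \<psi> assume "a \<in> carrier B" and "\<psi> \<in> DH"
    then have a: "a \<in> part H" "a \<in> carrier A" using part_H_carrier by simp_all
    let ?v = "inv_into I.D V \<psi>"
    have v: "?v \<in> I.D" "V ?v = \<psi>" using im \<open>\<psi> \<in> DH\<close> by (simp_all add: inv_into_into f_inv_into_f)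
    have "U (rep_op \<pi> a \<psi>) = rep_op I.Ind a (I.j ?v)"
      using Uop[OF a(2) d(1)[OF \<open>\<psi> \<in> DH\<close>]] V(2)[OF v(1)] v(2) by simp
    also have "\<dots> = I.j (rep_op \<rho> a ?v)"
      using I.Ind_extends_pre(2)[OF I.j_range[OF v(1)] a(2)] I.pre_op_j[OF a(1) v(1)] by simp
    finally have "V (rep_op \<rho> a ?v) = rep_op \<pi> a \<psi>"
      using I.rho_closed(1)[OF a(1) v(1)] pi.op_in_carrier[OF a(2) d(1)[OF \<open>\<psi> \<in> DH\<close>]] by (intro V_eq)
    then show "rep_op \<pi> a \<psi> = V (rep_op \<rho> a ?v)" by simp
  qed
  then show ?thesis by (auto simp: unitarily_equivalent_def)
qed

theorem theorem1:
  fixes G :: "('g, 'm) monoid_scheme" and H :: "'g set"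
    and A :: "'a star_alg" and \<A> :: "'g \<Rightarrow> 'a set"
    and \<pi> :: "('a, 'h) rep" and E :: "'g set \<Rightarrow> 'h \<Rightarrow> 'h"
  assumes "group G" and "subgroup H G"
    and "graded_star_algebra G A \<A>"
    and "star_rep A \<pi>" and "closed_rep A \<pi>"
    and "system_of_imprimitivity G H A \<A> \<pi> E"
    and "nondegenerate_system G H A \<A> \<pi> E"
  shows "(\<exists>\<rho> :: ('a, 'h) rep. induces_system G H A \<A> \<pi> E \<rho>) \<and>
         (\<forall>(\<rho>1 :: ('a, 'k) rep) (\<rho>2 :: ('a, 'l) rep).
            induces_system G H A \<A> \<pi> E \<rho>1 \<and> induces_system G H A \<A> \<pi> E \<rho>2 \<longrightarrow>
            unitarily_equivalent (graded_subalgebra A \<A> H) \<rho>1 \<rho>2)"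
proof -
  interpret nondegenerate_imprimitivity G A \<A> H \<pi> E
    using assms by (intro nondegenerate_imprimitivity.intro imprimitivity.intro
        graded_algebra_subgroup.intro imprimitivity_axioms.intro nondegenerate_imprimitivity_axioms.intro)
  have "unitarily_equivalent B \<rho>1 \<rho>2"
    if 1: "induces_system G H A \<A> \<pi> E \<rho>1" and 2: "induces_system G H A \<A> \<pi> E \<rho>2"
    for \<rho>1 :: "('a, 'k) rep" and \<rho>2 :: "('a, 'l) rep"
  proof (rule unitarily_equivalent_via)
    show "star_rep B \<rho>1" "star_rep B \<rho>2" using 1 2 by (simp_all add: induces_system_def)
  qed (rule star_rep_\<rho>0 inducing_rep_unique[OF 1] inducing_rep_unique[OF 2])+
  then show ?thesis using induces by blast
qed

end
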